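(* For every sufficiently large population size $N$ there exists a connected, undirected, edge-weighted graph $A_N$ on $N$ nodes such that for all $r\in(1,1.2)$, \[ \rho^{\mathrm{Bd}}_r(A_N)>\rho^{\mathrm{Bd}}_r(K_N)\quad\text{and}\quad \rho^{\mathrm{dB}}_r(A_N)>\rho^{\mathrm{dB}}_r(K_N). \]
   Context: Each edge $\{u,v\}$ has a positive weight $w(u,v)$ and $\deg(u)=\sum_v w(u,v)$. Each node is occupied by a resident (fitness 1) or a mutant (fitness $r\ge1$); $f(u)$ is the fitness at $u$, $F=\sum_u f(u)$. Moran Birth-death (Bd) process: each step a node $u$ is chosen with probability $f(u)/F$ and its offspring replaces a neighbor $v$ chosen with probability $w(u,v)/\deg(u)$. Moran death-Birth (dB) process: each step a uniformly random node $v$ dies and is replaced by the offspring of a neighbor $u$ chosen with probability $f(u)w(u,v)/\sum_{u'}f(u')w(u',v)$. For a graph $G_N$ and process $p$, $\rho^p_r(G_N)=\frac1N\sum_{v}\rho^p_r(G_N,\{v\})$, where $\rho^p_r(G_N,\{v\})$ is the probability that mutants eventually occupy all nodes when initially only $v$ is a mutant. $K_N$ is the unweighted complete graph on $N$ nodes, for which $\rho^{\mathrm{Bd}}_r(K_N)=\frac{1-1/r}{1-1/r^N}$ and $\rho^{\mathrm{dB}}_r(K_N)=\frac{N-1}{N}\cdot\frac{1-1/r}{1-1/r^{N-1}}$. *)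

theory Defs
  imports Complex_Main
begin

text \<open>Nodes of a graph on N nodes are 0..<N. An edge-weighted undirected graph is
  a weight function w; {u,v} is an edge iff w u v > 0 (weights of edges positive,
  non-edges have weight 0, no self-loops, symmetric).\<close>

definition weighted_graph :: "nat \<Rightarrow> (nat \<Rightarrow> nat \<Rightarrow> real) \<Rightarrow> bool" where
  "weighted_graph N w \<longleftrightarrow>
     (\<forall>u<N. \<forall>v<N. w u v = w v u \<and> w u v \<ge> 0) \<and> (\<forall>u<N. w u u = 0)"

definition graph_connected :: "nat \<Rightarrow> (nat \<Rightarrow> nat \<Rightarrow> real) \<Rightarrow> bool" where
  "graph_connected N w \<longleftrightarrow>
     (\<forall>u<N. \<forall>v<N. (u, v) \<in> ({(a, b). a < N \<and> b < N \<and> w a b > 0})\<^sup>*)"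

definition complete_graph :: "nat \<Rightarrow> nat \<Rightarrow> real" where
  "complete_graph u v = (if u = v then 0 else 1)"

definition wdeg :: "nat \<Rightarrow> (nat \<Rightarrow> nat \<Rightarrow> real) \<Rightarrow> nat \<Rightarrow> real" where
  "wdeg N w u = (\<Sum>v<N. w u v)"

text \<open>Fitness at node u when the mutant set is S.\<close>
definition fit :: "real \<Rightarrow> nat set \<Rightarrow> nat \<Rightarrow> real" where
  "fit r S u = (if u \<in> S then r else 1)"

text \<open>New mutant set after the offspring of u replaces v.\<close>
definition repl :: "nat set \<Rightarrow> nat \<Rightarrow> nat \<Rightarrow> nat set" where
  "repl S u v = (if u \<in> S then insert v S else S - {v})"

text \<open>One-step transition probabilities between mutant sets.\<close>
definition trans_Bd :: "nat \<Rightarrow> (nat \<Rightarrow> nat \<Rightarrow> real) \<Rightarrow> real \<Rightarrow> nat set \<Rightarrow> nat set \<Rightarrow> real" where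
  "trans_Bd N w r S T =
     (\<Sum>u<N. \<Sum>v<N. fit r S u / (\<Sum>x<N. fit r S x) * (w u v / wdeg N w u)
        * (if repl S u v = T then 1 else 0))"

definition trans_dB :: "nat \<Rightarrow> (nat \<Rightarrow> nat \<Rightarrow> real) \<Rightarrow> real \<Rightarrow> nat set \<Rightarrow> nat set \<Rightarrow> real" where
  "trans_dB N w r S T =
     (\<Sum>v<N. \<Sum>u<N. (1 / real N) * (fit r S u * w u v / (\<Sum>x<N. fit r S x * w x v))
        * (if repl S u v = T then 1 else 0))"

text \<open>n-step transition probabilities of the Markov chain on subsets of {0..<N}.\<close>
fun nstep :: "nat \<Rightarrow> (nat set \<Rightarrow> nat set \<Rightarrow> real) \<Rightarrow> nat \<Rightarrow> nat set \<Rightarrow> nat set \<Rightarrow> real" where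
  "nstep N P 0 S T = (if S = T then 1 else 0)"
| "nstep N P (Suc n) S T = (\<Sum>S'\<in>Pow {..<N}. nstep N P n S S' * P S' T)"

text \<open>Fixation probability from S: probability of eventually reaching the absorbing
  all-mutant state, i.e. the limit of the probability of being there after n steps.\<close>
definition fixation :: "nat \<Rightarrow> (nat set \<Rightarrow> nat set \<Rightarrow> real) \<Rightarrow> nat set \<Rightarrow> real" where
  "fixation N P S = lim (\<lambda>n. nstep N P n S {..<N})"

definition rho_Bd :: "real \<Rightarrow> nat \<Rightarrow> (nat \<Rightarrow> nat \<Rightarrow> real) \<Rightarrow> real" where
  "rho_Bd r N w = (1 / real N) * (\<Sum>v<N. fixation N (trans_Bd N w r) {v})"

definition rho_dB :: "real \<Rightarrow> nat \<Rightarrow> (nat \<Rightarrow> nat \<Rightarrow> real) \<Rightarrow> real" where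
  "rho_dB r N w = (1 / real N) * (\<Sum>v<N. fixation N (trans_dB N w r) {v})"

end

theory Submission
  imports Defs "HOL-Analysis.Analysis"
begin

text \<open>
  The amplifier consists of a hub clique of H nodes and 2n pairs of adjacent nodes, all of which
  are weakly attached to the hub; relative to the hub, half of the pairs have tiny (light pairs) and
  half have huge (heavy pairs) inner weight. As the weights separate (t tends to 0), every unit
  (hub or pair) is almost always homogeneous. Under Birth-death updating the light pairs emit often and are hit rarely, so the hub
  equilibrates between two changes of a light pair; under death-Birth updating the heavy pairs play
  this role. In both cases the number of mutant active pairs becomes a birth-death chain whose
  up/down ratio is r^(H+2): the factor r^H comes from the hub, the factor r^2 from the
  invasion of a pair. A single mutant takes over its pair with probability at least 1/2, so the
  limiting fixation probability is at least (n/N) (1 - y) / (1 - y^n) with y = r^-(H+2),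
  which beats the complete graph on (1, 6/5] by a multiple of r - 1.

  The limit t to 0 is singular, and uniformity in r down to r = 1 is needed. State elimination
  expresses a fixation probability through sums, products and quotients of the transition rates,
  without subtractions. Hence it is t^k times a positive function that is regular up to t = 0, and
  being bounded it extends to t = 0. All fixation probabilities average to 1/N at
  r = 1, so after division by r - 1 the comparison is one of continuous functions on a compact box.
\<close>

subsection \<open>Fixation probabilities as harmonic functions of a spin system\<close>

text \<open>A S v and B S v are the rates at which node v turns mutant and resident in state S. Rescaling time
  by a state-dependent factor does not change fixation probabilities, so both update rules
  fit this form.\<close>
definition gen :: "'a set \<Rightarrow> ('a set \<Rightarrow> 'a \<Rightarrow> real) \<Rightarrow> ('a set \<Rightarrow> 'a \<Rightarrow> real) \<Rightarrow> ('a set \<Rightarrow> real) \<Rightarrow> 'a set \<Rightarrow> real" where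
  "gen U A B g S = (\<Sum>v\<in>U - S. A S v * (g (insert v S) - g S)) + (\<Sum>v\<in>S. B S v * (g (S - {v}) - g S))"

lemma gen_diff: "gen U A B (\<lambda>S. f S - g S) S = gen U A B f S - gen U A B g S"
  by (simp add: gen_def right_diff_distrib sum_subtractf)

lemma gen_affine: "gen U A B (\<lambda>S. a + b * f S) S = b * gen U A B f S"
  by (simp add: gen_def sum_distrib_left algebra_simps)

lemma gen_rescale:
  assumes "\<And>v. v \<in> U - S \<Longrightarrow> A S v = k * A' S v" "\<And>v. v \<in> S \<Longrightarrow> B S v = k * B' S v"
  shows "gen U A B g S = k * gen U A' B' g S"
  using assms by (simp add: gen_def sum_distrib_left distrib_left mult.assoc)

lemma gen_max_principle:
  fixes g :: "'a set \<Rightarrow> real"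
  assumes fin: "finite U"
    and A: "\<And>S v. S \<subseteq> U \<Longrightarrow> v \<in> U - S \<Longrightarrow> 0 \<le> A S v"
    and B: "\<And>S v. S \<subseteq> U \<Longrightarrow> v \<in> S \<Longrightarrow> 0 \<le> B S v"
    and up: "\<And>S. S \<subset> U \<Longrightarrow> S \<noteq> {} \<Longrightarrow> \<exists>v\<in>U - S. 0 < A S v"
    and sub: "\<And>S. S \<subset> U \<Longrightarrow> S \<noteq> {} \<Longrightarrow> 0 \<le> gen U A B g S"
    and bd: "g {} \<le> 0" "g U \<le> 0"
    and S: "S \<subseteq> U"
  shows "g S \<le> 0"
proof (rule ccontr)
  assume "\<not> g S \<le> 0"
  define M where "M = Max (g ` Pow U)"
  have fP: "finite (g ` Pow U)" using fin by simp
  have le: "g T \<le> M" if "T \<subseteq> U" for T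
    unfolding M_def using fP that by (intro Max_ge) auto
  have Mpos: "0 < M" using le[OF S] \<open>\<not> g S \<le> 0\<close> by simp
  define W where "W = {T \<in> Pow U. g T = M}"
  have "M \<in> g ` Pow U" unfolding M_def using fP by (intro Max_in) auto
  hence "W \<noteq> {}" by (auto simp: W_def)
  moreover have "finite W" using fin by (simp add: W_def)
  ultimately have "Max (card ` W) \<in> card ` W" and *: "finite (card ` W)" by auto
  then obtain T where T: "T \<in> W" "card T = Max (card ` W)" by auto
  have Tmax: "card T' \<le> card T" if "T' \<in> W" for T' using T * that by auto
  have TU: "T \<subseteq> U" "g T = M" using T by (auto simp: W_def)
  have "T \<noteq> {}" "T \<noteq> U" using TU Mpos bd by auto
  then have Tp: "T \<subset> U" "T \<noteq> {}" using TU by auto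
  then obtain v where v: "v \<in> U - T" "0 < A T v" using up by blast
  have ft: "finite T" using TU fin finite_subset by blast
  have "insert v T \<notin> W"
  proof
    assume "insert v T \<in> W"
    from Tmax[OF this] v ft show False by simp
  qed
  hence "g (insert v T) < M" using le[of "insert v T"] v TU by (auto simp: W_def less_le)
  hence neg: "A T v * (g (insert v T) - g T) < 0"
    using v TU by (simp add: mult_pos_neg)
  have t1: "A T x * (g (insert x T) - g T) \<le> 0" if "x \<in> U - T" for x
    using that A[OF TU(1) that] le[of "insert x T"] TU by (intro mult_nonneg_nonpos) auto
  have t2: "B T x * (g (T - {x}) - g T) \<le> 0" if "x \<in> T" for x
    using that B[OF TU(1) that] le[of "T - {x}"] TU by (intro mult_nonneg_nonpos) auto
  have "(\<Sum>v\<in>U - T. A T v * (g (insert v T) - g T)) < (\<Sum>v\<in>U - T. 0)"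
    using t1 neg v fin by (intro sum_strict_mono_ex1) auto
  moreover have "(\<Sum>v\<in>T. B T v * (g (T - {v}) - g T)) \<le> 0"
    using t2 by (intro sum_nonpos) auto
  ultimately have "gen U A B g T < 0" by (simp add: gen_def)
  with sub[OF Tp] show False by simp
qed

locale stochastic =
  fixes N :: nat and P :: "nat set \<Rightarrow> nat set \<Rightarrow> real"
  assumes nonneg: "S \<subseteq> {..<N} \<Longrightarrow> T \<subseteq> {..<N} \<Longrightarrow> 0 \<le> P S T"
    and total: "S \<subseteq> {..<N} \<Longrightarrow> (\<Sum>T\<in>Pow {..<N}. P S T) = 1"
    and full: "P {..<N} {..<N} = 1"
    and empty: "P {} {} = 1"
    and N: "0 < N"
begin

lemma nstep_nonneg: "S \<subseteq> {..<N} \<Longrightarrow> T \<subseteq> {..<N} \<Longrightarrow> 0 \<le> nstep N P n S T"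
  by (induction n arbitrary: T) (auto intro!: sum_nonneg mult_nonneg_nonneg nonneg)

lemma nstep_total: "S \<subseteq> {..<N} \<Longrightarrow> (\<Sum>T\<in>Pow {..<N}. nstep N P n S T) = 1"
proof (induction n)
  case 0 thus ?case by (simp add: sum.delta)
next
  case (Suc n)
  have "(\<Sum>T\<in>Pow {..<N}. nstep N P (Suc n) S T)
      = (\<Sum>S'\<in>Pow {..<N}. nstep N P n S S' * (\<Sum>T\<in>Pow {..<N}. P S' T))"
    by (simp add: sum_distrib_left) (rule sum.swap)
  also have "\<dots> = (\<Sum>S'\<in>Pow {..<N}. nstep N P n S S')"
    by (intro sum.cong) (auto simp: total)
  finally show ?case using Suc by simp
qed

lemma nstep_first: "S \<subseteq> {..<N} \<Longrightarrow> T \<subseteq> {..<N} \<Longrightarrow>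
  nstep N P (Suc n) S T = (\<Sum>S'\<in>Pow {..<N}. P S S' * nstep N P n S' T)"
proof (induction n arbitrary: T)
  case 0
  have "(\<Sum>S'\<in>Pow {..<N}. (if S = S' then 1 else 0) * P S' T) = P S T"
    using 0 by (subst sum.cong[OF refl, of _ _ "\<lambda>S'. if S = S' then P S' T else 0"]) (auto simp: sum.delta)
  moreover have "(\<Sum>S'\<in>Pow {..<N}. P S S' * (if S' = T then 1 else 0)) = P S T"
    using 0 by (subst sum.cong[OF refl, of _ _ "\<lambda>S'. if S' = T then P S S' else 0"]) (auto simp: sum.delta)
  ultimately show ?case by simp
next
  case (Suc n)
  have "nstep N P (Suc (Suc n)) S T = (\<Sum>X\<in>Pow {..<N}. nstep N P (Suc n) S X * P X T)" by simp
  also have "\<dots> = (\<Sum>X\<in>Pow {..<N}. (\<Sum>S'\<in>Pow {..<N}. P S S' * nstep N P n S' X) * P X T)"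
    using Suc by (intro sum.cong refl) (auto simp del: nstep.simps)
  also have "\<dots> = (\<Sum>S'\<in>Pow {..<N}. P S S' * (\<Sum>X\<in>Pow {..<N}. nstep N P n S' X * P X T))"
    by (simp add: sum_distrib_left sum_distrib_right mult.assoc) (rule sum.swap)
  finally show ?case by simp
qed

lemma nstep_le_1: "S \<subseteq> {..<N} \<Longrightarrow> T \<subseteq> {..<N} \<Longrightarrow> nstep N P n S T \<le> 1"
  using member_le_sum[of T "Pow {..<N}" "nstep N P n S"] nstep_nonneg[of S] nstep_total[of S n]
  by auto

lemma nstep_mono: "S \<subseteq> {..<N} \<Longrightarrow> nstep N P n S {..<N} \<le> nstep N P (Suc n) S {..<N}"
  using member_le_sum[of "{..<N}" "Pow {..<N}" "\<lambda>S'. nstep N P n S S' * P S' {..<N}"]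
    nstep_nonneg[of S] nonneg full by auto

lemma fixation_tendsto: "S \<subseteq> {..<N} \<Longrightarrow> (\<lambda>n. nstep N P n S {..<N}) \<longlonglongrightarrow> fixation N P S"
proof -
  assume S: "S \<subseteq> {..<N}"
  have "incseq (\<lambda>n. nstep N P n S {..<N})" using nstep_mono[OF S] by (rule incseq_SucI)
  moreover have "\<And>n. nstep N P n S {..<N} \<le> 1" using nstep_le_1 S by blast
  ultimately obtain L where "(\<lambda>n. nstep N P n S {..<N}) \<longlonglongrightarrow> L"
    using incseq_convergent by blast
  thus ?thesis unfolding fixation_def by (simp add: limI)
qed

lemma fixation_bounds: "S \<subseteq> {..<N} \<Longrightarrow> 0 \<le> fixation N P S" "S \<subseteq> {..<N} \<Longrightarrow> fixation N P S \<le> 1"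
  by (rule LIMSEQ_le_const[OF fixation_tendsto], simp, use nstep_nonneg in blast)
     (rule LIMSEQ_le_const2[OF fixation_tendsto], simp, use nstep_le_1 in blast)

lemma fixation_step:
  assumes S: "S \<subseteq> {..<N}"
  shows "fixation N P S = (\<Sum>T\<in>Pow {..<N}. P S T * fixation N P T)"
proof -
  have "(\<lambda>n. nstep N P (Suc n) S {..<N}) \<longlonglongrightarrow> (\<Sum>T\<in>Pow {..<N}. P S T * fixation N P T)"
    unfolding nstep_first[OF S order_refl]
    by (intro tendsto_sum tendsto_mult tendsto_const fixation_tendsto) auto
  moreover have "(\<lambda>n. nstep N P (Suc n) S {..<N}) \<longlonglongrightarrow> fixation N P S"
    using fixation_tendsto[OF S] by (rule LIMSEQ_Suc)
  ultimately show ?thesis using LIMSEQ_unique by blast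
qed

lemma fixation_full: "fixation N P {..<N} = 1"
proof -
  have "nstep N P n {..<N} {..<N} \<ge> 1" for n
    by (induction n) (auto intro: order_trans nstep_mono simp del: nstep.simps(2))
  hence "1 \<le> fixation N P {..<N}"
    by (intro LIMSEQ_le_const[OF fixation_tendsto]) auto
  with fixation_bounds(2)[of "{..<N}"] show ?thesis by simp
qed

lemma fixation_empty: "fixation N P {} = 0"
proof -
  have z: "P {} T = 0" if "T \<subseteq> {..<N}" "T \<noteq> {}" for T
  proof -
    have "(\<Sum>T\<in>Pow {..<N} - {{}}. P {} T) = 0"
      using total[of "{}"] empty by (simp add: sum_diff1)
    thus ?thesis using that nonneg[of "{}"]
      by (subst (asm) sum_nonneg_eq_0_iff) auto
  qed
  have "nstep N P n {} {..<N} = 0" for n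
  proof (induction n)
    case 0 thus ?case using N by auto
  next
    case (Suc n)
    have "P {} S' * nstep N P n S' {..<N} = 0" if "S' \<in> Pow {..<N}" for S'
      using that Suc z[of S'] by (cases "S' = {}") auto
    thus ?case by (subst nstep_first) (auto intro!: sum.neutral)
  qed
  thus ?thesis using fixation_tendsto[of "{}"] by (simp add: LIMSEQ_const_iff)
qed

end

definition up_Bd where "up_Bd N w r S v = (\<Sum>u\<in>S. r * w u v / wdeg N w u)"
definition dn_Bd where "dn_Bd N w r S v = (\<Sum>u\<in>{..<N} - S. w u v / wdeg N w u)"
definition up_dB where "up_dB N w r S v = (\<Sum>u\<in>S. r * w u v) / ((\<Sum>u\<in>S. r * w u v) + (\<Sum>u\<in>{..<N} - S. w u v))"
definition dn_dB where "dn_dB N w r S v = (\<Sum>u\<in>{..<N} - S. w u v) / ((\<Sum>u\<in>S. r * w u v) + (\<Sum>u\<in>{..<N} - S. w u v))"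

lemma sum_center:
  fixes c :: "nat \<Rightarrow> nat \<Rightarrow> real"
  shows "(\<Sum>u<N. \<Sum>v<N. c u v * G u v) = (\<Sum>u<N. \<Sum>v<N. c u v * (G u v - k)) + (\<Sum>u<N. \<Sum>v<N. c u v) * k"
  by (simp add: sum_distrib_right sum_subtractf right_diff_distrib)

lemma repl_subset: "S \<subseteq> {..<N} \<Longrightarrow> v < N \<Longrightarrow> repl S u v \<subseteq> {..<N}"
  by (auto simp: repl_def)

lemma sum_repl:
  assumes S: "S \<subseteq> {..<N}"
  shows "(\<Sum>u<N. \<Sum>v<N. c u v * (g (repl S u v) - g S))
    = gen {..<N} (\<lambda>_ v. \<Sum>u\<in>S. c u v) (\<lambda>_ v. \<Sum>u\<in>{..<N} - S. c u v) g S"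
proof -
  have fS: "finite S" using S finite_subset by blast
  have "(\<Sum>u<N. \<Sum>v<N. c u v * (g (repl S u v) - g S)) = (\<Sum>v<N. \<Sum>u<N. c u v * (g (repl S u v) - g S))"
    by (rule sum.swap)
  also have "\<dots> = (\<Sum>v<N. (\<Sum>u\<in>S. c u v) * (g (insert v S) - g S) + (\<Sum>u\<in>{..<N} - S. c u v) * (g (S - {v}) - g S))"
  proof (intro sum.cong refl)
    fix v
    have "(\<Sum>u<N. c u v * (g (repl S u v) - g S))
      = (\<Sum>u\<in>S. c u v * (g (repl S u v) - g S)) + (\<Sum>u\<in>{..<N}-S. c u v * (g (repl S u v) - g S))"
      using S by (subst sum.subset_diff[of S]) auto
    thus "(\<Sum>u<N. c u v * (g (repl S u v) - g S)) = (\<Sum>u\<in>S. c u v) * (g (insert v S) - g S) + (\<Sum>u\<in>{..<N} - S. c u v) * (g (S - {v}) - g S)"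
      by (simp add: repl_def sum_distrib_right)
  qed
  also have "\<dots> = (\<Sum>v\<in>{..<N}-S. (\<Sum>u\<in>S. c u v) * (g (insert v S) - g S)) + (\<Sum>v\<in>S. (\<Sum>u\<in>{..<N} - S. c u v) * (g (S - {v}) - g S))"
    using S by (subst sum.subset_diff[of S]) (auto simp: insert_absorb)
  finally show ?thesis by (simp add: gen_def)
qed

lemma sum_indicator_Pow:
  assumes S: "S \<subseteq> {..<N}"
  shows "(\<Sum>T\<in>Pow {..<N}. (\<Sum>u<N. \<Sum>v<N. c u v * (if repl S u v = T then 1 else 0)) * g T)
     = (\<Sum>u<N. \<Sum>v<N. c u v * (g (repl S u v) :: real))"
proof -
  have "(\<Sum>T\<in>Pow {..<N}. (\<Sum>u<N. \<Sum>v<N. c u v * (if repl S u v = T then 1 else 0)) * g T)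
     = (\<Sum>T\<in>Pow {..<N}. \<Sum>u<N. \<Sum>v<N. c u v * (if repl S u v = T then g T else 0))"
    by (auto simp: sum_distrib_right intro!: sum.cong)
  also have "\<dots> = (\<Sum>u<N. \<Sum>v<N. \<Sum>T\<in>Pow {..<N}. c u v * (if repl S u v = T then g T else 0))"
    by (subst sum.swap, rule sum.cong[OF refl], rule sum.swap)
  also have "\<dots> = (\<Sum>u<N. \<Sum>v<N. c u v * g (repl S u v))"
  proof (intro sum.cong refl)
    fix u v assume "v \<in> {..<N}"
    hence "repl S u v \<in> Pow {..<N}" using repl_subset[OF S] by auto
    thus "(\<Sum>T\<in>Pow {..<N}. c u v * (if repl S u v = T then g T else 0)) = c u v * g (repl S u v)"
      by (simp add: sum_distrib_left[symmetric] sum.delta')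
  qed
  finally show ?thesis .
qed

locale wgraph =
  fixes N :: nat and w :: "nat \<Rightarrow> nat \<Rightarrow> real" and r :: real
  assumes graph: "weighted_graph N w" and conn: "graph_connected N w" and N2: "2 \<le> N" and r: "1 \<le> r"
begin

lemma w_nonneg: "u < N \<Longrightarrow> v < N \<Longrightarrow> 0 \<le> w u v"
  and w_sym: "u < N \<Longrightarrow> v < N \<Longrightarrow> w u v = w v u"
  using graph by (auto simp: weighted_graph_def)

lemma boundary_edge:
  assumes "S \<subset> {..<N}" "S \<noteq> {}"
  obtains u v where "u \<in> S" "v \<in> {..<N} - S" "0 < w u v"
proof -
  obtain a b where ab: "a \<in> S" "b \<in> {..<N} - S" using assms by blast
  have "(a, b) \<in> {(a, b). a < N \<and> b < N \<and> w a b > 0}\<^sup>*"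
    using ab assms conn by (auto simp: graph_connected_def)
  hence "b \<notin> S \<longrightarrow> (\<exists>u v. u \<in> S \<and> v \<in> {..<N} - S \<and> 0 < w u v)"
  proof (induction rule: rtrancl_induct)
    case base thus ?case using ab by simp
  next
    case (step y z) thus ?case by auto
  qed
  thus thesis using ab that by auto
qed

lemma wdeg_pos: "u < N \<Longrightarrow> 0 < wdeg N w u"
proof -
  assume u: "u < N"
  have "\<exists>x<N. x \<noteq> u" using N2 by (intro exI[of _ "if u = 0 then 1 else 0"]) auto
  hence "{u} \<subset> {..<N}" using u by auto
  then obtain x v where "x \<in> {u}" "v \<in> {..<N} - {u}" "0 < w x v" using boundary_edge[of "{u}"] by auto
  thus ?thesis unfolding wdeg_def using w_nonneg u
    by (intro sum_pos2[of _ v]) auto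
qed

lemma in_wdeg: "v < N \<Longrightarrow> (\<Sum>u<N. w u v) = wdeg N w v"
  unfolding wdeg_def by (intro sum.cong) (auto simp: w_sym)

lemma fit_total_pos: "0 < (\<Sum>x<N. fit r S x)"
  using N2 r by (intro sum_pos) (auto simp: fit_def lessThan_empty_iff)

lemma in_fit_pos: "v < N \<Longrightarrow> 0 < (\<Sum>x<N. fit r S x * w x v)"
proof -
  assume v: "v < N"
  have "(\<Sum>u<N. w u v) \<le> (\<Sum>x<N. fit r S x * w x v)"
    using r w_nonneg v by (intro sum_mono) (auto simp: fit_def intro: mult_left_le_one_le mult_right_mono[of 1 r, unfolded mult_1])
  thus ?thesis using in_wdeg[OF v] wdeg_pos[OF v] by linarith
qed

lemma in_fit_split: "S \<subseteq> {..<N} \<Longrightarrow> (\<Sum>x<N. fit r S x * w x v) = (\<Sum>u\<in>S. r * w u v) + (\<Sum>u\<in>{..<N} - S. w u v)"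
  by (subst sum.subset_diff[of S]) (auto simp: fit_def)

lemma Bd_total:
  "(\<Sum>u<N. \<Sum>v<N. fit r S u / (\<Sum>x<N. fit r S x) * (w u v / wdeg N w u)) = 1"
proof -
  have "(\<Sum>v<N. fit r S u / (\<Sum>x<N. fit r S x) * (w u v / wdeg N w u)) = fit r S u / (\<Sum>x<N. fit r S x)"
    if "u < N" for u
    using wdeg_pos[OF that] by (simp add: sum_distrib_left[symmetric] sum_divide_distrib[symmetric] wdeg_def[symmetric])
  thus ?thesis using fit_total_pos[of S] by (simp add: sum_divide_distrib[symmetric])
qed

lemma dB_total:
  "(\<Sum>v<N. \<Sum>u<N. 1 / real N * (fit r S u * w u v / (\<Sum>x<N. fit r S x * w x v))) = 1"
proof -
  have "(\<Sum>u<N. 1 / real N * (fit r S u * w u v / (\<Sum>x<N. fit r S x * w x v))) = 1 / N"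
    if "v < N" for v
    using in_fit_pos[OF that, of S] by (simp only: sum_distrib_left[symmetric] sum_divide_distrib[symmetric]) simp
  thus ?thesis using N2 by simp
qed

lemma Bd_expect:
  assumes S: "S \<subseteq> {..<N}"
  shows "(\<Sum>T\<in>Pow {..<N}. trans_Bd N w r S T * g T)
    = g S + gen {..<N} (up_Bd N w r) (dn_Bd N w r) g S / (\<Sum>x<N. fit r S x)"
proof -
  let ?c = "\<lambda>u v. fit r S u / (\<Sum>x<N. fit r S x) * (w u v / wdeg N w u)"
  have "(\<Sum>T\<in>Pow {..<N}. trans_Bd N w r S T * g T) = (\<Sum>u<N. \<Sum>v<N. ?c u v * g (repl S u v))"
    unfolding trans_Bd_def by (rule sum_indicator_Pow[OF S])
  also have "\<dots> = (\<Sum>u<N. \<Sum>v<N. ?c u v * (g (repl S u v) - g S)) + (\<Sum>u<N. \<Sum>v<N. ?c u v) * g S"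
    by (rule sum_center)
  also have "(\<Sum>u<N. \<Sum>v<N. ?c u v * (g (repl S u v) - g S))
     = gen {..<N} (\<lambda>_ v. \<Sum>u\<in>S. ?c u v) (\<lambda>_ v. \<Sum>u\<in>{..<N} - S. ?c u v) g S"
    by (rule sum_repl[OF S])
  also have "\<dots> = gen {..<N} (up_Bd N w r) (dn_Bd N w r) g S / (\<Sum>x<N. fit r S x)"
    unfolding divide_inverse[of "gen _ _ _ _ _"] mult.commute[of "gen _ _ _ _ _"]
    by (rule gen_rescale; unfold up_Bd_def dn_Bd_def sum_distrib_left; rule sum.cong[OF refl]; simp add: fit_def divide_inverse)
  finally show ?thesis using Bd_total by simp
qed

lemma dB_expect:
  assumes S: "S \<subseteq> {..<N}"
  shows "(\<Sum>T\<in>Pow {..<N}. trans_dB N w r S T * g T)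
    = g S + gen {..<N} (up_dB N w r) (dn_dB N w r) g S / N"
proof -
  let ?c = "\<lambda>u v. 1 / real N * (fit r S u * w u v / (\<Sum>x<N. fit r S x * w x v))"
  have "trans_dB N w r S T = (\<Sum>u<N. \<Sum>v<N. ?c u v * (if repl S u v = T then 1 else 0))" for T
    unfolding trans_dB_def by (rule sum.swap)
  hence "(\<Sum>T\<in>Pow {..<N}. trans_dB N w r S T * g T) = (\<Sum>u<N. \<Sum>v<N. ?c u v * g (repl S u v))"
    using sum_indicator_Pow[OF S, of ?c g] by simp
  also have "\<dots> = (\<Sum>u<N. \<Sum>v<N. ?c u v * (g (repl S u v) - g S)) + (\<Sum>u<N. \<Sum>v<N. ?c u v) * g S"
    by (rule sum_center)
  also have "(\<Sum>u<N. \<Sum>v<N. ?c u v) = 1" using dB_total[of S] by (subst sum.swap)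
  also have "(\<Sum>u<N. \<Sum>v<N. ?c u v * (g (repl S u v) - g S))
     = gen {..<N} (\<lambda>_ v. \<Sum>u\<in>S. ?c u v) (\<lambda>_ v. \<Sum>u\<in>{..<N} - S. ?c u v) g S"
    by (rule sum_repl[OF S])
  also have "\<dots> = gen {..<N} (up_dB N w r) (dn_dB N w r) g S / N"
    unfolding divide_inverse[of "gen _ _ _ _ _"] mult.commute[of "gen _ _ _ _ _"]
    by (rule gen_rescale; unfold up_dB_def dn_dB_def in_fit_split[OF S, symmetric] sum_divide_distrib sum_distrib_left;
        rule sum.cong[OF refl]; simp add: fit_def divide_inverse)
  finally show ?thesis by simp
qed

lemma stochastic_Bd: "stochastic N (trans_Bd N w r)"
proof
  fix S T assume "S \<subseteq> {..<N}"
  show "0 \<le> trans_Bd N w r S T"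
    unfolding trans_Bd_def using fit_total_pos[of S] wdeg_pos w_nonneg r
    by (intro sum_nonneg mult_nonneg_nonneg divide_nonneg_nonneg) (auto simp: fit_def less_imp_le)
next
  fix S assume "S \<subseteq> {..<N}"
  from Bd_expect[OF this, of "\<lambda>_. 1"] show "(\<Sum>T\<in>Pow {..<N}. trans_Bd N w r S T) = 1" by (simp add: gen_def)
next
  have "trans_Bd N w r {..<N} {..<N} = (\<Sum>T\<in>Pow {..<N}. trans_Bd N w r {..<N} T * (if T = {..<N} then 1 else 0))"
    by (simp add: sum.delta if_distrib cong: if_cong)
  also have "\<dots> = 1" by (subst Bd_expect) (auto simp: gen_def dn_Bd_def)
  finally show "trans_Bd N w r {..<N} {..<N} = 1" .
next
  have "trans_Bd N w r {} {} = (\<Sum>T\<in>Pow {..<N}. trans_Bd N w r {} T * (if T = {} then 1 else 0))"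
    by (simp add: sum.delta if_distrib cong: if_cong)
  also have "\<dots> = 1" by (subst Bd_expect) (auto simp: gen_def up_Bd_def)
  finally show "trans_Bd N w r {} {} = 1" .
qed (use N2 in simp)

lemma stochastic_dB: "stochastic N (trans_dB N w r)"
proof
  fix S T assume "S \<subseteq> {..<N}"
  show "0 \<le> trans_dB N w r S T"
    unfolding trans_dB_def using in_fit_pos[of _ S] w_nonneg r
    by (intro sum_nonneg mult_nonneg_nonneg divide_nonneg_nonneg) (auto simp: fit_def less_imp_le)
next
  fix S assume "S \<subseteq> {..<N}"
  from dB_expect[OF this, of "\<lambda>_. 1"] show "(\<Sum>T\<in>Pow {..<N}. trans_dB N w r S T) = 1" by (simp add: gen_def)
next
  have "trans_dB N w r {..<N} {..<N} = (\<Sum>T\<in>Pow {..<N}. trans_dB N w r {..<N} T * (if T = {..<N} then 1 else 0))"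
    by (simp add: sum.delta if_distrib cong: if_cong)
  also have "\<dots> = 1" by (subst dB_expect) (auto simp: gen_def dn_dB_def)
  finally show "trans_dB N w r {..<N} {..<N} = 1" .
next
  have "trans_dB N w r {} {} = (\<Sum>T\<in>Pow {..<N}. trans_dB N w r {} T * (if T = {} then 1 else 0))"
    by (simp add: sum.delta if_distrib cong: if_cong)
  also have "\<dots> = 1" by (subst dB_expect) (auto simp: gen_def up_dB_def)
  finally show "trans_dB N w r {} {} = 1" .
qed (use N2 in simp)

lemma gen_fixation_Bd:
  assumes "S \<subseteq> {..<N}"
  shows "gen {..<N} (up_Bd N w r) (dn_Bd N w r) (fixation N (trans_Bd N w r)) S = 0"
proof -
  have "gen {..<N} (up_Bd N w r) (dn_Bd N w r) (fixation N (trans_Bd N w r)) S / (\<Sum>x<N. fit r S x) = 0"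
    using stochastic.fixation_step[OF stochastic_Bd assms] Bd_expect[OF assms, of "fixation N (trans_Bd N w r)"]
    by linarith
  thus ?thesis using fit_total_pos[of S] by simp
qed

lemma gen_fixation_dB:
  assumes "S \<subseteq> {..<N}"
  shows "gen {..<N} (up_dB N w r) (dn_dB N w r) (fixation N (trans_dB N w r)) S = 0"
proof -
  have "gen {..<N} (up_dB N w r) (dn_dB N w r) (fixation N (trans_dB N w r)) S / N = 0"
    using stochastic.fixation_step[OF stochastic_dB assms] dB_expect[OF assms, of "fixation N (trans_dB N w r)"]
    by linarith
  thus ?thesis using N2 by simp
qed

end

subsection \<open>Attractive spin systems\<close>

locale attractive_spins =
  fixes U :: "nat set" and A B :: "nat set \<Rightarrow> nat \<Rightarrow> real"
  assumes fin: "finite U"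
    and A_nonneg: "S \<subseteq> U \<Longrightarrow> v \<in> U - S \<Longrightarrow> 0 \<le> A S v"
    and B_nonneg: "S \<subseteq> U \<Longrightarrow> v \<in> S \<Longrightarrow> 0 \<le> B S v"
    and up: "S \<subset> U \<Longrightarrow> S \<noteq> {} \<Longrightarrow> \<exists>v\<in>U - S. 0 < A S v"
    and A_mono: "S \<subseteq> T \<Longrightarrow> T \<subseteq> U \<Longrightarrow> v \<in> U - T \<Longrightarrow> A S v \<le> A T v"
    and B_anti: "S \<subseteq> T \<Longrightarrow> T \<subseteq> U \<Longrightarrow> v \<in> S \<Longrightarrow> B T v \<le> B S v"
begin

definition harmonic :: "(nat set \<Rightarrow> real) \<Rightarrow> bool" where
  "harmonic h \<longleftrightarrow> h {} = 0 \<and> h U = 1 \<and> (\<forall>S\<subseteq>U. gen U A B h S = 0 \<and> 0 \<le> h S \<and> h S \<le> 1)"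

lemma subharmonic_le:
  assumes h: "harmonic h" and g: "\<And>S. S \<subset> U \<Longrightarrow> S \<noteq> {} \<Longrightarrow> 0 \<le> gen U A B g S"
    and "g {} \<le> 0" "g U \<le> 1" "S \<subseteq> U"
  shows "g S \<le> h S"
proof -
  have h0: "gen U A B h S = 0" if "S \<subset> U" for S using h that by (auto simp: harmonic_def)
  have sub: "0 \<le> gen U A B (\<lambda>S. g S - h S) S" if "S \<subset> U" "S \<noteq> {}" for S
    using g[OF that] h0[OF that(1)] by (simp add: gen_diff)
  have "g S - h S \<le> 0"
    by (rule gen_max_principle[where g = "\<lambda>S. g S - h S", OF fin A_nonneg B_nonneg up sub])
       (use assms in \<open>simp_all add: harmonic_def\<close>)
  thus ?thesis by simp
qed

lemma harmonic_le_superharmonic: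
  assumes h: "harmonic h" and g: "\<And>S. S \<subset> U \<Longrightarrow> S \<noteq> {} \<Longrightarrow> gen U A B g S \<le> 0"
    and "0 \<le> g {}" "1 \<le> g U" "S \<subseteq> U"
  shows "h S \<le> g S"
proof -
  have h0: "gen U A B h S = 0" if "S \<subset> U" for S using h that by (auto simp: harmonic_def)
  have sub: "0 \<le> gen U A B (\<lambda>S. h S - g S) S" if "S \<subset> U" "S \<noteq> {}" for S
    using g[OF that] h0[OF that(1)] by (simp add: gen_diff)
  have "h S - g S \<le> 0"
    by (rule gen_max_principle[where g = "\<lambda>S. h S - g S", OF fin A_nonneg B_nonneg up sub])
       (use assms in \<open>simp_all add: harmonic_def\<close>)
  thus ?thesis by simp
qed

text \<open>Maximise h S - h T over nested pairs, with S as large as possible: under the monotone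
  coupling every move weakly decreases the difference, and some move does so strictly.\<close>
lemma harmonic_mono:
  assumes h: "harmonic h" and ST: "S \<subseteq> T" "T \<subseteq> U"
  shows "h S \<le> h T"
proof (rule ccontr)
  assume neg: "\<not> h S \<le> h T"
  define D where "D p = h (fst p) - h (snd p)" for p
  define X where "X = {p. fst p \<subseteq> snd p \<and> snd p \<subseteq> U}"
  have "X \<subseteq> Pow U \<times> Pow U" by (auto simp: X_def)
  hence fX: "finite X" using fin by (meson finite_Pow_iff finite_SigmaI finite_subset)
  define M where "M = Max (D ` X)"
  have le: "h S' - h T' \<le> M" if "S' \<subseteq> T'" "T' \<subseteq> U" for S' T'
    unfolding M_def using fX that by (intro Max_ge) (auto simp: X_def D_def image_iff intro!: bexI[of _ "(S', T')"])
  have Mpos: "0 < M" using le[OF ST] neg by simp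
  have "X \<noteq> {}" using ST by (auto simp: X_def)
  hence "M \<in> D ` X" unfolding M_def using fX by (intro Max_in) auto
  define W where "W = {p \<in> X. D p = M}"
  have "finite W" "W \<noteq> {}" using fX \<open>M \<in> D ` X\<close> by (auto simp: W_def)
  hence "Max ((card \<circ> fst) ` W) \<in> (card \<circ> fst) ` W" and *: "finite ((card \<circ> fst) ` W)" by auto
  then obtain p where p: "p \<in> W" "(card \<circ> fst) p = Max ((card \<circ> fst) ` W)" by (auto simp del: comp_apply)
  obtain S T where pST: "p = (S, T)" by (cases p)
  have ST: "S \<subseteq> T" "T \<subseteq> U" "h S - h T = M"
    using p by (auto simp: pST W_def X_def D_def)
  have strict: "h S' - h T' < M" if "S' \<subseteq> T'" "T' \<subseteq> U" "card S < card S'" for S' T'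
  proof (rule ccontr)
    assume "\<not> h S' - h T' < M"
    hence "(S', T') \<in> W" using le[OF that(1,2)] that by (auto simp: W_def X_def D_def)
    hence "(card \<circ> fst) (S', T') \<le> Max ((card \<circ> fst) ` W)" using * by (intro Max_ge imageI)
    thus False using p(2) pST that by simp
  qed
  have fS: "finite S" "finite T" using ST fin finite_subset by (meson finite_subset)+
  have bnd: "0 \<le> h T" "gen U A B h S = 0" "gen U A B h T = 0" "h {} = 0"
    using h ST by (auto simp: harmonic_def)
  have "S \<noteq> {}" using ST bnd Mpos by auto
  moreover have "S \<noteq> U" using ST Mpos by auto
  ultimately obtain v where v: "v \<in> U - S" "0 < A S v" using up ST by (meson order_trans psubsetI)
  have eS: "gen U A B h S = (\<Sum>v\<in>U-T. A S v * (h (insert v S) - h S)) + (\<Sum>v\<in>T-S. A S v * (h (insert v S) - h S))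
       + (\<Sum>v\<in>S. B S v * (h (S-{v}) - h S))"
  proof -
    have "U - S = (U - T) \<union> (T - S)" using ST by auto
    moreover have "(U - T) \<inter> (T - S) = {}" by auto
    ultimately show ?thesis unfolding gen_def using fin fS by (simp add: sum.union_disjoint)
  qed
  have eT: "gen U A B h T = (\<Sum>v\<in>U-T. A T v * (h (insert v T) - h T)) + (\<Sum>v\<in>T-S. B T v * (h (T-{v}) - h T))
       + (\<Sum>v\<in>S. B T v * (h (T-{v}) - h T))"
    unfolding gen_def using ST fS by (simp add: sum.subset_diff[of S T])
  define F1 where "F1 v = A S v * (h (insert v S) - h S) - A T v * (h (insert v T) - h T)" for v
  define F2 where "F2 v = A S v * (h (insert v S) - h S) - B T v * (h (T-{v}) - h T)" for v
  define F3 where "F3 v = B S v * (h (S-{v}) - h S) - B T v * (h (T-{v}) - h T)" for v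
  have 0: "sum F1 (U-T) + sum F2 (T-S) + sum F3 S = 0"
    using eS eT bnd by (simp add: F1_def F2_def F3_def sum_subtractf)
  have i1: "F1 x \<le> 0 \<and> (0 < A S x \<longrightarrow> F1 x < 0)" if x: "x \<in> U - T" for x
  proof -
    have xS: "x \<notin> S" using x ST by auto
    have e: "F1 x = A S x * ((h (insert x S) - h (insert x T)) - M) - (A T x - A S x) * (h (insert x T) - h T)"
      using ST by (simp add: F1_def algebra_simps)
    have a: "(A T x - A S x) * (h (insert x T) - h T) \<ge> 0"
      using A_mono[OF ST(1,2) x] le[OF subset_insertI2[OF ST(1)], of x] ST x by (intro mult_nonneg_nonneg) auto
    have b: "(h (insert x S) - h (insert x T)) - M < 0"
      using strict[OF insert_mono[OF ST(1)], of x] xS ST x fS by auto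
    have "0 \<le> A S x" using A_nonneg[of S x] ST x by auto
    thus ?thesis using e a b mult_pos_neg[of "A S x" "(h (insert x S) - h (insert x T)) - M"]
        mult_nonneg_nonpos[of "A S x" "(h (insert x S) - h (insert x T)) - M"] by auto
  qed
  have i2: "F2 x \<le> 0 \<and> (0 < A S x \<longrightarrow> F2 x < 0)" if x: "x \<in> T - S" for x
  proof -
    have s1: "S \<subseteq> T - {x}" and s2: "T - {x} \<subseteq> U" and s3: "insert x S \<subseteq> T" and c: "card S < card (insert x S)"
      using ST x fS by auto
    have a: "B T x * (h (T-{x}) - h T) \<ge> 0"
      using B_nonneg[OF ST(2), of x] le[OF s1 s2] ST x by (intro mult_nonneg_nonneg) auto
    have b: "h (insert x S) - h S < 0"
      using strict[OF s3 ST(2) c] ST by simp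
    have "0 \<le> A S x" using A_nonneg[of S x] ST x by auto
    thus ?thesis using a b mult_pos_neg[of "A S x" "h (insert x S) - h S"]
        mult_nonneg_nonpos[of "A S x" "h (insert x S) - h S"] by (auto simp: F2_def)
  qed
  have i3: "F3 x \<le> 0" if x: "x \<in> S" for x
  proof -
    have s1: "S - {x} \<subseteq> T - {x}" and s2: "T - {x} \<subseteq> U" and s3: "S - {x} \<subseteq> T" using ST by auto
    have e: "F3 x = B T x * ((h (S-{x}) - h (T-{x})) - M) + (B S x - B T x) * (h (S-{x}) - h S)"
      using ST by (simp add: F3_def algebra_simps)
    have "B T x * ((h (S-{x}) - h (T-{x})) - M) \<le> 0"
      using B_nonneg[OF ST(2), of x] le[OF s1 s2] ST x by (intro mult_nonneg_nonpos) auto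
    moreover have "(B S x - B T x) * (h (S-{x}) - h S) \<le> 0"
      using B_anti[OF ST(1,2) x] le[OF s3 ST(2)] ST by (intro mult_nonneg_nonpos) auto
    ultimately show ?thesis using e by linarith
  qed
  have "sum F1 (U-T) \<le> 0" "sum F2 (T-S) \<le> 0" "sum F3 S \<le> 0"
    using i1 i2 i3 by (auto intro!: sum_nonpos)
  with 0 have "sum F1 (U-T) = 0" "sum F2 (T-S) = 0" by linarith+
  moreover have "sum F1 (U-T) < 0 \<or> sum F2 (T-S) < 0"
  proof (cases "v \<in> T")
    case True
    have "sum F2 (T-S) < sum (\<lambda>_. 0) (T-S)"
      using i2 v True fS by (intro sum_strict_mono_ex1) (auto intro!: bexI[of _ v])
    thus ?thesis by simp
  next
    case False
    have "sum F1 (U-T) < sum (\<lambda>_. 0) (U-T)"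
      using i1 v False fin by (intro sum_strict_mono_ex1) (auto intro!: bexI[of _ v])
    thus ?thesis by simp
  qed
  ultimately show False by linarith
qed

end

lemma gen_additive:
  assumes "finite U" "S \<subseteq> U"
  shows "gen U A B (\<lambda>S. sum \<nu> S / c) S = ((\<Sum>v\<in>U-S. A S v * \<nu> v) - (\<Sum>v\<in>S. B S v * \<nu> v)) / c"
proof -
  have fS: "finite S" using assms finite_subset by blast
  have "(\<Sum>v\<in>U-S. A S v * (sum \<nu> (insert v S) / c - sum \<nu> S / c)) = (\<Sum>v\<in>U-S. A S v * \<nu> v / c)"
    using fS by (intro sum.cong) (auto simp: add_divide_distrib)
  moreover have "(\<Sum>v\<in>S. B S v * (sum \<nu> (S-{v}) / c - sum \<nu> S / c)) = (\<Sum>v\<in>S. - (B S v * \<nu> v / c))"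
    using fS by (intro sum.cong) (auto simp: sum_diff1 diff_divide_distrib algebra_simps)
  ultimately show ?thesis
    by (simp add: gen_def sum_negf sum_divide_distrib diff_divide_distrib)
qed

context wgraph
begin

lemma spins_Bd: "attractive_spins {..<N} (up_Bd N w r) (dn_Bd N w r)"
proof
  fix S assume "S \<subset> {..<N}" "S \<noteq> {}"
  then obtain u v where uv: "u \<in> S" "v \<in> {..<N} - S" "0 < w u v" using boundary_edge by blast
  have fS: "finite S" using \<open>S \<subset> {..<N}\<close> finite_subset by blast
  have "0 < up_Bd N w r S v" unfolding up_Bd_def
    using uv \<open>S \<subset> {..<N}\<close> r w_nonneg wdeg_pos fS
    by (intro sum_pos2[of _ u] divide_nonneg_nonneg mult_nonneg_nonneg divide_pos_pos mult_pos_pos) (auto simp: less_imp_le)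
  thus "\<exists>v\<in>{..<N} - S. 0 < up_Bd N w r S v" using uv by blast
next
  fix S T v assume *: "S \<subseteq> T" "T \<subseteq> {..<N}" "v \<in> {..<N} - T"
  show "up_Bd N w r S v \<le> up_Bd N w r T v" unfolding up_Bd_def
    using * r w_nonneg wdeg_pos finite_subset[OF *(2)]
    by (intro sum_mono2 divide_nonneg_nonneg mult_nonneg_nonneg) (auto simp: less_imp_le)
next
  fix S T v assume *: "S \<subseteq> T" "T \<subseteq> {..<N}" "v \<in> S"
  show "dn_Bd N w r T v \<le> dn_Bd N w r S v" unfolding dn_Bd_def
    using * r w_nonneg wdeg_pos
    by (intro sum_mono2 divide_nonneg_nonneg mult_nonneg_nonneg) (auto simp: less_imp_le)
next
  fix S v assume *: "S \<subseteq> {..<N}" "v \<in> {..<N} - S"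
  show "0 \<le> up_Bd N w r S v" unfolding up_Bd_def
    using * r w_nonneg wdeg_pos
    by (intro sum_nonneg divide_nonneg_nonneg mult_nonneg_nonneg) (auto simp: less_imp_le subset_iff)
next
  fix S v assume *: "S \<subseteq> {..<N}" "v \<in> S"
  show "0 \<le> dn_Bd N w r S v" unfolding dn_Bd_def
    using * r w_nonneg wdeg_pos
    by (intro sum_nonneg divide_nonneg_nonneg mult_nonneg_nonneg) (auto simp: less_imp_le subset_iff)
qed simp

lemma in_rate_nonneg: "S \<subseteq> {..<N} \<Longrightarrow> v < N \<Longrightarrow> 0 \<le> (\<Sum>u\<in>S. w u v)"
  using w_nonneg by (intro sum_nonneg) auto

lemma dB_denom_pos: "S \<subseteq> {..<N} \<Longrightarrow> v < N \<Longrightarrow> 0 < (\<Sum>u\<in>S. r * w u v) + (\<Sum>u\<in>{..<N} - S. w u v)"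
  using in_fit_pos in_fit_split by metis

lemma dn_dB_eq: "S \<subseteq> {..<N} \<Longrightarrow> v < N \<Longrightarrow> dn_dB N w r S v = 1 - up_dB N w r S v"
  using dB_denom_pos[of S v] by (simp add: up_dB_def dn_dB_def field_simps)

lemma up_dB_mono:
  assumes "S \<subseteq> T" "T \<subseteq> {..<N}" "v < N"
  shows "up_dB N w r S v \<le> up_dB N w r T v"
proof -
  define a b c d where "a = (\<Sum>u\<in>S. r * w u v)" and "b = (\<Sum>u\<in>{..<N} - S. w u v)"
    and "c = (\<Sum>u\<in>T. r * w u v)" and "d = (\<Sum>u\<in>{..<N} - T. w u v)"
  have "0 < a + b" "0 < c + d" unfolding a_def b_def c_def d_def using assms dB_denom_pos by auto
  moreover have "0 \<le> a" "0 \<le> d" unfolding a_def d_def using assms w_nonneg r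
    by (auto intro!: sum_nonneg mult_nonneg_nonneg)
  moreover have "a \<le> c" unfolding a_def c_def using assms w_nonneg r finite_subset[OF assms(2)]
    by (intro sum_mono2) (auto intro!: mult_nonneg_nonneg)
  moreover have "d \<le> b" unfolding b_def d_def using assms w_nonneg r
    by (intro sum_mono2) auto
  moreover from calculation have "a * d \<le> b * c" using mult_mono[of a c d b] by (simp add: mult.commute)
  ultimately have "a / (a + b) \<le> c / (c + d)"
    by (simp add: field_simps)
  thus ?thesis by (simp add: up_dB_def a_def b_def c_def d_def)
qed

lemma spins_dB: "attractive_spins {..<N} (up_dB N w r) (dn_dB N w r)"
proof
  fix S assume "S \<subset> {..<N}" "S \<noteq> {}"
  then obtain u v where uv: "u \<in> S" "v \<in> {..<N} - S" "0 < w u v" using boundary_edge by blast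
  have fS: "finite S" using \<open>S \<subset> {..<N}\<close> finite_subset by blast
  have "0 < up_dB N w r S v" unfolding up_dB_def
    using uv \<open>S \<subset> {..<N}\<close> r w_nonneg dB_denom_pos fS
    by (intro sum_pos2[of _ u] mult_nonneg_nonneg divide_pos_pos mult_pos_pos) auto
  thus "\<exists>v\<in>{..<N} - S. 0 < up_dB N w r S v" using uv by blast
next
  fix S T v assume *: "S \<subseteq> T" "T \<subseteq> {..<N}" "v \<in> {..<N} - T"
  show "up_dB N w r S v \<le> up_dB N w r T v" using * up_dB_mono by auto
next
  fix S T v assume *: "S \<subseteq> T" "T \<subseteq> {..<N}" "v \<in> S"
  hence "S \<subseteq> {..<N}" "v < N" by auto
  thus "dn_dB N w r T v \<le> dn_dB N w r S v" using * up_dB_mono[of S T v] by (simp add: dn_dB_eq)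
next
  fix S v assume *: "S \<subseteq> {..<N}" "v \<in> {..<N} - S"
  show "0 \<le> up_dB N w r S v" unfolding up_dB_def
    using * r w_nonneg dB_denom_pos[of S v]
    by (intro sum_nonneg divide_nonneg_nonneg mult_nonneg_nonneg) (auto simp: less_imp_le subset_iff)
next
  fix S v assume *: "S \<subseteq> {..<N}" "v \<in> S"
  show "0 \<le> dn_dB N w r S v" unfolding dn_dB_def
    using * r w_nonneg dB_denom_pos[of S v]
    by (intro sum_nonneg divide_nonneg_nonneg mult_nonneg_nonneg) (auto simp: less_imp_le subset_iff)
qed simp

lemma harmonic_Bd: "attractive_spins.harmonic {..<N} (up_Bd N w r) (dn_Bd N w r) (fixation N (trans_Bd N w r))"
  unfolding attractive_spins.harmonic_def[OF spins_Bd]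
  using stochastic_Bd gen_fixation_Bd stochastic.fixation_bounds stochastic.fixation_full stochastic.fixation_empty
  by simp

lemma harmonic_dB: "attractive_spins.harmonic {..<N} (up_dB N w r) (dn_dB N w r) (fixation N (trans_dB N w r))"
  unfolding attractive_spins.harmonic_def[OF spins_dB]
  using stochastic_dB gen_fixation_dB stochastic.fixation_bounds stochastic.fixation_full stochastic.fixation_empty
  by simp

text \<open>Reproductive values of the neutral process; they are submartingales for r at least 1.\<close>
definition V_Bd where "V_Bd S = (\<Sum>u\<in>S. 1 / wdeg N w u) / (\<Sum>u<N. 1 / wdeg N w u)"
definition V_dB where "V_dB S = (\<Sum>u\<in>S. wdeg N w u) / (\<Sum>u<N. wdeg N w u)"

lemma V_denoms: "0 < (\<Sum>u<N. 1 / wdeg N w u)" "0 < (\<Sum>u<N. wdeg N w u)"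
  using N2 wdeg_pos by (auto intro!: sum_pos simp: lessThan_empty_iff)

lemma V_ends: "V_Bd {} = 0" "V_Bd {..<N} = 1" "V_dB {} = 0" "V_dB {..<N} = 1"
  using V_denoms by (auto simp: V_Bd_def V_dB_def)

lemma gen_V_Bd:
  assumes S: "S \<subseteq> {..<N}"
  shows "0 \<le> gen {..<N} (up_Bd N w r) (dn_Bd N w r) V_Bd S" (is ?a)
    and "r = 1 \<Longrightarrow> gen {..<N} (up_Bd N w r) (dn_Bd N w r) V_Bd S = 0" (is "_ \<Longrightarrow> ?b")
proof -
  define X where "X = (\<Sum>v\<in>{..<N}-S. \<Sum>u\<in>S. w u v / (wdeg N w u * wdeg N w v))"
  have "(\<Sum>v\<in>S. dn_Bd N w r S v * (1 / wdeg N w v)) = (\<Sum>v\<in>S. \<Sum>u\<in>{..<N}-S. w v u / (wdeg N w u * wdeg N w v))"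
    using S w_sym by (auto simp: dn_Bd_def sum_divide_distrib intro!: sum.cong)
  also have "\<dots> = X" unfolding X_def by (subst sum.swap) (simp add: mult.commute)
  finally have 1: "(\<Sum>v\<in>S. dn_Bd N w r S v * (1 / wdeg N w v)) = X" .
  have 2: "(\<Sum>v\<in>{..<N}-S. up_Bd N w r S v * (1 / wdeg N w v)) = r * X"
    by (simp add: X_def up_Bd_def sum_distrib_left sum_divide_distrib)
  have X: "0 \<le> X" unfolding X_def using S w_nonneg wdeg_pos
    by (intro sum_nonneg divide_nonneg_nonneg mult_nonneg_nonneg) (auto simp: less_imp_le subset_iff)
  have "gen {..<N} (up_Bd N w r) (dn_Bd N w r) V_Bd S = (r * X - X) / (\<Sum>u<N. 1 / wdeg N w u)"
    unfolding V_Bd_def using gen_additive[of "{..<N}" S "up_Bd N w r" "dn_Bd N w r" "\<lambda>u. 1 / wdeg N w u"] S 1 2 by simp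
  moreover have "X \<le> r * X" using X r by (simp add: mult_le_cancel_right1)
  ultimately show ?a and "r = 1 \<Longrightarrow> ?b" using V_denoms by auto
qed

lemma gen_V_dB:
  assumes S: "S \<subseteq> {..<N}"
  shows "0 \<le> gen {..<N} (up_dB N w r) (dn_dB N w r) V_dB S" (is ?a)
    and "r = 1 \<Longrightarrow> gen {..<N} (up_dB N w r) (dn_dB N w r) V_dB S = 0" (is "_ \<Longrightarrow> ?b")
proof -
  define M R where "M v = (\<Sum>u\<in>S. w u v)" and "R v = (\<Sum>u\<in>{..<N}-S. w u v)" for v
  have MR: "M v + R v = wdeg N w v" if "v < N" for v
    using in_wdeg[OF that] S by (simp add: M_def R_def sum.subset_diff[of S "{..<N}"])
  have nn: "0 \<le> M v" "0 \<le> R v" if "v < N" for v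
    using that S in_rate_nonneg by (auto simp: M_def R_def)
  have pos: "0 < r * M v + R v" if "v < N" for v
    using dB_denom_pos[OF S that] by (simp add: M_def R_def sum_distrib_left)
  have upe: "up_dB N w r S v = r * M v / (r * M v + R v)" "dn_dB N w r S v = R v / (r * M v + R v)" for v
    by (simp_all add: up_dB_def dn_dB_def M_def R_def sum_distrib_left)
  have "(\<Sum>v\<in>{..<N}-S. M v) = (\<Sum>u\<in>S. \<Sum>v\<in>{..<N}-S. w u v)" unfolding M_def by (rule sum.swap)
  also have "\<dots> = (\<Sum>v\<in>S. R v)" unfolding R_def using S w_sym by (intro sum.cong) auto
  finally have MRsum: "(\<Sum>v\<in>{..<N}-S. M v) = (\<Sum>v\<in>S. R v)" .
  have k1: "M v \<le> up_dB N w r S v * wdeg N w v" if "v < N" for v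
  proof -
    have "M v * (r * M v + R v) \<le> r * M v * (M v + R v)"
      using nn[OF that] r mult_right_mono[of 1 r "M v * R v"] by (simp add: algebra_simps)
    thus ?thesis using pos[OF that] MR[OF that] by (simp add: upe field_simps)
  qed
  have k2: "dn_dB N w r S v * wdeg N w v \<le> R v" if "v < N" for v
  proof -
    have "M v * R v \<le> r * (M v * R v)"
      using nn[OF that] r mult_right_mono[of 1 r "M v * R v"] by simp
    hence "R v * (M v + R v) \<le> R v * (r * M v + R v)"
      by (simp add: algebra_simps)
    thus ?thesis using pos[OF that] MR[OF that] by (simp add: upe field_simps)
  qed
  have g: "gen {..<N} (up_dB N w r) (dn_dB N w r) V_dB S = ((\<Sum>v\<in>{..<N}-S. up_dB N w r S v * wdeg N w v)
     - (\<Sum>v\<in>S. dn_dB N w r S v * wdeg N w v)) / (\<Sum>u<N. wdeg N w u)"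
    unfolding V_dB_def using gen_additive[of "{..<N}" S] S by simp
  have "(\<Sum>v\<in>S. dn_dB N w r S v * wdeg N w v) \<le> (\<Sum>v\<in>S. R v)" using k2 S by (intro sum_mono) auto
  also have "\<dots> \<le> (\<Sum>v\<in>{..<N}-S. up_dB N w r S v * wdeg N w v)"
    unfolding MRsum[symmetric] using k1 by (intro sum_mono) auto
  finally show ?a using g V_denoms by simp
  assume r1: "r = 1"
  have e: "dn_dB N w r S v * wdeg N w v = R v" "up_dB N w r S v * wdeg N w v = M v" if "v < N" for v
    unfolding upe using pos[OF that] MR[OF that] r1 by simp_all
  have "(\<Sum>v\<in>S. dn_dB N w r S v * wdeg N w v) = (\<Sum>v\<in>S. R v)"
    using S e by (intro sum.cong refl) auto
  moreover have "(\<Sum>v\<in>{..<N}-S. up_dB N w r S v * wdeg N w v) = (\<Sum>v\<in>{..<N}-S. M v)"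
    using e by (intro sum.cong refl) auto
  ultimately show ?b using g MRsum by simp
qed

lemma fixation_ge_V_Bd: "S \<subseteq> {..<N} \<Longrightarrow> V_Bd S \<le> fixation N (trans_Bd N w r) S"
  by (rule attractive_spins.subharmonic_le[OF spins_Bd harmonic_Bd]) (use gen_V_Bd V_ends in \<open>simp_all add: psubset_imp_subset\<close>)

lemma fixation_ge_V_dB: "S \<subseteq> {..<N} \<Longrightarrow> V_dB S \<le> fixation N (trans_dB N w r) S"
  by (rule attractive_spins.subharmonic_le[OF spins_dB harmonic_dB]) (use gen_V_dB V_ends in \<open>simp_all add: psubset_imp_subset\<close>)

lemma rho_neutral_Bd: "r = 1 \<Longrightarrow> rho_Bd r N w = 1 / N"
proof -
  assume r1: "r = 1"
  have "fixation N (trans_Bd N w r) S = V_Bd S" if "S \<subseteq> {..<N}" for S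
    by (rule antisym[OF _ fixation_ge_V_Bd[OF that]],
        rule attractive_spins.harmonic_le_superharmonic[OF spins_Bd harmonic_Bd])
       (use gen_V_Bd r1 V_ends that in \<open>simp_all add: psubset_imp_subset\<close>)
  hence "(\<Sum>v<N. fixation N (trans_Bd N w r) {v}) = (\<Sum>v<N. V_Bd {v})" by simp
  also have "\<dots> = (\<Sum>v<N. 1 / wdeg N w v) / (\<Sum>u<N. 1 / wdeg N w u)"
    unfolding V_Bd_def sum_divide_distrib by simp
  also have "\<dots> = 1" using V_denoms by simp
  finally show ?thesis by (simp add: rho_Bd_def)
qed

lemma rho_neutral_dB: "r = 1 \<Longrightarrow> rho_dB r N w = 1 / N"
proof -
  assume r1: "r = 1"
  have "fixation N (trans_dB N w r) S = V_dB S" if "S \<subseteq> {..<N}" for S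
    by (rule antisym[OF _ fixation_ge_V_dB[OF that]],
        rule attractive_spins.harmonic_le_superharmonic[OF spins_dB harmonic_dB])
       (use gen_V_dB r1 V_ends that in \<open>simp_all add: psubset_imp_subset\<close>)
  hence "(\<Sum>v<N. fixation N (trans_dB N w r) {v}) = (\<Sum>v<N. V_dB {v})" by simp
  also have "\<dots> = (\<Sum>v<N. wdeg N w v) / (\<Sum>u<N. wdeg N w u)"
    unfolding V_dB_def sum_divide_distrib by simp
  also have "\<dots> = 1" using V_denoms by simp
  finally show ?thesis by (simp add: rho_dB_def)
qed

end

subsection \<open>Subtraction-free state elimination\<close>

definition rbox :: "(real \<times> real) set" where "rbox = {0..1} \<times> {1..6/5}"

definition pbox :: "(real \<times> real) set" where "pbox = {0<..1} \<times> {1..6/5}"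

definition r_regular :: "(real \<times> real \<Rightarrow> real) \<Rightarrow> bool" where
  "r_regular g \<longleftrightarrow> continuous_on rbox g \<and>
     (\<exists>G. continuous_on rbox G \<and> (\<forall>z\<in>rbox. g z = g (fst z, 1) + (snd z - 1) * G z))"

lemma pbox_subset: "z \<in> pbox \<Longrightarrow> z \<in> rbox" by (auto simp: pbox_def rbox_def)

lemma pbox_fst: "z \<in> pbox \<Longrightarrow> 0 < fst z" by (auto simp: pbox_def)

lemma box_base: "z \<in> rbox \<Longrightarrow> (fst z, 1) \<in> rbox" by (auto simp: rbox_def)

lemma continuous_on_base:
  assumes "continuous_on rbox g" shows "continuous_on rbox (\<lambda>z. g (fst z, 1))"
  by (rule continuous_on_compose2[OF assms]) (auto intro!: continuous_intros simp: rbox_def)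

lemma r_regular_const: "r_regular (\<lambda>_. c)"
  unfolding r_regular_def by (auto intro!: continuous_intros exI[of _ "\<lambda>_. 0"])

lemma r_regular_fst: "r_regular fst"
  unfolding r_regular_def by (auto intro!: continuous_intros exI[of _ "\<lambda>_. 0"])

lemma r_regular_snd: "r_regular snd"
  unfolding r_regular_def by (auto intro!: continuous_intros exI[of _ "\<lambda>_. 1"])

lemma r_regular_add:
  assumes "r_regular f" "r_regular g" shows "r_regular (\<lambda>z. f z + g z)"
proof -
  from assms obtain F G where "continuous_on rbox F" "continuous_on rbox G"
    "\<forall>z\<in>rbox. f z = f (fst z, 1) + (snd z - 1) * F z" "\<forall>z\<in>rbox. g z = g (fst z, 1) + (snd z - 1) * G z"
    by (auto simp: r_regular_def)
  thus ?thesis using assms unfolding r_regular_def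
    by (intro conjI continuous_intros exI[of _ "\<lambda>z. F z + G z"] ballI) (auto simp: algebra_simps)
qed

lemma r_regular_mult:
  assumes "r_regular f" "r_regular g" shows "r_regular (\<lambda>z. f z * g z)"
proof -
  from assms obtain F G where FG: "continuous_on rbox F" "continuous_on rbox G"
    and f: "\<And>z. z \<in> rbox \<Longrightarrow> f z = f (fst z, 1) + (snd z - 1) * F z"
    and g: "\<And>z. z \<in> rbox \<Longrightarrow> g z = g (fst z, 1) + (snd z - 1) * G z"
    unfolding r_regular_def by metis
  have c: "continuous_on rbox f" "continuous_on rbox g" using assms by (auto simp: r_regular_def)
  have "f z * g z = f (fst z, 1) * g (fst z, 1) + (snd z - 1) * (F z * g z + f (fst z, 1) * G z)" if "z \<in> rbox" for z
  proof -
    have "f z * g z = f (fst z, 1) * g z + (snd z - 1) * F z * g z" by (subst f[OF that]) (simp add: algebra_simps)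
    also have "f (fst z, 1) * g z = f (fst z, 1) * g (fst z, 1) + (snd z - 1) * (f (fst z, 1) * G z)"
      by (subst g[OF that]) (simp add: algebra_simps)
    finally show ?thesis by (simp add: algebra_simps)
  qed
  thus ?thesis unfolding r_regular_def using FG c
    by (intro conjI exI[of _ "\<lambda>z. F z * g z + f (fst z, 1) * G z"] ballI continuous_intros continuous_on_base) auto
qed

lemma r_regular_inverse:
  assumes "r_regular f" "\<And>z. z \<in> rbox \<Longrightarrow> 0 < f z" shows "r_regular (\<lambda>z. inverse (f z))"
proof -
  from assms obtain F where F: "continuous_on rbox F"
    and f: "\<And>z. z \<in> rbox \<Longrightarrow> f z = f (fst z, 1) + (snd z - 1) * F z"
    unfolding r_regular_def by metis
  have c: "continuous_on rbox f" using assms by (auto simp: r_regular_def)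
  have "inverse (f z) = inverse (f (fst z, 1)) + (snd z - 1) * (- F z * inverse (f z) * inverse (f (fst z, 1)))"
    if "z \<in> rbox" for z
  proof -
    have p: "0 < f z" "0 < f (fst z, 1)" using assms(2) that box_base by auto
    have "inverse (f z) - inverse (f (fst z, 1)) = (f (fst z, 1) - f z) * inverse (f z) * inverse (f (fst z, 1))"
      using p by (simp add: field_simps)
    also have "f (fst z, 1) - f z = - ((snd z - 1) * F z)" using f[OF that] by simp
    finally show ?thesis by (simp add: algebra_simps)
  qed
  moreover have "f z \<noteq> 0" "f (fst z, 1) \<noteq> 0" if "z \<in> rbox" for z using assms(2)[OF that] assms(2)[OF box_base[OF that]] by auto
  ultimately show ?thesis unfolding r_regular_def using F c
    by (intro conjI exI[of _ "\<lambda>z. - F z * inverse (f z) * inverse (f (fst z, 1))"] ballI continuous_intros continuous_on_base) auto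
qed

lemma r_regular_power: "r_regular f \<Longrightarrow> r_regular (\<lambda>z. f z ^ k)"
  by (induction k) (auto intro: r_regular_const r_regular_mult)

definition pos_scaled :: "(real \<times> real \<Rightarrow> real) \<Rightarrow> bool" where
  "pos_scaled f \<longleftrightarrow> (\<exists>a b g. r_regular g \<and> (\<forall>z\<in>rbox. 0 < g z) \<and> (\<forall>z\<in>pbox. f z = fst z ^ b / fst z ^ a * g z))"

definition scaled :: "(real \<times> real \<Rightarrow> real) \<Rightarrow> bool" where
  "scaled f \<longleftrightarrow> (\<forall>z\<in>pbox. f z = 0) \<or> pos_scaled f"

lemma pos_scaled_pos: "pos_scaled f \<Longrightarrow> z \<in> pbox \<Longrightarrow> 0 < f z"
  unfolding pos_scaled_def using pbox_fst[of z] pbox_subset[of z] by (auto intro!: mult_pos_pos divide_pos_pos)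

lemma scaled_nonneg: "scaled f \<Longrightarrow> z \<in> pbox \<Longrightarrow> 0 \<le> f z"
  using pos_scaled_pos[of f z] by (auto simp: scaled_def)

lemma pos_scaled_cls: "pos_scaled f \<Longrightarrow> scaled f" by (simp add: scaled_def)

lemma pbox_ex: "(1, 1) \<in> pbox" by (simp add: pbox_def)

lemma scaled_pcls_iff: "scaled f \<Longrightarrow> z \<in> pbox \<Longrightarrow> pos_scaled f \<longleftrightarrow> 0 < f z"
  using pos_scaled_pos[of f z] by (auto simp: scaled_def)

lemma pos_scaled_const: "0 < c \<Longrightarrow> pos_scaled (\<lambda>_. c)"
  unfolding pos_scaled_def by (intro exI[of _ 0] exI[of _ "\<lambda>_. c"]) (auto intro: r_regular_const)

lemma pos_scaled_fst_power: "pos_scaled (\<lambda>z. fst z ^ k)"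
  unfolding pos_scaled_def by (intro exI[of _ 0] exI[of _ k] exI[of _ "\<lambda>_. 1"]) (auto intro: r_regular_const)

lemma pos_scaled_snd: "pos_scaled snd"
  unfolding pos_scaled_def by (intro exI[of _ 0] exI[of _ snd]) (auto intro: r_regular_snd simp: rbox_def)

lemma pos_scaled_mult:
  assumes "pos_scaled f" "pos_scaled g" shows "pos_scaled (\<lambda>z. f z * g z)"
proof -
  obtain a b f' where f: "r_regular f'" "\<forall>z\<in>rbox. 0 < f' z" "\<forall>z\<in>pbox. f z = fst z ^ b / fst z ^ a * f' z"
    using assms(1) by (auto simp: pos_scaled_def)
  obtain c d g' where g: "r_regular g'" "\<forall>z\<in>rbox. 0 < g' z" "\<forall>z\<in>pbox. g z = fst z ^ d / fst z ^ c * g' z"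
    using assms(2) by (auto simp: pos_scaled_def)
  show ?thesis unfolding pos_scaled_def
    by (intro exI[of _ "a + c"] exI[of _ "b + d"] exI[of _ "\<lambda>z. f' z * g' z"])
       (use f g in \<open>auto intro: r_regular_mult simp: power_add\<close>)
qed

lemma pos_scaled_inverse:
  assumes "pos_scaled f" shows "pos_scaled (\<lambda>z. inverse (f z))"
proof -
  obtain a b f' where f: "r_regular f'" "\<forall>z\<in>rbox. 0 < f' z" "\<forall>z\<in>pbox. f z = fst z ^ b / fst z ^ a * f' z"
    using assms(1) by (auto simp: pos_scaled_def)
  have "\<forall>z\<in>pbox. inverse (f z) = fst z ^ a / fst z ^ b * inverse (f' z)"
    using f(3) by (simp add: divide_inverse)
  thus ?thesis unfolding pos_scaled_def
    using f r_regular_inverse[of f'] by (intro exI[of _ b] exI[of _ a] exI[of _ "\<lambda>z. inverse (f' z)"]) simp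
qed

lemma pos_scaled_add_aux:
  assumes f: "r_regular f'" "\<forall>z\<in>rbox. 0 < f' z" "\<forall>z\<in>pbox. f z = fst z ^ b / fst z ^ a * f' z"
    and g: "r_regular g'" "\<forall>z\<in>rbox. 0 < g' z" "\<forall>z\<in>pbox. g z = fst z ^ d / fst z ^ c * g' z"
    and le: "b + c \<le> d + a"
  shows "pos_scaled (\<lambda>z. f z + g z)"
proof -
  define e where "e = d + a - (b + c)"
  have e: "d + a = e + (b + c)" using le by (simp add: e_def)
  let ?k = "\<lambda>z. f' z + fst z ^ e * g' z"
  have "f z + g z = fst z ^ (b + c) / fst z ^ (a + c) * ?k z" if z: "z \<in> pbox" for z
  proof -
    have t: "fst z \<noteq> 0" using pbox_fst[OF z] by simp
    have "fst z ^ d / fst z ^ c = fst z ^ (d + a) / fst z ^ (a + c)"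
      using t by (simp add: power_add)
    also have "\<dots> = fst z ^ (b + c) / fst z ^ (a + c) * fst z ^ e" by (simp add: e power_add)
    finally have *: "fst z ^ d / fst z ^ c = fst z ^ (b + c) / fst z ^ (a + c) * fst z ^ e" .
    have 1: "g z = fst z ^ (b + c) / fst z ^ (a + c) * fst z ^ e * g' z"
      unfolding *[symmetric] using g(3) z by simp
    have 2: "f z = fst z ^ (b + c) / fst z ^ (a + c) * f' z" using f(3) z t by (simp add: power_add)
    show ?thesis by (simp only: 1 2 distrib_left mult.assoc)
  qed
  moreover have "r_regular ?k" using f g by (intro r_regular_add r_regular_mult r_regular_power r_regular_fst)
  moreover have "0 < ?k z" if "z \<in> rbox" for z
  proof -
    have "0 \<le> fst z" using that by (auto simp: rbox_def)
    thus ?thesis using f(2) g(2) that by (intro add_pos_nonneg mult_nonneg_nonneg) (auto simp: less_imp_le)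
  qed
  ultimately show ?thesis unfolding pos_scaled_def by blast
qed

lemma pos_scaled_add:
  assumes "pos_scaled f" "pos_scaled g" shows "pos_scaled (\<lambda>z. f z + g z)"
proof -
  obtain a b f' where f: "r_regular f'" "\<forall>z\<in>rbox. 0 < f' z" "\<forall>z\<in>pbox. f z = fst z ^ b / fst z ^ a * f' z"
    using assms(1) by (auto simp: pos_scaled_def)
  obtain c d g' where g: "r_regular g'" "\<forall>z\<in>rbox. 0 < g' z" "\<forall>z\<in>pbox. g z = fst z ^ d / fst z ^ c * g' z"
    using assms(2) by (auto simp: pos_scaled_def)
  show ?thesis
  proof (cases "b + c \<le> d + a")
    case True thus ?thesis by (rule pos_scaled_add_aux[OF f g])
  next
    case False
    hence "pos_scaled (\<lambda>z. g z + f z)" by (intro pos_scaled_add_aux[OF g f]) simp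
    thus ?thesis by (simp add: add.commute)
  qed
qed

lemma pos_scaled_cong: "(\<And>z. z \<in> pbox \<Longrightarrow> f z = g z) \<Longrightarrow> pos_scaled f \<Longrightarrow> pos_scaled g"
  unfolding pos_scaled_def by (simp cong: ball_cong)

lemma scaled_cong: "(\<And>z. z \<in> pbox \<Longrightarrow> f z = g z) \<Longrightarrow> scaled f \<Longrightarrow> scaled g"
  unfolding scaled_def using pos_scaled_cong[of f g] by auto

lemma scaled_const: "0 \<le> c \<Longrightarrow> scaled (\<lambda>_. c)"
  by (cases "c = 0") (auto simp: scaled_def intro: pos_scaled_const)

lemma scaled_add:
  assumes "scaled f" "scaled g" shows "scaled (\<lambda>z. f z + g z)"
proof (cases "(\<forall>z\<in>pbox. f z = 0) \<or> (\<forall>z\<in>pbox. g z = 0)")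
  case True
  thus ?thesis
  proof
    assume "\<forall>z\<in>pbox. f z = 0" thus ?thesis by (intro scaled_cong[OF _ assms(2)]) simp
  next
    assume "\<forall>z\<in>pbox. g z = 0" thus ?thesis by (intro scaled_cong[OF _ assms(1)]) simp
  qed
next
  case False
  hence "pos_scaled f" "pos_scaled g" using assms unfolding scaled_def by blast+
  thus ?thesis by (intro pos_scaled_cls pos_scaled_add)
qed

lemma scaled_mult: "scaled f \<Longrightarrow> scaled g \<Longrightarrow> scaled (\<lambda>z. f z * g z)"
  unfolding scaled_def using pos_scaled_mult[of f g] by auto

lemma scaled_divide: "scaled f \<Longrightarrow> scaled g \<Longrightarrow> scaled (\<lambda>z. f z / g z)"
  unfolding scaled_def divide_inverse using pos_scaled_mult[of f "\<lambda>z. inverse (g z)"] pos_scaled_inverse[of g] by auto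

lemma scaled_sum: "(\<And>i. i \<in> I \<Longrightarrow> scaled (f i)) \<Longrightarrow> scaled (\<lambda>z. \<Sum>i\<in>I. f i z)"
  by (induction I rule: infinite_finite_induct) (auto intro: scaled_const scaled_add)

lemma scaled_bounded_extends:
  assumes "scaled f" "\<And>z. z \<in> pbox \<Longrightarrow> f z \<le> 1"
  obtains F where "r_regular F" "\<And>z. z \<in> pbox \<Longrightarrow> F z = f z"
proof (cases "\<forall>z\<in>pbox. f z = 0")
  case True thus ?thesis using that[of "\<lambda>_. 0"] r_regular_const by auto
next
  case False
  with assms(1) have "pos_scaled f" by (simp add: scaled_def)
  then obtain a b g where g: "r_regular g" "\<forall>z\<in>rbox. 0 < g z" "\<forall>z\<in>pbox. f z = fst z ^ b / fst z ^ a * g z"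
    by (auto simp: pos_scaled_def)
  show ?thesis
  proof (cases "a \<le> b")
    case True
    show ?thesis
    proof (rule that[of "\<lambda>z. fst z ^ (b - a) * g z"])
      show "r_regular (\<lambda>z. fst z ^ (b - a) * g z)" using g by (intro r_regular_mult r_regular_power r_regular_fst)
      show "fst z ^ (b - a) * g z = f z" if "z \<in> pbox" for z
        using g(3) that True pbox_fst[OF that] by (simp add: power_diff)
    qed
  next
    case False
    have le: "g (t, 1) \<le> t" if "0 < t" "t \<le> 1" for t
    proof -
      have z: "(t, 1) \<in> pbox" using that by (simp add: pbox_def)
      have "t ^ b * g (t, 1) \<le> t ^ a" using assms(2)[OF z] g(3) z that by (simp add: field_simps)
      also have "t ^ a \<le> t ^ (b + 1)" using False that by (intro power_decreasing) auto
      finally show ?thesis using that by simp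
    qed
    have c: "continuous_on rbox g" using g(1) by (simp add: r_regular_def)
    have "continuous_on {0..1} (\<lambda>t. g (t, 1))"
      by (rule continuous_on_compose2[OF c]) (auto intro!: continuous_intros simp: rbox_def)
    hence "((\<lambda>t. g (t, 1)) \<longlongrightarrow> g (0, 1)) (at 0 within {0..1})" by (simp add: continuous_on)
    hence l: "((\<lambda>t. g (t, 1)) \<longlongrightarrow> g (0, 1)) (at_right 0)"
      by (simp add: at_within_Icc_at_right)
    have "g (0, 1) \<le> 0"
      by (rule tendsto_le[OF _ tendsto_ident_at l]) (auto simp: eventually_at_right[of 0 1] intro!: exI[of _ 1] le)
    moreover have "0 < g (0, 1)" using g(2) by (auto simp: rbox_def)
    ultimately show ?thesis by simp
  qed
qed

text \<open>State elimination uses no subtraction, so it never leaves the class.\<close>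
lemma scaled_elimination:
  fixes q :: "'s \<Rightarrow> 's \<Rightarrow> real \<times> real \<Rightarrow> real"
  assumes "finite X" "finite Y" "X \<inter> Y = {}"
    and "\<And>i j. scaled (q i j)"
    and "\<And>z i. z \<in> pbox \<Longrightarrow> i \<in> X \<Longrightarrow> (\<Sum>j\<in>X \<union> Y. q i j z * (h j z - h i z)) = 0"
    and "\<And>W. W \<subseteq> X \<Longrightarrow> W \<noteq> {} \<Longrightarrow> \<exists>i\<in>W. \<exists>j\<in>(X \<union> Y) - W. pos_scaled (q i j)"
    and "\<And>y. y \<in> Y \<Longrightarrow> scaled (h y)"
  shows "i \<in> X \<Longrightarrow> scaled (h i)"
  using assms
proof (induction X arbitrary: q i rule: finite_induct)
  case empty thus ?case by simp
next
  case (insert x X)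
  define E where "E = X \<union> Y"
  have fE: "finite E" "x \<notin> E" and ins: "insert x X \<union> Y = insert x E"
    using insert by (auto simp: E_def)
  define Q where "Q z = (\<Sum>j\<in>E. q x j z)" for z
  define q' where "q' i j z = q i j z + q i x z * q x j z / Q z" for i j z
  have clsq: "scaled (q i j)" for i j using insert.prems by blast
  have eq: "(\<Sum>j\<in>insert x E. q i j z * (h j z - h i z)) = 0" if "z \<in> pbox" "i \<in> insert x X" for z i
    using insert.prems(5)[OF that(1), of i] that ins by simp
  have nc: "\<exists>i\<in>W. \<exists>j\<in>insert x E - W. pos_scaled (q i j)" if "W \<subseteq> insert x X" "W \<noteq> {}" for W
    using insert.prems(6)[OF that] ins by simp
  have clsQ: "scaled Q" unfolding Q_def by (intro scaled_sum clsq)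
  have Qpos: "0 < Q z" if z: "z \<in> pbox" for z
  proof -
    obtain j where "j \<in> insert x E - {x}" "pos_scaled (q x j)" using nc[of "{x}"] by auto
    thus ?thesis unfolding Q_def using fE pos_scaled_pos[OF _ z] scaled_nonneg[OF clsq z]
      by (intro sum_pos2[of _ j]) auto
  qed
  have hx: "Q z * h x z = (\<Sum>j\<in>E. q x j z * h j z)" if z: "z \<in> pbox" for z
    using eq[OF z, of x] fE by (simp add: Q_def right_diff_distrib sum_subtractf sum_distrib_right)
  have clsq': "scaled (q' i j)" for i j
    unfolding q'_def by (intro scaled_add scaled_divide scaled_mult clsq clsQ)
  have IH: "scaled (h i)" if "i \<in> X" for i
  proof (rule insert.IH[OF that insert.prems(2) _ clsq' _ _ insert.prems(7)])
    show "X \<inter> Y = {}" using insert.prems by auto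
    fix z i assume z: "z \<in> pbox" and i: "i \<in> X"
    have "(\<Sum>j\<in>E. q' i j z * (h j z - h i z))
      = (\<Sum>j\<in>E. q i j z * (h j z - h i z)) + q i x z / Q z * (\<Sum>j\<in>E. q x j z * (h j z - h i z))"
      by (simp add: q'_def distrib_right sum.distrib sum_distrib_left mult.assoc)
    also have "(\<Sum>j\<in>E. q x j z * (h j z - h i z)) = Q z * (h x z - h i z)"
      using hx[OF z] by (simp add: Q_def right_diff_distrib sum_subtractf sum_distrib_right)
    also have "q i x z / Q z * (Q z * (h x z - h i z)) = q i x z * (h x z - h i z)"
      using Qpos[OF z] by simp
    finally show "(\<Sum>j\<in>X \<union> Y. q' i j z * (h j z - h i z)) = 0"
      using eq[OF z, of i] i fE by (simp add: E_def)
  next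
    fix W assume W: "W \<subseteq> X" "W \<noteq> {}"
    have p1: "pos_scaled (q' i j)" if "pos_scaled (q i j)" for i j
    proof -
      have "0 < q i j (1, 1)" using that pos_scaled_pos pbox_ex by blast
      moreover have "0 \<le> q i x (1, 1) * q x j (1, 1) / Q (1, 1)"
        using scaled_nonneg[OF clsq pbox_ex] Qpos[OF pbox_ex] by (intro divide_nonneg_pos mult_nonneg_nonneg)
      ultimately show ?thesis using scaled_pcls_iff[OF clsq' pbox_ex] by (simp add: q'_def)
    qed
    obtain i j where ij: "i \<in> W" "j \<in> insert x E - W" "pos_scaled (q i j)" using nc[of W] W by auto
    show "\<exists>i\<in>W. \<exists>j\<in>X \<union> Y - W. pos_scaled (q' i j)"
    proof (cases "j = x")
      case False thus ?thesis using ij p1 by (auto simp: E_def)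
    next
      case True
      obtain i' j' where ij': "i' \<in> insert x W" "j' \<in> insert x E - insert x W" "pos_scaled (q i' j')"
        using nc[of "insert x W"] W by auto
      show ?thesis
      proof (cases "i' = x")
        case False thus ?thesis using ij' p1 by (auto simp: E_def)
      next
        case i': True
        have "0 < q i x (1, 1) * q x j' (1, 1) / Q (1, 1)"
          using ij ij' True i' pos_scaled_pos[OF _ pbox_ex] Qpos[OF pbox_ex] by (intro divide_pos_pos mult_pos_pos) auto
        moreover have "0 \<le> q i j' (1, 1)" using scaled_nonneg[OF clsq pbox_ex] by blast
        ultimately have "pos_scaled (q' i j')" using scaled_pcls_iff[OF clsq' pbox_ex] by (simp add: q'_def)
        thus ?thesis using ij ij' by (auto simp: E_def)
      qed
    qed
  qed
  show ?case
  proof (cases "i = x")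
    case False thus ?thesis using IH insert.prems(1) by auto
  next
    case True
    have c: "scaled (\<lambda>z. (\<Sum>j\<in>E. q x j z * h j z) / Q z)"
      by (intro scaled_divide scaled_sum scaled_mult clsq clsQ) (use IH insert.prems(7) in \<open>auto simp: E_def\<close>)
    have "(\<Sum>j\<in>E. q x j z * h j z) / Q z = h x z" if z: "z \<in> pbox" for z
      using hx[OF z] Qpos[OF z] by (simp add: field_simps)
    from scaled_cong[OF this c] show ?thesis by (simp only: True)
  qed
qed

subsection \<open>Flip rates and comparison with error terms\<close>

definition flip :: "'a set \<Rightarrow> 'a \<Rightarrow> 'a set" where
  "flip S v = (if v \<in> S then S - {v} else insert v S)"

definition rate :: "('a set \<Rightarrow> 'a \<Rightarrow> real) \<Rightarrow> ('a set \<Rightarrow> 'a \<Rightarrow> real) \<Rightarrow> 'a set \<Rightarrow> 'a \<Rightarrow> real" where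
  "rate A B S v = (if v \<in> S then B S v else A S v)"

lemma gen_flip:
  assumes "finite U" "S \<subseteq> U"
  shows "gen U A B g S = (\<Sum>v\<in>U. rate A B S v * (g (flip S v) - g S))"
proof -
  have "(\<Sum>v\<in>U. rate A B S v * (g (flip S v) - g S)) =
     (\<Sum>v\<in>U-S. rate A B S v * (g (flip S v) - g S)) + (\<Sum>v\<in>S. rate A B S v * (g (flip S v) - g S))"
    using assms by (intro sum.subset_diff)
  thus ?thesis by (simp add: gen_def rate_def flip_def)
qed

lemma gen_drift_function:
  assumes fin: "finite U"
    and A: "\<And>S v. S \<subset> U \<Longrightarrow> S \<noteq> {} \<Longrightarrow> v \<in> U - S \<Longrightarrow> 0 < A S v"
    and B: "\<And>S v. S \<subseteq> U \<Longrightarrow> v \<in> S \<Longrightarrow> 0 \<le> B S v"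
  shows "\<exists>\<tau>. \<forall>S. S \<subset> U \<longrightarrow> S \<noteq> {} \<longrightarrow> gen U A B \<tau> S \<le> -1"
proof -
  define m where "m S = (\<Sum>v\<in>U-S. A S v)" for S
  define b where "b S = (\<Sum>v\<in>S. B S v)" for S
  define X where "X = {S. S \<subset> U \<and> S \<noteq> {}}"
  have fX: "finite X" by (rule finite_subset[of _ "Pow U"]) (use fin in \<open>auto simp: X_def\<close>)
  have mpos: "0 < m S" if "S \<in> X" for S
    unfolding m_def using that A fin by (intro sum_pos) (auto simp: X_def)
  define \<beta> where "\<beta> = 2 + (\<Sum>S\<in>X. (1 + b S) / m S)"
  have bnn: "0 \<le> b S" if "S \<in> X" for S unfolding b_def using that B by (intro sum_nonneg) (auto simp: X_def)
  have sum_nn: "0 \<le> (\<Sum>S\<in>X. (1 + b S) / m S)"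
    using mpos bnn by (intro sum_nonneg divide_nonneg_pos) (auto intro: add_nonneg_nonneg)
  hence b1: "1 < \<beta>" by (simp add: \<beta>_def)
  have ratio: "1 + b S \<le> (\<beta> - 1) * m S" if "S \<in> X" for S
  proof -
    have "(1 + b S) / m S \<le> (\<Sum>S\<in>X. (1 + b S) / m S)"
      using that mpos bnn fX by (intro member_le_sum[where f = "\<lambda>S. (1 + b S) / m S"] divide_nonneg_pos) (auto intro: add_nonneg_nonneg)
    hence "(1 + b S) / m S \<le> \<beta> - 1" by (simp add: \<beta>_def)
    thus ?thesis using mpos[OF that] by (simp add: field_simps)
  qed
  have "gen U A B (\<lambda>S. - (\<beta> ^ card S)) S \<le> -1" if S: "S \<in> X" for S
  proof -
    have SU: "S \<subseteq> U" and fS: "finite S" using S fin finite_subset by (auto simp: X_def)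
    have "(\<Sum>v\<in>U-S. A S v * (- (\<beta> ^ card (insert v S)) - (- (\<beta> ^ card S)))) = (\<Sum>v\<in>U-S. A S v * (- ((\<beta> - 1) * \<beta> ^ card S)))"
      using fS by (intro sum.cong) (auto simp: algebra_simps)
    also have "\<dots> = - ((\<beta> - 1) * m S * \<beta> ^ card S)" by (simp add: m_def sum_distrib_right[symmetric] sum_negf)
    finally have 1: "(\<Sum>v\<in>U-S. A S v * (- (\<beta> ^ card (insert v S)) - (- (\<beta> ^ card S)))) = - ((\<beta> - 1) * m S * \<beta> ^ card S)" .
    have "(\<Sum>v\<in>S. B S v * (- (\<beta> ^ card (S - {v})) - (- (\<beta> ^ card S)))) \<le> (\<Sum>v\<in>S. B S v * \<beta> ^ card S)"
      using B[OF SU] b1 by (intro sum_mono mult_left_mono) auto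
    also have "\<dots> = b S * \<beta> ^ card S" by (simp add: b_def sum_distrib_right)
    finally have "gen U A B (\<lambda>S. - (\<beta> ^ card S)) S \<le> (b S - (\<beta> - 1) * m S) * \<beta> ^ card S"
      using 1 by (simp add: gen_def algebra_simps)
    also have "\<dots> \<le> (-1) * \<beta> ^ card S" using ratio[OF S] b1 by (intro mult_right_mono) auto
    also have "\<dots> \<le> -1" using b1 one_le_power[of \<beta> "card S"] by simp
    finally show ?thesis .
  qed
  thus ?thesis by (intro exI[of _ "\<lambda>S. - (\<beta> ^ card S)"]) (auto simp: X_def)
qed

lemma gen_lower_bound_with_error:
  fixes A B :: "'a set \<Rightarrow> 'a \<Rightarrow> real"
  assumes fin: "finite U"
    and A: "\<And>S v. S \<subset> U \<Longrightarrow> S \<noteq> {} \<Longrightarrow> v \<in> U - S \<Longrightarrow> 0 < A S v"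
    and A0: "\<And>S v. S \<subseteq> U \<Longrightarrow> v \<in> U - S \<Longrightarrow> 0 \<le> A S v"
    and B: "\<And>S v. S \<subseteq> U \<Longrightarrow> v \<in> S \<Longrightarrow> 0 \<le> B S v"
    and f: "\<And>S. S \<subset> U \<Longrightarrow> S \<noteq> {} \<Longrightarrow> gen U A B f S = 0" "f {} = 0" "f U = 1"
  shows "\<exists>C\<ge>0. \<forall>u \<eta> S. 0 \<le> \<eta> \<longrightarrow> (\<forall>S. S \<subset> U \<longrightarrow> S \<noteq> {} \<longrightarrow> gen U A B u S \<le> \<eta>) \<longrightarrow> S \<subseteq> U
       \<longrightarrow> u {} + f S * (u U - u {}) - C * \<eta> \<le> u S"
proof -
  obtain \<tau> where \<tau>: "\<And>S. S \<subset> U \<Longrightarrow> S \<noteq> {} \<Longrightarrow> gen U A B \<tau> S \<le> -1"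
    using gen_drift_function[of U A B, OF fin A B] by blast
  define c where "c = (\<Sum>S\<in>Pow U. \<bar>\<tau> S\<bar>)"
  have c: "\<bar>\<tau> S\<bar> \<le> c" if "S \<subseteq> U" for S
    unfolding c_def using that fin by (intro member_le_sum[where f = "\<lambda>S. \<bar>\<tau> S\<bar>"]) auto
  have c0: "0 \<le> c" unfolding c_def by (intro sum_nonneg) auto
  show ?thesis
  proof (rule exI[of _ "2 * c"], intro conjI allI impI)
    show "0 \<le> 2 * c" using c0 by simp
    fix u :: "'a set \<Rightarrow> real" and \<eta> S
    assume \<eta>: "0 \<le> \<eta>" and u: "\<forall>S. S \<subset> U \<longrightarrow> S \<noteq> {} \<longrightarrow> gen U A B u S \<le> \<eta>" and S: "S \<subseteq> U"
    define g where "g S = ((u {} + (u U - u {}) * f S) - u S) - (\<eta> * c + \<eta> * \<tau> S)" for S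
    have e: "gen U A B g S = (u U - u {}) * gen U A B f S - gen U A B u S - \<eta> * gen U A B \<tau> S" for S
      unfolding g_def gen_diff gen_affine by simp
    have t: "\<eta> * gen U A B \<tau> S \<le> \<eta> * (-1)" if "S \<subset> U" "S \<noteq> {}" for S
      using \<tau>[OF that] \<eta> by (intro mult_left_mono)
    have sub: "0 \<le> gen U A B g S" if "S \<subset> U" "S \<noteq> {}" for S
      using f(1)[OF that] u[rule_format, OF that] t[OF that] unfolding e by simp
    have A_ex: "\<exists>v\<in>U - S. 0 < A S v" if "S \<subset> U" "S \<noteq> {}" for S using A[OF that] that by auto
    have tn: "0 \<le> \<eta> * (c + \<tau> S)" if "S \<subseteq> U" for S using c[OF that] \<eta> by (intro mult_nonneg_nonneg) auto
    have "g S \<le> 0"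
      by (rule gen_max_principle[where g = g and A = A and B = B and U = U, OF fin A0 B _ sub])
         (use f S A_ex tn[of "{}"] tn[of U] in \<open>simp_all add: g_def distrib_left\<close>)
    moreover have "\<eta> * \<tau> S \<le> \<eta> * c" using c[OF S] \<eta> by (intro mult_left_mono) auto
    ultimately show "u {} + f S * (u U - u {}) - 2 * c * \<eta> \<le> u S"
      by (simp add: g_def algebra_simps)
  qed
qed

subsection \<open>A fast hub with slow pairs\<close>

lemma nonpos_of_pos_mult: "0 < a \<Longrightarrow> a * b \<le> 0 \<Longrightarrow> b \<le> 0" for a b :: real
  by (simp add: mult_le_0_iff)

lemma sum_rescale_cube:
  fixes t q :: real assumes "0 < t"
  shows "(\<Sum>v\<in>X. c v * (t * q)) = t ^ 3 * ((\<Sum>v\<in>X. c v / t ^ 2) * q)"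
  unfolding sum_distrib_right[symmetric] sum_divide_distrib[symmetric]
  using assms by (simp add: power2_eq_square power3_eq_cube)

lemma pair_other:
  assumes "card P = 2" "x \<in> P"
  obtains v where "P = {x, v}" "x \<noteq> v"
  using assms by (auto simp: card_2_iff)

text \<open>The state st Z K has mutants on the hub nodes Z and on the pairs in K; only pairs in J are active,
  all further nodes are resident. Suffixes p and m refer to transitions favouring mutants and
  residents: \<kappa> are the rates at which a half mutant pair becomes homogeneous, a and b the
  normalised rates at which active pairs invade the hub and the hub invades an active pair, and
  \<rho> the probabilities that a single invader takes over the hub, whose clique dynamics has rates
  A0, B0 and harmonic function f.\<close>
locale hub_pairs =
  fixes N n :: nat and A B :: "real \<Rightarrow> nat set \<Rightarrow> nat \<Rightarrow> real" and h :: "real \<Rightarrow> nat set \<Rightarrow> real"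
    and h0 :: "nat set \<Rightarrow> real" and Hb J :: "nat set" and pr :: "nat \<Rightarrow> nat set"
    and A0 B0 :: "nat set \<Rightarrow> nat \<Rightarrow> real" and f :: "nat set \<Rightarrow> real"
    and \<kappa>p \<kappa>m ap am bp bm \<rho>p \<rho>m y :: real
    and st :: "nat set \<Rightarrow> nat set \<Rightarrow> nat set"
  assumes st_def: "st = (\<lambda>Z K. Z \<union> (\<Union>j\<in>K. pr j))"
    and spins: "0 < t \<Longrightarrow> t \<le> 1 \<Longrightarrow> attractive_spins {..<N} (A t) (B t)"
    and harm: "0 < t \<Longrightarrow> t \<le> 1 \<Longrightarrow> attractive_spins.harmonic {..<N} (A t) (B t) (h t)"
    and lim: "S \<subseteq> {..<N} \<Longrightarrow> ((\<lambda>t. h t S) \<longlongrightarrow> h0 S) (at_right 0)"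
    and Hb: "Hb \<subseteq> {..<N}" "Hb \<noteq> {}" and J: "finite J" "card J = n" "J \<noteq> {}"
    and pr: "\<And>j. j \<in> J \<Longrightarrow> pr j \<subseteq> {..<N}" "\<And>j. j \<in> J \<Longrightarrow> card (pr j) = 2"
      "\<And>j. j \<in> J \<Longrightarrow> pr j \<inter> Hb = {}" "\<And>i j. i \<in> J \<Longrightarrow> j \<in> J \<Longrightarrow> i \<noteq> j \<Longrightarrow> pr i \<inter> pr j = {}"
    and hub_rate: "\<And>Z K v. Z \<subset> Hb \<Longrightarrow> Z \<noteq> {} \<Longrightarrow> K \<subseteq> J \<Longrightarrow> v \<in> Hb \<Longrightarrow>
       ((\<lambda>t. (rate (A t) (B t) (st Z K) v - rate A0 B0 Z v) / t) \<longlongrightarrow> 0) (at_right 0)"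
    and hub_rate_pairs: "\<And>Z K j v. Z \<subset> Hb \<Longrightarrow> Z \<noteq> {} \<Longrightarrow> K \<subseteq> J \<Longrightarrow> j \<in> J \<Longrightarrow> v \<in> pr j \<Longrightarrow>
       ((\<lambda>t. rate (A t) (B t) (st Z K) v / t) \<longlongrightarrow> 0) (at_right 0)"
    and half_up: "\<And>Z K j x v. Z = {} \<or> Z = Hb \<Longrightarrow> K \<subseteq> J - {j} \<Longrightarrow> j \<in> J \<Longrightarrow> pr j = {x, v} \<Longrightarrow> x \<noteq> v \<Longrightarrow>
       ((\<lambda>t. rate (A t) (B t) (insert x (st Z K)) v) \<longlongrightarrow> \<kappa>p) (at_right 0)"
    and half_down: "\<And>Z K j x v. Z = {} \<or> Z = Hb \<Longrightarrow> K \<subseteq> J - {j} \<Longrightarrow> j \<in> J \<Longrightarrow> pr j = {x, v} \<Longrightarrow> x \<noteq> v \<Longrightarrow>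
       ((\<lambda>t. rate (A t) (B t) (insert x (st Z K)) x) \<longlongrightarrow> \<kappa>m) (at_right 0)"
    and half_other: "\<And>Z K j x v. Z = {} \<or> Z = Hb \<Longrightarrow> K \<subseteq> J - {j} \<Longrightarrow> j \<in> J \<Longrightarrow> x \<in> pr j \<Longrightarrow>
       v \<in> st Hb J - pr j \<Longrightarrow> ((\<lambda>t. rate (A t) (B t) (insert x (st Z K)) v) \<longlongrightarrow> 0) (at_right 0)"
    and res_hub: "\<And>K v. K \<subseteq> J \<Longrightarrow> v \<in> Hb \<Longrightarrow>
       ((\<lambda>t. rate (A t) (B t) (st {} K) v / t ^ 2) \<longlongrightarrow> ap * card K) (at_right 0)"
    and res_mut: "\<And>K j v. K \<subseteq> J \<Longrightarrow> j \<in> K \<Longrightarrow> v \<in> pr j \<Longrightarrow>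
       ((\<lambda>t. rate (A t) (B t) (st {} K) v / t ^ 3) \<longlongrightarrow> bm) (at_right 0)"
    and res_res: "\<And>K j v t. K \<subseteq> J \<Longrightarrow> j \<in> J - K \<Longrightarrow> v \<in> pr j \<Longrightarrow> 0 < t \<Longrightarrow> t \<le> 1 \<Longrightarrow> rate (A t) (B t) (st {} K) v = 0"
    and mut_hub: "\<And>K v. K \<subseteq> J \<Longrightarrow> v \<in> Hb \<Longrightarrow>
       ((\<lambda>t. rate (A t) (B t) (st Hb K) v / t ^ 2) \<longlongrightarrow> am * (real n - card K)) (at_right 0)"
    and mut_res: "\<And>K j v. K \<subseteq> J \<Longrightarrow> j \<in> J - K \<Longrightarrow> v \<in> pr j \<Longrightarrow>
       ((\<lambda>t. rate (A t) (B t) (st Hb K) v / t ^ 3) \<longlongrightarrow> bp) (at_right 0)"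
    and mut_mut: "\<And>K j v t. K \<subseteq> J \<Longrightarrow> j \<in> K \<Longrightarrow> v \<in> pr j \<Longrightarrow> 0 < t \<Longrightarrow> t \<le> 1 \<Longrightarrow> rate (A t) (B t) (st Hb K) v = 0"
    and full: "1 \<le> h0 (st {} J)"
    and A0: "\<And>Z v. Z \<subset> Hb \<Longrightarrow> Z \<noteq> {} \<Longrightarrow> v \<in> Hb - Z \<Longrightarrow> 0 < A0 Z v"
       "\<And>Z v. Z \<subseteq> Hb \<Longrightarrow> v \<in> Hb - Z \<Longrightarrow> 0 \<le> A0 Z v"
    and B0: "\<And>Z v. Z \<subseteq> Hb \<Longrightarrow> v \<in> Z \<Longrightarrow> 0 \<le> B0 Z v"
    and f: "\<And>Z. Z \<subset> Hb \<Longrightarrow> Z \<noteq> {} \<Longrightarrow> gen Hb A0 B0 f Z = 0" "f {} = 0" "f Hb = 1"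
      "\<And>v. v \<in> Hb \<Longrightarrow> f {v} = \<rho>p" "\<And>v. v \<in> Hb \<Longrightarrow> f (Hb - {v}) = 1 - \<rho>m"
    and pos: "0 < \<kappa>p" "0 < \<kappa>m" "0 < ap" "0 < am" "0 < bp" "0 < bm" "0 < \<rho>p" "0 < \<rho>m" "0 < y"
    and ratio: "y * (ap * \<rho>p * bp * \<kappa>p) = am * \<rho>m * bm * \<kappa>m"
begin

abbreviation "R t S v \<equiv> rate (A t) (B t) S v"
abbreviation "F \<equiv> at_right (0::real)"

lemma ev_t: "eventually (\<lambda>t. 0 < t \<and> t \<le> 1) F"
  by (auto simp: eventually_at_right[of 0 1] intro!: exI[of _ 1])

lemma st_subset: "Z \<subseteq> Hb \<Longrightarrow> K \<subseteq> J \<Longrightarrow> st Z K \<subseteq> {..<N}"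
  unfolding st_def using Hb(1) pr(1) by blast

lemma fin: "finite Hb" "j \<in> J \<Longrightarrow> finite (pr j)" "finite (st Hb J)"
proof -
  show "finite Hb" using Hb finite_subset by blast
  show "finite (pr j)" if "j \<in> J" using pr(1)[OF that] finite_subset by blast
  show "finite (st Hb J)" using st_subset[of Hb J] finite_subset by blast
qed

lemma sum_units: "sum g (st Hb J) = sum g Hb + (\<Sum>j\<in>J. sum g (pr j))"
  for g :: "nat \<Rightarrow> real"
proof -
  have "Hb \<inter> (\<Union>j\<in>J. pr j) = {}" using pr(3) by auto
  hence "sum g (st Hb J) = sum g Hb + sum g (\<Union>j\<in>J. pr j)"
    unfolding st_def using fin J by (intro sum.union_disjoint) auto
  also have "sum g (\<Union>j\<in>J. pr j) = (\<Sum>j\<in>J. sum g (pr j))"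
    using fin J pr(4) by (intro sum.UNION_disjoint) auto
  finally show ?thesis .
qed

lemma mem_st: "v \<in> Hb \<Longrightarrow> K \<subseteq> J \<Longrightarrow> v \<in> st Z K \<longleftrightarrow> v \<in> Z"
    "Z \<subseteq> Hb \<Longrightarrow> K \<subseteq> J \<Longrightarrow> j \<in> J \<Longrightarrow> v \<in> pr j \<Longrightarrow> v \<in> st Z K \<longleftrightarrow> j \<in> K"
proof -
  show "v \<in> st Z K \<longleftrightarrow> v \<in> Z" if "v \<in> Hb" "K \<subseteq> J" using that pr(3) by (auto simp: st_def)
  show "v \<in> st Z K \<longleftrightarrow> j \<in> K" if "Z \<subseteq> Hb" "K \<subseteq> J" "j \<in> J" "v \<in> pr j"
  proof
    assume "v \<in> st Z K"
    then consider "v \<in> Z" | i where "i \<in> K" "v \<in> pr i" by (auto simp: st_def)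
    thus "j \<in> K"
    proof cases
      case 1 thus ?thesis using pr(3) that by auto
    next
      case 2 thus ?thesis using pr(4)[of i j] that by auto
    qed
  qed (use that in \<open>auto simp: st_def\<close>)
qed

lemma flip_hub: "v \<in> Hb \<Longrightarrow> K \<subseteq> J \<Longrightarrow> flip (st Z K) v = st (flip Z v) K"
  using pr(3) mem_st(1)[of v K Z] by (auto simp: flip_def st_def)

lemma h_props:
  assumes "0 < t" "t \<le> 1"
  shows "S \<subseteq> {..<N} \<Longrightarrow> gen {..<N} (A t) (B t) (h t) S = 0"
    and "S \<subseteq> {..<N} \<Longrightarrow> 0 \<le> h t S" "S \<subseteq> {..<N} \<Longrightarrow> h t S \<le> 1"
    and "S \<subseteq> T \<Longrightarrow> T \<subseteq> {..<N} \<Longrightarrow> h t S \<le> h t T"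
  using harm[OF assms] attractive_spins.harmonic_mono[OF spins harm, OF assms assms, of S T]
  by (auto simp: attractive_spins.harmonic_def[OF spins[OF assms]])

lemma h_diff_abs:
  assumes "0 < t" "t \<le> 1" "S \<subseteq> {..<N}" "T \<subseteq> {..<N}" shows "\<bar>h t S - h t T\<bar> \<le> 1"
  using h_props(2,3)[OF assms(1,2) assms(3)] h_props(2,3)[OF assms(1,2) assms(4)] by linarith

lemma rate_nonneg:
  assumes "0 < t" "t \<le> 1" "S \<subseteq> {..<N}" "v < N" shows "0 \<le> R t S v"
  using attractive_spins.A_nonneg[OF spins[OF assms(1,2)]] attractive_spins.B_nonneg[OF spins[OF assms(1,2)]] assms
  by (auto simp: rate_def)

text \<open>Mutants spreading to the remaining nodes only help, by monotonicity.\<close>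
lemma drift_le:
  assumes t: "0 < t" "t \<le> 1" and S: "S \<subseteq> st Hb J"
  shows "(\<Sum>v\<in>st Hb J. R t S v * (h t (flip S v) - h t S)) \<le> 0"
proof -
  have SN: "S \<subseteq> {..<N}" using S st_subset[of Hb J] by auto
  have "0 = (\<Sum>v<N. R t S v * (h t (flip S v) - h t S))"
    using h_props(1)[OF t SN] SN by (simp add: gen_flip)
  also have "\<dots> = (\<Sum>v\<in>{..<N} - st Hb J. R t S v * (h t (flip S v) - h t S)) + (\<Sum>v\<in>st Hb J. R t S v * (h t (flip S v) - h t S))"
    using st_subset[of Hb J] by (intro sum.subset_diff) auto
  finally have 1: "0 = \<dots>" .
  have "0 \<le> R t S v * (h t (flip S v) - h t S)" if v: "v \<in> {..<N} - st Hb J" for v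
  proof -
    have "v \<notin> S" using v S by auto
    moreover have "h t S \<le> h t (insert v S)" using h_props(4)[OF t, of S "insert v S"] SN v by auto
    ultimately show ?thesis using rate_nonneg[OF t SN, of v] v by (simp add: flip_def)
  qed
  hence "0 \<le> (\<Sum>v\<in>{..<N} - st Hb J. R t S v * (h t (flip S v) - h t S))" by (intro sum_nonneg)
  thus ?thesis using 1 by linarith
qed

lemma hub_resolution:
  assumes K: "K \<subseteq> J"
  obtains e where "(e \<longlongrightarrow> 0) F"
    "\<And>t Z. 0 < t \<Longrightarrow> t \<le> 1 \<Longrightarrow> Z \<subseteq> Hb \<Longrightarrow>
       h t (st {} K) + f Z * (h t (st Hb K) - h t (st {} K)) - t * e t \<le> h t (st Z K)"
proof -
  have "\<exists>C\<ge>0. \<forall>u \<eta> S. 0 \<le> \<eta> \<longrightarrow> (\<forall>S. S \<subset> Hb \<longrightarrow> S \<noteq> {} \<longrightarrow> gen Hb A0 B0 u S \<le> \<eta>) \<longrightarrow> S \<subseteq> Hb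
       \<longrightarrow> u {} + f S * (u Hb - u {}) - C * \<eta> \<le> u S"
    by (rule gen_lower_bound_with_error) (fact fin(1) | rule A0 B0 f; assumption)+
  then obtain C where C: "0 \<le> C" "\<forall>u \<eta> S. 0 \<le> \<eta> \<longrightarrow> (\<forall>S. S \<subset> Hb \<longrightarrow> S \<noteq> {} \<longrightarrow> gen Hb A0 B0 u S \<le> \<eta>) \<longrightarrow> S \<subseteq> Hb
       \<longrightarrow> u {} + f S * (u Hb - u {}) - C * \<eta> \<le> u S" by blast
  define X where "X = {Z. Z \<subset> Hb \<and> Z \<noteq> {}}"
  have fX: "finite X" by (rule finite_subset[of _ "Pow Hb"]) (use fin in \<open>auto simp: X_def\<close>)
  define err where "err t Z = (\<Sum>v\<in>Hb. \<bar>(R t (st Z K) v - rate A0 B0 Z v) / t\<bar>) + (\<Sum>j\<in>J. \<Sum>v\<in>pr j. \<bar>R t (st Z K) v / t\<bar>)" for t Z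
  define e where "e t = C * (\<Sum>Z\<in>X. err t Z)" for t
  have "((\<lambda>t. err t Z) \<longlongrightarrow> (\<Sum>v\<in>Hb. \<bar>0\<bar>) + (\<Sum>j\<in>J. \<Sum>v\<in>pr j. \<bar>0\<bar>)) F" if "Z \<in> X" for Z
    unfolding err_def
    by (intro tendsto_intros tendsto_rabs hub_rate hub_rate_pairs) (use that K in \<open>auto simp: X_def\<close>)
  hence "(e \<longlongrightarrow> C * (\<Sum>Z\<in>X. 0)) F" unfolding e_def by (intro tendsto_intros) auto
  moreover have "h t (st {} K) + f Z * (h t (st Hb K) - h t (st {} K)) - t * e t \<le> h t (st Z K)"
    if t: "0 < t" "t \<le> 1" and Z: "Z \<subseteq> Hb" for t Z
  proof -
    define \<eta> where "\<eta> = t * (\<Sum>Z\<in>X. err t Z)"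
    have err0: "0 \<le> err t Z" for Z unfolding err_def by (intro add_nonneg_nonneg sum_nonneg) auto
    hence "0 \<le> \<eta>" unfolding \<eta>_def using t by (intro mult_nonneg_nonneg sum_nonneg) auto
    moreover have "gen Hb A0 B0 (\<lambda>Z. h t (st Z K)) Z \<le> \<eta>" if Z: "Z \<subset> Hb" "Z \<noteq> {}" for Z
    proof -
      let ?S = "st Z K"
      let ?d = "\<lambda>v. h t (flip ?S v) - h t ?S"
      have SU: "?S \<subseteq> st Hb J" using Z K by (auto simp: st_def)
      have UN: "st Hb J \<subseteq> {..<N}" using st_subset[of Hb J] by simp
      have fl: "flip ?S v \<subseteq> {..<N}" if "v \<in> st Hb J" for v using that SU UN by (auto simp: flip_def)
      have d: "\<bar>?d v\<bar> \<le> 1" if "v \<in> st Hb J" for v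
        using h_diff_abs[OF t fl[OF that]] SU UN by auto
      have b: "- (x * ?d v) \<le> \<bar>x\<bar>" if "v \<in> st Hb J" for x v
      proof -
        have "\<bar>x * ?d v\<bar> \<le> \<bar>x\<bar> * 1" unfolding abs_mult using d[OF that] by (intro mult_left_mono) auto
        thus ?thesis by linarith
      qed
      have "gen Hb A0 B0 (\<lambda>Z. h t (st Z K)) Z = (\<Sum>v\<in>Hb. rate A0 B0 Z v * (h t (st (flip Z v) K) - h t (st Z K)))"
        using fin Z by (intro gen_flip) auto
      also have "\<dots> = (\<Sum>v\<in>Hb. rate A0 B0 Z v * ?d v)"
        using flip_hub[OF _ K] by (intro sum.cong) auto
      also have "\<dots> = (\<Sum>v\<in>Hb. R t ?S v * ?d v) + (\<Sum>v\<in>Hb. - ((R t ?S v - rate A0 B0 Z v) * ?d v))"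
        by (simp add: sum.distrib[symmetric] algebra_simps)
      also have "(\<Sum>v\<in>Hb. R t ?S v * ?d v) \<le> (\<Sum>j\<in>J. \<Sum>v\<in>pr j. - (R t ?S v * ?d v))"
        using drift_le[OF t SU] by (simp add: sum_units sum_negf)
      also have "\<dots> \<le> (\<Sum>j\<in>J. \<Sum>v\<in>pr j. \<bar>R t ?S v\<bar>)"
        by (intro sum_mono b) (auto simp: st_def)
      also have "(\<Sum>v\<in>Hb. - ((R t ?S v - rate A0 B0 Z v) * ?d v)) \<le> (\<Sum>v\<in>Hb. \<bar>R t ?S v - rate A0 B0 Z v\<bar>)"
        by (intro sum_mono b) (auto simp: st_def)
      also have "(\<Sum>j\<in>J. \<Sum>v\<in>pr j. \<bar>R t ?S v\<bar>) + (\<Sum>v\<in>Hb. \<bar>R t ?S v - rate A0 B0 Z v\<bar>) = t * err t Z"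
        using t by (simp add: err_def distrib_left sum_distrib_left)
      also have "\<dots> \<le> \<eta>" unfolding \<eta>_def
        using t err0 Z fX by (intro mult_left_mono member_le_sum[where f = "err t"]) (auto simp: X_def)
      finally show ?thesis by simp
    qed
    ultimately have "h t (st {} K) + f Z * (h t (st Hb K) - h t (st {} K)) - C * \<eta> \<le> h t (st Z K)"
      using C(2)[rule_format, of \<eta> "\<lambda>Z. h t (st Z K)" Z] Z by simp
    thus ?thesis by (simp add: \<eta>_def e_def algebra_simps)
  qed
  ultimately show ?thesis using that by simp
qed

lemma h0_mono: "S \<subseteq> T \<Longrightarrow> T \<subseteq> {..<N} \<Longrightarrow> h0 S \<le> h0 T"
  by (rule tendsto_le[OF _ lim lim]) (auto intro!: eventually_mono[OF ev_t] h_props(4))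

lemma half_bound:
  assumes Z: "Z = {} \<or> Z = Hb" and K: "K \<subseteq> J - {j}" and j: "j \<in> J" and x: "x \<in> pr j"
  shows "\<kappa>p * h0 (st Z (insert j K)) + \<kappa>m * h0 (st Z K) \<le> (\<kappa>p + \<kappa>m) * h0 (insert x (st Z K))"
proof -
  obtain v where v: "pr j = {x, v}" "x \<noteq> v"
    by (rule pair_other[OF pr(2)[OF j] x])
  let ?S = "insert x (st Z K)"
  let ?l = "\<lambda>w. if w = v then \<kappa>p else if w = x then \<kappa>m else 0"
  have ZH: "Z \<subseteq> Hb" "K \<subseteq> J" using Z K by auto
  have vx: "v \<notin> st Z K" "x \<notin> st Z K" using mem_st(2)[OF ZH j] v K by auto
  have xvU: "x \<in> st Hb J" "v \<in> st Hb J" using v j by (auto simp: st_def)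
  have SU: "?S \<subseteq> st Hb J" using ZH xvU by (auto simp: st_def)
  have UN: "st Hb J \<subseteq> {..<N}" using st_subset[of Hb J] by simp
  have l: "((\<lambda>t. R t ?S w) \<longlongrightarrow> ?l w) F" if "w \<in> st Hb J" for w
  proof -
    consider "w = v" | "w = x" | "w \<noteq> v" "w \<noteq> x" by blast
    thus ?thesis
    proof cases
      case 1 thus ?thesis using half_up[OF Z K j v] by simp
    next
      case 2 thus ?thesis using half_down[OF Z K j v] v(2) by simp
    next
      case 3
      hence "w \<in> st Hb J - pr j" using that by (simp add: v(1))
      thus ?thesis using half_other[OF Z K j x] 3 by simp
    qed
  qed
  have fl: "flip ?S w \<subseteq> {..<N}" if "w \<in> st Hb J" for w using that SU UN by (auto simp: flip_def)
  have "((\<lambda>t. \<Sum>w\<in>st Hb J. R t ?S w * (h t (flip ?S w) - h t ?S)) \<longlongrightarrow> (\<Sum>w\<in>st Hb J. ?l w * (h0 (flip ?S w) - h0 ?S))) F"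
    by (intro tendsto_intros l lim fl) (use SU UN in auto)
  hence "(\<Sum>w\<in>st Hb J. ?l w * (h0 (flip ?S w) - h0 ?S)) \<le> 0"
    by (rule tendsto_upperbound) (auto intro!: eventually_mono[OF ev_t] drift_le SU)
  also have "(\<Sum>w\<in>st Hb J. ?l w * (h0 (flip ?S w) - h0 ?S)) = (\<Sum>w\<in>{x, v}. ?l w * (h0 (flip ?S w) - h0 ?S))"
    using fin xvU by (intro sum.mono_neutral_right) auto
  also have "\<dots> = \<kappa>m * (h0 (st Z K) - h0 ?S) + \<kappa>p * (h0 (insert v ?S) - h0 ?S)"
    using v vx by (simp add: flip_def)
  also have "insert v ?S = st Z (insert j K)" using v by (auto simp: st_def)
  finally show ?thesis by (simp add: algebra_simps)
qed

definition "E0 t K = (\<Sum>j\<in>K. \<Sum>v\<in>pr j. R t (st {} K) v / t ^ 3 * (h t (st {} K - {v}) - h t (st {} K)))"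
definition "E1 t K = (\<Sum>j\<in>J - K. \<Sum>v\<in>pr j. R t (st Hb K) v / t ^ 3 * (h t (insert v (st Hb K)) - h t (st Hb K)))"
definition "E0' K = (\<Sum>j\<in>K. \<Sum>v\<in>pr j. bm * (h0 (st {} K - {v}) - h0 (st {} K)))"
definition "E1' K = (\<Sum>j\<in>J - K. \<Sum>v\<in>pr j. bp * (h0 (insert v (st Hb K)) - h0 (st Hb K)))"
definition "X0 t K = (\<Sum>v\<in>Hb. R t (st {} K) v / t ^ 2)"
definition "X1 t K = (\<Sum>v\<in>Hb. R t (st Hb K) v / t ^ 2)"

lemma lims:
  assumes K: "K \<subseteq> J"
  shows "((\<lambda>t. E0 t K) \<longlongrightarrow> E0' K) F" "((\<lambda>t. E1 t K) \<longlongrightarrow> E1' K) F"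
    "((\<lambda>t. X0 t K) \<longlongrightarrow> card Hb * (ap * card K)) F" "((\<lambda>t. X1 t K) \<longlongrightarrow> card Hb * (am * (real n - card K))) F"
proof -
  have s: "st {} K \<subseteq> {..<N}" "st Hb K \<subseteq> {..<N}" using st_subset K by auto
  have i: "insert v (st Hb K) \<subseteq> {..<N}" if "j \<in> J" "v \<in> pr j" for j v using s pr(1) that by auto
  show "((\<lambda>t. E0 t K) \<longlongrightarrow> E0' K) F"
    unfolding E0_def E0'_def by (intro tendsto_sum tendsto_mult tendsto_diff lim res_mut[OF K]) (use s in auto)
  show "((\<lambda>t. E1 t K) \<longlongrightarrow> E1' K) F"
    unfolding E1_def E1'_def by (intro tendsto_sum tendsto_mult tendsto_diff lim mut_res[OF K] i s) auto
  have "((\<lambda>t. X0 t K) \<longlongrightarrow> (\<Sum>v\<in>Hb. ap * card K)) F"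
    unfolding X0_def by (intro tendsto_sum res_hub[OF K])
  thus "((\<lambda>t. X0 t K) \<longlongrightarrow> card Hb * (ap * card K)) F" by simp
  have "((\<lambda>t. X1 t K) \<longlongrightarrow> (\<Sum>v\<in>Hb. am * (real n - card K))) F"
    unfolding X1_def by (intro tendsto_sum mut_hub[OF K])
  thus "((\<lambda>t. X1 t K) \<longlongrightarrow> card Hb * (am * (real n - card K))) F" by simp
qed

lemma X_nonneg:
  assumes "0 < t" "t \<le> 1" "K \<subseteq> J" shows "0 \<le> X0 t K" "0 \<le> X1 t K"
proof -
  have "R t (st Z K) v \<ge> 0" if "v \<in> Hb" "Z \<subseteq> Hb" for Z v
    by (rule rate_nonneg[OF assms(1,2) st_subset[OF that(2) assms(3)]]) (use that Hb in auto)
  thus "0 \<le> X0 t K" "0 \<le> X1 t K" unfolding X0_def X1_def using assms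
    by (auto intro!: sum_nonneg divide_nonneg_nonneg)
qed

lemma hub_balance:
  assumes K: "K \<subseteq> J"
  obtains e where "(e \<longlongrightarrow> 0) F"
    "\<And>t. 0 < t \<Longrightarrow> t \<le> 1 \<Longrightarrow>
        X0 t K * (\<rho>p * ((h t (st Hb K) - h t (st {} K)) / t) - e t) + E0 t K \<le> 0"
    "\<And>t. 0 < t \<Longrightarrow> t \<le> 1 \<Longrightarrow>
        X1 t K * (- \<rho>m * ((h t (st Hb K) - h t (st {} K)) / t) - e t) + E1 t K \<le> 0"
proof -
  obtain e where e: "(e \<longlongrightarrow> 0) F"
    "\<And>t Z. 0 < t \<Longrightarrow> t \<le> 1 \<Longrightarrow> Z \<subseteq> Hb \<Longrightarrow>
       h t (st {} K) + f Z * (h t (st Hb K) - h t (st {} K)) - t * e t \<le> h t (st Z K)"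
    by (rule hub_resolution[OF K]) (rule that, assumption, blast+)
  show ?thesis
  proof (rule that[OF e(1)])
    fix t :: real assume t: "0 < t" "t \<le> 1"
    let ?D = "h t (st Hb K) - h t (st {} K)"
    let ?S = "st {} K"
    have D: "t * (\<rho>p * (?D / t) - e t) = \<rho>p * ?D - t * e t" using t by (simp add: field_simps)
    have "t * (\<rho>p * (?D / t) - e t) \<le> h t (flip ?S v) - h t ?S" if v: "v \<in> Hb" for v
      unfolding D using e(2)[OF t, of "{v}"] v f(4)[OF v] t flip_hub[OF v K, of "{}"] by (simp add: flip_def algebra_simps)
    hence "R t ?S v * (t * (\<rho>p * (?D / t) - e t)) \<le> R t ?S v * (h t (flip ?S v) - h t ?S)" if v: "v \<in> Hb" for v
      using v Hb rate_nonneg[OF t st_subset[of "{}" K], of v] K by (intro mult_left_mono) auto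
    hence "(\<Sum>v\<in>Hb. R t ?S v * (t * (\<rho>p * (?D / t) - e t))) \<le> (\<Sum>v\<in>Hb. R t ?S v * (h t (flip ?S v) - h t ?S))"
      by (rule sum_mono)
    also have "(\<Sum>v\<in>Hb. R t ?S v * (t * (\<rho>p * (?D / t) - e t))) = t ^ 3 * (X0 t K * (\<rho>p * (?D / t) - e t))"
      unfolding X0_def by (rule sum_rescale_cube[OF t(1)])
    finally have 1: "t ^ 3 * (X0 t K * (\<rho>p * (?D / t) - e t)) \<le> (\<Sum>v\<in>Hb. R t ?S v * (h t (flip ?S v) - h t ?S))" .
    have "(\<Sum>j\<in>J. \<Sum>v\<in>pr j. R t ?S v * (h t (flip ?S v) - h t ?S)) = (\<Sum>j\<in>K. \<Sum>v\<in>pr j. R t ?S v * (h t (flip ?S v) - h t ?S))"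
      using K J res_res[OF K _ _ t] by (intro sum.mono_neutral_right) (auto intro!: sum.neutral)
    also have "\<dots> = (\<Sum>j\<in>K. \<Sum>v\<in>pr j. R t ?S v * (h t (?S - {v}) - h t ?S))"
      using mem_st(2)[of "{}" K] K by (intro sum.cong refl) (auto simp: flip_def)
    also have "\<dots> = t ^ 3 * E0 t K" using t by (simp add: E0_def sum_distrib_left)
    finally have 2: "(\<Sum>j\<in>J. \<Sum>v\<in>pr j. R t ?S v * (h t (flip ?S v) - h t ?S)) = t ^ 3 * E0 t K" .
    have "?S \<subseteq> st Hb J" using K by (auto simp: st_def)
    from drift_le[OF t this] 1 2 have "t ^ 3 * (X0 t K * (\<rho>p * (?D / t) - e t) + E0 t K) \<le> 0"
      by (simp add: sum_units distrib_left)
    thus "X0 t K * (\<rho>p * (?D / t) - e t) + E0 t K \<le> 0" using t by (simp add: mult_le_0_iff)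
  next
    fix t :: real assume t: "0 < t" "t \<le> 1"
    let ?D = "h t (st Hb K) - h t (st {} K)"
    let ?S = "st Hb K"
    have D: "t * (- \<rho>m * (?D / t) - e t) = - \<rho>m * ?D - t * e t" using t by (simp add: field_simps)
    have "t * (- \<rho>m * (?D / t) - e t) \<le> h t (flip ?S v) - h t ?S" if v: "v \<in> Hb" for v
      unfolding D using e(2)[OF t, of "Hb - {v}"] v f(5)[OF v] t flip_hub[OF v K, of Hb] by (simp add: flip_def algebra_simps)
    hence "R t ?S v * (t * (- \<rho>m * (?D / t) - e t)) \<le> R t ?S v * (h t (flip ?S v) - h t ?S)" if v: "v \<in> Hb" for v
      using v Hb rate_nonneg[OF t st_subset[of Hb K], of v] K by (intro mult_left_mono) auto
    hence "(\<Sum>v\<in>Hb. R t ?S v * (t * (- \<rho>m * (?D / t) - e t))) \<le> (\<Sum>v\<in>Hb. R t ?S v * (h t (flip ?S v) - h t ?S))"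
      by (rule sum_mono)
    also have "(\<Sum>v\<in>Hb. R t ?S v * (t * (- \<rho>m * (?D / t) - e t))) = t ^ 3 * (X1 t K * (- \<rho>m * (?D / t) - e t))"
      unfolding X1_def by (rule sum_rescale_cube[OF t(1)])
    finally have 1: "t ^ 3 * (X1 t K * (- \<rho>m * (?D / t) - e t)) \<le> (\<Sum>v\<in>Hb. R t ?S v * (h t (flip ?S v) - h t ?S))" .
    have "(\<Sum>j\<in>J. \<Sum>v\<in>pr j. R t ?S v * (h t (flip ?S v) - h t ?S)) = (\<Sum>j\<in>J - K. \<Sum>v\<in>pr j. R t ?S v * (h t (flip ?S v) - h t ?S))"
      using K J mut_mut[OF K _ _ t] by (intro sum.mono_neutral_right) (auto intro!: sum.neutral)
    also have "\<dots> = (\<Sum>j\<in>J - K. \<Sum>v\<in>pr j. R t ?S v * (h t (insert v ?S) - h t ?S))"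
      using mem_st(2)[of Hb K] K by (intro sum.cong refl) (auto simp: flip_def)
    also have "\<dots> = t ^ 3 * E1 t K" using t by (simp add: E1_def sum_distrib_left)
    finally have 2: "(\<Sum>j\<in>J. \<Sum>v\<in>pr j. R t ?S v * (h t (flip ?S v) - h t ?S)) = t ^ 3 * E1 t K" .
    have "?S \<subseteq> st Hb J" using K by (auto simp: st_def)
    from drift_le[OF t this] 1 2 have "t ^ 3 * (X1 t K * (- \<rho>m * (?D / t) - e t) + E1 t K) \<le> 0"
      by (simp add: sum_units distrib_left)
    thus "X1 t K * (- \<rho>m * (?D / t) - e t) + E1 t K \<le> 0" using t by (simp add: mult_le_0_iff)
  qed
qed

lemma hub_irrelevant:
  assumes K: "K \<subseteq> J" "K \<noteq> {}"
  shows "h0 (st Hb K) = h0 (st {} K)"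
proof (rule antisym)
  show "h0 (st {} K) \<le> h0 (st Hb K)"
    by (rule h0_mono[OF _ st_subset]) (use K in \<open>auto simp: st_def\<close>)
  obtain e where e: "(e \<longlongrightarrow> 0) F" "\<And>t. 0 < t \<Longrightarrow> t \<le> 1 \<Longrightarrow>
        X0 t K * (\<rho>p * ((h t (st Hb K) - h t (st {} K)) / t) - e t) + E0 t K \<le> 0"
    "\<And>t. 0 < t \<Longrightarrow> t \<le> 1 \<Longrightarrow>
        X1 t K * (- \<rho>m * ((h t (st Hb K) - h t (st {} K)) / t) - e t) + E1 t K \<le> 0"
    by (rule hub_balance[OF K(1)]) (rule that, assumption, blast+)
  let ?g = "\<lambda>t. X0 t K * (\<rho>p * (h t (st Hb K) - h t (st {} K)) - t * e t) + t * E0 t K"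
  have "(?g \<longlongrightarrow> card Hb * (ap * card K) * (\<rho>p * (h0 (st Hb K) - h0 (st {} K)) - 0 * 0) + 0 * E0' K) F"
    by (intro tendsto_intros lims K lim st_subset e(1)) auto
  moreover have "?g t \<le> 0" if "0 < t" "t \<le> 1" for t
  proof -
    have "X * (\<rho>p * d - t * c) + t * E = t * (X * (\<rho>p * (d / t) - c) + E)" for X d c E
      using that by (simp add: field_simps)
    thus ?thesis using mult_nonneg_nonpos[OF less_imp_le[OF that(1)] e(2)[OF that]] by simp
  qed
  ultimately have 1: "card Hb * (ap * card K) * (\<rho>p * (h0 (st Hb K) - h0 (st {} K)) - 0 * 0) + 0 * E0' K \<le> 0"
    by (intro tendsto_upperbound) (auto intro!: eventually_mono[OF ev_t])
  have 2: "0 < card Hb * (ap * card K) * \<rho>p"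
    using pos Hb fin K J finite_subset[OF K(1)] by (auto intro!: mult_pos_pos simp: card_gt_0_iff)
  have "h0 (st Hb K) - h0 (st {} K) \<le> 0"
    by (rule nonpos_of_pos_mult[OF 2]) (use 1 in \<open>simp add: mult.assoc\<close>)
  thus "h0 (st Hb K) \<le> h0 (st {} K)" by simp
qed

lemma averaged:
  assumes K: "K \<subseteq> J"
  shows "am * (real n - card K) * \<rho>m * E0' K + ap * card K * \<rho>p * E1' K \<le> 0"
proof -
  obtain e where e: "(e \<longlongrightarrow> 0) F" "\<And>t. 0 < t \<Longrightarrow> t \<le> 1 \<Longrightarrow>
        X0 t K * (\<rho>p * ((h t (st Hb K) - h t (st {} K)) / t) - e t) + E0 t K \<le> 0"
    "\<And>t. 0 < t \<Longrightarrow> t \<le> 1 \<Longrightarrow>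
        X1 t K * (- \<rho>m * ((h t (st Hb K) - h t (st {} K)) / t) - e t) + E1 t K \<le> 0"
    by (rule hub_balance[OF K]) (rule that, assumption, blast+)
  let ?g = "\<lambda>t. X1 t K * \<rho>m * (E0 t K - X0 t K * e t) + X0 t K * \<rho>p * (E1 t K - X1 t K * e t)"
  let ?a = "card Hb * (ap * card K)" and ?b = "card Hb * (am * (real n - card K))"
  have "(?g \<longlongrightarrow> ?b * \<rho>m * (E0' K - ?a * 0) + ?a * \<rho>p * (E1' K - ?b * 0)) F"
    by (intro tendsto_intros lims K e(1))
  moreover have "?g t \<le> 0" if t: "0 < t" "t \<le> 1" for t
  proof -
    define D where "D = (h t (st Hb K) - h t (st {} K)) / t"
    have "X1 t K * \<rho>m * (X0 t K * (\<rho>p * D - e t) + E0 t K) \<le> 0"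
      using e(2)[OF t] X_nonneg[OF t K] pos by (intro mult_nonneg_nonpos mult_nonneg_nonneg) (auto simp: D_def)
    moreover have "X0 t K * \<rho>p * (X1 t K * (- \<rho>m * D - e t) + E1 t K) \<le> 0"
      using e(3)[OF t] X_nonneg[OF t K] pos by (intro mult_nonneg_nonpos mult_nonneg_nonneg) (auto simp: D_def)
    ultimately show ?thesis by (simp add: algebra_simps)
  qed
  ultimately have "?b * \<rho>m * (E0' K - ?a * 0) + ?a * \<rho>p * (E1' K - ?b * 0) \<le> 0"
    by (intro tendsto_upperbound) (auto intro!: eventually_mono[OF ev_t])
  hence "card Hb * (am * (real n - card K) * \<rho>m * E0' K + ap * card K * \<rho>p * E1' K) \<le> 0"
    by (simp add: algebra_simps)
  moreover have "0 < real (card Hb)" using Hb fin by (simp add: card_gt_0_iff)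
  ultimately show ?thesis by (simp add: mult_le_0_iff)
qed

abbreviation "g K \<equiv> h0 (st {} K)"

lemma E0_ge:
  assumes K: "K \<subseteq> J"
  shows "2 * bm * \<kappa>m / (\<kappa>p + \<kappa>m) * (\<Sum>j\<in>K. g (K - {j}) - g K) \<le> E0' K"
proof -
  have "\<kappa>m / (\<kappa>p + \<kappa>m) * (g (K - {j}) - g K) \<le> h0 (st {} K - {v}) - g K" if j: "j \<in> K" and v: "v \<in> pr j" for j v
  proof -
    have jJ: "j \<in> J" using j K by auto
    obtain x where x: "pr j = {x, v}" "x \<noteq> v"
      by (rule pair_other[OF pr(2)[OF jJ] v]) (metis insert_commute)
    have vn: "v \<notin> st {} (K - {j})" using mem_st(2)[of "{}" "K - {j}" j v] K jJ v by auto
    have "st {} K = st {} (K - {j}) \<union> pr j" using j by (auto simp: st_def)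
    hence e: "st {} K - {v} = insert x (st {} (K - {j}))" using x vn by auto
    have "\<kappa>p * g (insert j (K - {j})) + \<kappa>m * g (K - {j}) \<le> (\<kappa>p + \<kappa>m) * h0 (insert x (st {} (K - {j})))"
      by (rule half_bound) (use K jJ x in auto)
    moreover have "insert j (K - {j}) = K" using j by auto
    ultimately have "\<kappa>m * (g (K - {j}) - g K) \<le> (h0 (st {} K - {v}) - g K) * (\<kappa>p + \<kappa>m)"
      by (simp add: e algebra_simps)
    thus ?thesis using pos by (simp add: pos_divide_le_eq)
  qed
  hence "(\<Sum>j\<in>K. \<Sum>v\<in>pr j. bm * (\<kappa>m / (\<kappa>p + \<kappa>m) * (g (K - {j}) - g K))) \<le> E0' K"
    unfolding E0'_def using pos by (intro sum_mono mult_left_mono) auto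
  also have "(\<Sum>j\<in>K. \<Sum>v\<in>pr j. bm * (\<kappa>m / (\<kappa>p + \<kappa>m) * (g (K - {j}) - g K)))
     = (\<Sum>j\<in>K. 2 * (bm * (\<kappa>m / (\<kappa>p + \<kappa>m) * (g (K - {j}) - g K))))"
    using K pr(2) by (intro sum.cong) auto
  finally show ?thesis by (simp add: sum_distrib_left mult.assoc)
qed

lemma E1_ge:
  assumes K: "K \<subseteq> J" "K \<noteq> {}"
  shows "2 * bp * \<kappa>p / (\<kappa>p + \<kappa>m) * (\<Sum>j\<in>J - K. g (insert j K) - g K) \<le> E1' K"
proof -
  have "\<kappa>p / (\<kappa>p + \<kappa>m) * (g (insert j K) - g K) \<le> h0 (insert v (st Hb K)) - h0 (st Hb K)"
    if j: "j \<in> J - K" and v: "v \<in> pr j" for j v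
  proof -
    have "\<kappa>p * h0 (st Hb (insert j K)) + \<kappa>m * h0 (st Hb K) \<le> (\<kappa>p + \<kappa>m) * h0 (insert v (st Hb K))"
      by (rule half_bound) (use K j v in auto)
    moreover have "h0 (st Hb (insert j K)) = g (insert j K)" "h0 (st Hb K) = g K"
      using hub_irrelevant K j by auto
    ultimately have "\<kappa>p * (g (insert j K) - g K) \<le> (h0 (insert v (st Hb K)) - h0 (st Hb K)) * (\<kappa>p + \<kappa>m)"
      by (simp add: algebra_simps)
    thus ?thesis using pos by (simp add: pos_divide_le_eq)
  qed
  hence "(\<Sum>j\<in>J-K. \<Sum>v\<in>pr j. bp * (\<kappa>p / (\<kappa>p + \<kappa>m) * (g (insert j K) - g K))) \<le> E1' K"
    unfolding E1'_def using pos by (intro sum_mono mult_left_mono) auto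
  also have "(\<Sum>j\<in>J-K. \<Sum>v\<in>pr j. bp * (\<kappa>p / (\<kappa>p + \<kappa>m) * (g (insert j K) - g K)))
     = (\<Sum>j\<in>J-K. 2 * (bp * (\<kappa>p / (\<kappa>p + \<kappa>m) * (g (insert j K) - g K))))"
    using K pr(2) by (intro sum.cong) auto
  finally show ?thesis by (simp add: sum_distrib_left mult.assoc)
qed

lemma n_ge_card: "K \<subseteq> J \<Longrightarrow> real (card K) \<le> real n"
  using J card_mono by fastforce

lemma pair_chain:
  assumes K: "K \<subset> J" "K \<noteq> {}"
  shows "gen J (\<lambda>K _. real (card K)) (\<lambda>K _. y * (real n - card K)) g K \<le> 0"
proof -
  define u where "u = (\<Sum>j\<in>J - K. g (insert j K) - g K)"
  define d where "d = (\<Sum>j\<in>K. g (K - {j}) - g K)"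
  have KJ: "K \<subseteq> J" using K by auto
  have n: "0 \<le> real n - card K" using n_ge_card[OF KJ] by simp
  have "am * (real n - card K) * \<rho>m * (2 * bm * \<kappa>m / (\<kappa>p + \<kappa>m) * d) + ap * card K * \<rho>p * (2 * bp * \<kappa>p / (\<kappa>p + \<kappa>m) * u)
     \<le> am * (real n - card K) * \<rho>m * E0' K + ap * card K * \<rho>p * E1' K"
    unfolding u_def d_def using E0_ge[OF KJ] E1_ge[OF KJ K(2)] pos n
    by (intro add_mono mult_left_mono mult_nonneg_nonneg) auto
  also have "\<dots> \<le> 0" by (rule averaged[OF KJ])
  finally have 1: "am * (real n - card K) * \<rho>m * (2 * bm * \<kappa>m / (\<kappa>p + \<kappa>m) * d) + ap * card K * \<rho>p * (2 * bp * \<kappa>p / (\<kappa>p + \<kappa>m) * u) \<le> 0" .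
  have "am * m * \<rho>m * (2 * bm * \<kappa>m / (\<kappa>p + \<kappa>m) * d) = (am * \<rho>m * bm * \<kappa>m) * (2 * m * d / (\<kappa>p + \<kappa>m))" for m
    by simp
  also have "\<And>m. (am * \<rho>m * bm * \<kappa>m) * (2 * m * d / (\<kappa>p + \<kappa>m)) = (ap * \<rho>p * bp * \<kappa>p) * 2 / (\<kappa>p + \<kappa>m) * (y * m * d)"
    unfolding ratio[symmetric] by simp
  finally have 2: "am * m * \<rho>m * (2 * bm * \<kappa>m / (\<kappa>p + \<kappa>m) * d) = (ap * \<rho>p * bp * \<kappa>p) * 2 / (\<kappa>p + \<kappa>m) * (y * m * d)" for m .
  have "(ap * \<rho>p * bp * \<kappa>p) * 2 / (\<kappa>p + \<kappa>m) * (card K * u + y * (real n - card K) * d) \<le> 0"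
    using 1 unfolding 2 by (simp only: distrib_left) (simp add: ac_simps)
  moreover have "0 < (ap * \<rho>p * bp * \<kappa>p) * 2 / (\<kappa>p + \<kappa>m)" using pos by simp
  ultimately have "card K * u + y * (real n - card K) * d \<le> 0" using nonpos_of_pos_mult by blast
  thus ?thesis by (simp add: gen_def u_def d_def sum_distrib_left)
qed

lemma g_ge:
  assumes K: "K \<subseteq> J"
  shows "(\<Sum>i<card K. y ^ i) / (\<Sum>i<n. y ^ i) \<le> g K"
proof -
  define G where "G k = (\<Sum>i<k. y ^ i) / (\<Sum>i<n. y ^ i)" for k
  have np: "0 < n" using J by (auto simp: card_gt_0_iff)
  have dp: "0 < (\<Sum>i<n. y ^ i)" using np pos by (intro sum_pos) (auto simp: lessThan_empty_iff)
  have Gd: "G (Suc k) - G k = y ^ k / (\<Sum>i<n. y ^ i)" for k by (simp add: G_def add_divide_distrib)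
  let ?A = "\<lambda>K (_::nat). real (card K)" and ?B = "\<lambda>K (_::nat). y * (real n - card K)"
  have gG: "gen J ?A ?B (\<lambda>K. G (card K)) K = 0" if K: "K \<subset> J" "K \<noteq> {}" for K
  proof -
    have fK: "finite K" and KJ: "K \<subseteq> J" using K J finite_subset by auto
    obtain k where k: "card K = Suc k" using fK K by (metis card_eq_0_iff not0_implies_Suc)
    have cJK: "real (card (J - K)) = real n - real (card K)"
      using J KJ fK n_ge_card[OF KJ] by (simp add: card_Diff_subset of_nat_diff)
    have "(\<Sum>v\<in>J - K. real (card K) * (G (card (insert v K)) - G (card K))) = (\<Sum>v\<in>J - K. real (card K) * (G (Suc (card K)) - G (card K)))"
      using fK by (intro sum.cong) auto
    moreover have "(\<Sum>v\<in>K. y * (real n - card K) * (G (card (K - {v})) - G (card K))) = (\<Sum>v\<in>K. y * (real n - card K) * (- (G (Suc k) - G k)))"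
      using fK k by (intro sum.cong) auto
    ultimately have "gen J ?A ?B (\<lambda>K. G (card K)) K
       = (real n - card K) * (card K * (G (Suc (card K)) - G (card K))) - card K * (y * (real n - card K) * (G (Suc k) - G k))"
      by (simp add: gen_def cJK algebra_simps)
    also have "\<dots> = 0" unfolding Gd k by simp
    finally show ?thesis .
  qed
  have "G (card K) - g K \<le> 0"
  proof (rule gen_max_principle[where g = "\<lambda>K. G (card K) - g K" and A = ?A and B = ?B and U = J])
    show "finite J" by (rule J)
    show "0 \<le> ?A S v" for S v by simp
    show "0 \<le> ?B S v" if "S \<subseteq> J" "v \<in> S" for S v using n_ge_card[OF that(1)] pos by simp
    show "\<exists>v\<in>J - S. 0 < ?A S v" if "S \<subset> J" "S \<noteq> {}" for S
      using that J finite_subset[of S J] by (auto simp: card_gt_0_iff)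
    show "0 \<le> gen J ?A ?B (\<lambda>K. G (card K) - g K) S" if "S \<subset> J" "S \<noteq> {}" for S
      unfolding gen_diff gG[OF that] using pair_chain[OF that] by simp
    have "0 \<le> g {}" by (rule tendsto_lowerbound[OF lim]) (auto intro!: eventually_mono[OF ev_t] h_props(2) simp: st_def)
    thus "G (card {}) - g {} \<le> 0" by (simp add: G_def)
    show "G (card J) - g J \<le> 0" using full dp J by (simp add: G_def)
    show "K \<subseteq> J" by fact
  qed
  thus ?thesis by (simp add: G_def)
qed

lemma single_mutant_bound:
  assumes "j \<in> J" "x \<in> pr j"
  shows "\<kappa>p / (\<kappa>p + \<kappa>m) / (\<Sum>i<n. y ^ i) \<le> h0 {x}"
proof -
  have "\<kappa>p * g {j} + \<kappa>m * g {} \<le> (\<kappa>p + \<kappa>m) * h0 {x}"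
    using half_bound[of "{}" "{}" j x] assms by (simp add: st_def)
  moreover have "0 \<le> g {}" using g_ge[of "{}"] by simp
  moreover have "\<kappa>p * (1 / (\<Sum>i<n. y ^ i)) \<le> \<kappa>p * g {j}"
    using g_ge[of "{j}"] assms pos by (intro mult_left_mono) auto
  ultimately have "\<kappa>p * (1 / (\<Sum>i<n. y ^ i)) \<le> (\<kappa>p + \<kappa>m) * h0 {x}"
    using pos mult_nonneg_nonneg[of \<kappa>m "g {}"] by linarith
  moreover have "\<kappa>p / (\<kappa>p + \<kappa>m) / (\<Sum>i<n. y ^ i) = \<kappa>p * (1 / (\<Sum>i<n. y ^ i)) / (\<kappa>p + \<kappa>m)" by simp
  ultimately show ?thesis using pos by (simp only: pos_divide_le_eq add_pos_pos mult.commute[of "h0 {x}"])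
qed

end

subsection \<open>Geometric sums and cliques\<close>

lemma geometric_avg_ge:
  fixes z :: real assumes "0 \<le> z"
  shows "real N * z ^ (N - 1) \<le> (\<Sum>j<N. (z\<^sup>2) ^ j)"
proof -
  have "2 * (\<Sum>j<N. (z\<^sup>2) ^ j) = (\<Sum>j<N. (z\<^sup>2) ^ j) + (\<Sum>j<N. (z\<^sup>2) ^ (N - Suc j))"
    by (simp add: sum.nat_diff_reindex)
  also have "\<dots> = (\<Sum>j<N. (z\<^sup>2) ^ j + (z\<^sup>2) ^ (N - Suc j))" by (simp add: sum.distrib)
  also have "\<dots> \<ge> (\<Sum>j<N. 2 * z ^ (N - 1))"
  proof (intro sum_mono)
    fix j assume "j \<in> {..<N}"
    hence "z ^ (N - 1) = z ^ j * z ^ (N - Suc j)" by (simp flip: power_add)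
    moreover have "2 * z ^ j * z ^ (N - Suc j) \<le> (z ^ j)\<^sup>2 + (z ^ (N - Suc j))\<^sup>2" by (rule sum_squares_bound)
    ultimately show "2 * z ^ (N - 1) \<le> (z\<^sup>2) ^ j + (z\<^sup>2) ^ (N - Suc j)"
      by (simp add: power_mult[symmetric] mult.commute mult.left_commute)
  qed
  finally show ?thesis by simp
qed

lemma geometric_avg_le:
  fixes w :: real assumes "0 \<le> w" "w \<le> 1"
  shows "(\<Sum>l<n. w ^ l) \<le> real n * ((1 + w ^ (n - 1)) / 2)"
proof -
  have "2 * (\<Sum>l<n. w ^ l) = (\<Sum>l<n. w ^ l) + (\<Sum>l<n. w ^ (n - Suc l))"
    by (simp add: sum.nat_diff_reindex)
  also have "\<dots> = (\<Sum>l<n. w ^ l + w ^ (n - Suc l))" by (simp add: sum.distrib)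
  also have "\<dots> \<le> (\<Sum>l<n. 1 + w ^ (n - 1))"
  proof (intro sum_mono)
    fix l assume "l \<in> {..<n}"
    hence "w ^ (n - 1) = w ^ l * w ^ (n - Suc l)" by (simp flip: power_add)
    moreover have "0 \<le> (1 - w ^ l) * (1 - w ^ (n - Suc l))"
      using assms by (intro mult_nonneg_nonneg) (auto simp: power_le_one)
    ultimately show "w ^ l + w ^ (n - Suc l) \<le> 1 + w ^ (n - 1)" by (simp add: algebra_simps)
  qed
  finally show ?thesis by simp
qed

text \<open>For x close to 1, AM-GM bounds the average of x^j over j < N from below by x^((N-1)/2), and a
  chord bounds the average of x^(m l) over l < n from above.\<close>
lemma geometric_gap_moderate:
  fixes x :: real
  assumes x: "0 < x" "x < 1" and N: "N = 4 * n + m - 2" and m: "20 \<le> m" "m \<le> 23" and n: "100 \<le> n"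
    and big: "27/100 \<le> x ^ N"
  shows "2/5 * (1 - x) \<le> real n * (\<Sum>j<N. x ^ j) - real N * (\<Sum>l<n. (x ^ m) ^ l)"
proof -
  define z where "z = sqrt x"
  have z: "0 < z" "z < 1" "z\<^sup>2 = x" using x by (auto simp: z_def)
  define Y where "Y = z ^ (N - 1)"
  have Y1: "0 < Y" "Y \<le> 1" using z by (auto simp: Y_def power_le_one)
  have "Y\<^sup>2 = x ^ (N - 1)" by (simp add: Y_def z(3)[symmetric] power_mult[symmetric] mult.commute)
  also have "\<dots> \<ge> x ^ N" using x by (intro power_decreasing) auto
  finally have "(51/100)\<^sup>2 \<le> Y\<^sup>2" using big by (simp add: power2_eq_square)
  hence Y51: "51/100 \<le> Y" using Y1 by (meson less_imp_le power2_le_imp_le)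
  have e: "9 * (N - 1) \<le> 2 * (m * (n - 1))"
  proof -
    obtain k where k: "n = k + 100" using n by (metis le_Suc_ex add.commute)
    have "m \<in> {20, 21, 22, 23}" using m by auto
    thus ?thesis unfolding N k by auto
  qed
  have "(x ^ m) ^ (n - 1) = z ^ (2 * (m * (n - 1)))" by (simp add: z(3)[symmetric] power_mult)
  also have "\<dots> \<le> z ^ (9 * (N - 1))" using e z by (intro power_decreasing) auto
  also have "\<dots> = Y ^ 9" by (simp add: Y_def power_mult[symmetric] mult.commute)
  finally have w: "(x ^ m) ^ (n - 1) \<le> Y ^ 9" .
  have "(\<Sum>l<n. (x ^ m) ^ l) \<le> real n * ((1 + (x ^ m) ^ (n - 1)) / 2)"
    using x by (intro geometric_avg_le) (auto simp: power_le_one)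
  also have "\<dots> \<le> real n * ((1 + Y ^ 9) / 2)" using w by (intro mult_left_mono) auto
  finally have b: "(\<Sum>l<n. (x ^ m) ^ l) \<le> real n * ((1 + Y ^ 9) / 2)" .
  have a: "real N * Y \<le> (\<Sum>j<N. x ^ j)" using geometric_avg_ge[of z N] z by (simp add: Y_def)
  have "real n * (real N * Y) - real N * (real n * ((1 + Y ^ 9) / 2)) \<le> real n * (\<Sum>j<N. x ^ j) - real N * (\<Sum>l<n. (x ^ m) ^ l)"
    using a b by (intro diff_mono mult_left_mono) auto
  moreover have "real n * (real N * Y) - real N * (real n * ((1 + Y ^ 9) / 2)) = real n * real N / 2 * (2 * Y - 1 - Y ^ 9)"
    by (simp add: field_simps)
  moreover have "2 * Y - 1 - Y ^ 9 = (1 - Y) * ((\<Sum>i<9. Y ^ i) - 2)"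
    by (simp add: eval_nat_numeral algebra_simps)
  moreover have "(\<Sum>i<9. (51/100) ^ i) \<le> (\<Sum>i<9. Y ^ i)" using Y51 by (intro sum_mono power_mono) auto
  moreover have "(\<Sum>i<9. (51/100 :: real) ^ i) \<ge> 203/100" by (simp add: eval_nat_numeral)
  moreover have "1 - x \<le> 1 - Y"
  proof -
    have "Y \<le> z ^ 2" unfolding Y_def using z N n by (intro power_decreasing) auto
    thus ?thesis using z by simp
  qed
  moreover have "1000 \<le> real n * real N / 2"
  proof -
    have "100 * 100 \<le> real n * real N" using n N by (intro mult_mono) auto
    thus ?thesis by simp
  qed
  ultimately have 1: "real n * real N / 2 * ((1 - Y) * ((\<Sum>i<9. Y ^ i) - 2)) \<le> real n * (\<Sum>j<N. x ^ j) - real N * (\<Sum>l<n. (x ^ m) ^ l)"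
    and 2: "3/100 \<le> (\<Sum>i<9. Y ^ i) - 2" and 3: "1 - x \<le> 1 - Y" and 4: "1000 \<le> real n * real N / 2" by (simp_all only:)
  have "2/5 * (1 - x) \<le> 1000 * ((1 - x) * (3/100))" using x by simp
  also have "\<dots> \<le> real n * real N / 2 * ((1 - Y) * ((\<Sum>i<9. Y ^ i) - 2))"
    using 2 3 4 x by (intro mult_mono) auto
  finally show ?thesis using 1 by linarith
qed

lemma geometric_gap_extreme:
  fixes x :: real
  assumes x: "5/6 \<le> x" "x < 1" and N: "N = 4 * n + m - 2" and m: "20 \<le> m" "m \<le> 23" and n: "100 \<le> n"
    and small: "x ^ N \<le> 27/100"
  shows "2/5 * (1 - x) \<le> real n * (\<Sum>j<N. x ^ j) - real N * (\<Sum>l<n. (x ^ m) ^ l)"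
proof -
  define w where "w = x ^ m"
  have w: "0 < w" "w < 1" unfolding w_def using x m by (auto simp: power_less_one_iff)
  have a: "(1 - x) * (\<Sum>j<N. x ^ j) = 1 - x ^ N" by (simp add: one_diff_power_eq)
  have b: "(1 - w) * (\<Sum>j<n. w ^ j) \<le> 1" using w by (simp add: one_diff_power_eq[symmetric])
  have A: "(1 - x) * (\<Sum>i<m. x ^ i) = 1 - w" by (simp add: one_diff_power_eq w_def)
  have "(\<Sum>i<20. (5/6::real) ^ i) \<le> (\<Sum>i<20. x ^ i)" using x by (intro sum_mono power_mono) auto
  also have "\<dots> \<le> (\<Sum>i<m. x ^ i)" using x m by (intro sum_mono2) auto
  finally have A2: "58/10 \<le> (\<Sum>i<m. x ^ i)"
    by (simp add: eval_nat_numeral)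
  have "(1 - x) * (58/10) \<le> 1 - w" unfolding A[symmetric] using A2 x by (intro mult_left_mono) auto
  hence "(1 - x) * (58/10) * (\<Sum>j<n. w ^ j) \<le> (1 - w) * (\<Sum>j<n. w ^ j)"
    using w by (intro mult_right_mono sum_nonneg) auto
  hence "58/10 * ((1 - x) * (\<Sum>j<n. w ^ j)) \<le> 1" using b by (simp only: mult_ac)
  hence b2: "(1 - x) * (\<Sum>j<n. w ^ j) \<le> 10/58" by linarith
  define D where "D = real n * (\<Sum>j<N. x ^ j) - real N * (\<Sum>l<n. w ^ l)"
  have e: "(1 - x) * D = real n * (1 - x ^ N) - real N * ((1 - x) * (\<Sum>l<n. w ^ l))"
    unfolding a[symmetric] D_def by (simp add: algebra_simps)
  have "real n * (73/100) \<le> real n * (1 - x ^ N)" using small by (intro mult_left_mono) auto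
  moreover have "real N * ((1 - x) * (\<Sum>l<n. w ^ l)) \<le> real N * (10/58)" using b2 by (intro mult_left_mono) auto
  moreover have "real N \<le> 4 * real n + 21" "100 \<le> real n" using N m n by simp_all
  ultimately have 1: "2/5 \<le> (1 - x) * D" unfolding e by linarith
  have D: "0 \<le> D"
  proof (rule ccontr)
    assume "\<not> 0 \<le> D"
    hence "(1 - x) * D \<le> 0" using x by (intro mult_nonneg_nonpos) auto
    thus False using 1 by linarith
  qed
  have "(1 - x) * D \<le> 1 * D" using x D by (intro mult_right_mono) auto
  moreover have "2/5 * (1 - x) \<le> 2/5" using x by simp
  ultimately have "2/5 * (1 - x) \<le> D" using 1 by linarith
  thus ?thesis unfolding w_def D_def .
qed

lemma geometric_comparison:
  assumes N: "N = 4 * n + m - 2" and m: "20 \<le> m" "m \<le> 23" and n: "100 \<le> n"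
  shows "\<exists>c>0. \<forall>r. 1 < r \<longrightarrow> r \<le> 6/5 \<longrightarrow>
    1 / (\<Sum>j<N. (1/r) ^ j) + c * (r - 1) \<le> real n / (real N * (\<Sum>l<n. ((1/r) ^ m) ^ l))"
proof (intro exI conjI allI impI)
  have pos: "0 < real n" "0 < real N" using n N by auto
  let ?c = "1 / (3 * (real N)\<^sup>2 * real n)"
  show "0 < ?c" using pos by simp
  fix r :: real assume r: "1 < r" "r \<le> 6/5"
  define x where "x = 1 / r"
  have x: "5/6 \<le> x" "x < 1" using r by (auto simp: x_def field_simps)
  define a b where "a = (\<Sum>j<N. x ^ j)" and "b = (\<Sum>l<n. (x ^ m) ^ l)"
  have gap: "2/5 * (1 - x) \<le> real n * a - real N * b"
    unfolding a_def b_def using geometric_gap_moderate[OF _ x(2) N m n] geometric_gap_extreme[OF x N m n] x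
    by (cases "x ^ N \<le> 27/100") auto
  have ap: "0 < a" "0 < b" unfolding a_def b_def using pos x by (auto intro!: sum_pos simp: lessThan_empty_iff)
  have "a \<le> (\<Sum>j<N. 1)" "b \<le> (\<Sum>j<n. 1)" unfolding a_def b_def using x by (intro sum_mono power_le_one; simp add: power_le_one)+
  hence ab: "a * b \<le> real N * real n" using ap by (intro mult_mono) auto
  have "(r - 1) * (1/3) \<le> (r - 1) * (2/5 * x)" using r x by (intro mult_left_mono) auto
  moreover have "(r - 1) * x = 1 - x" using r by (simp add: x_def field_simps)
  ultimately have "1/3 * (r - 1) \<le> 2/5 * (1 - x)" by simp
  hence g3: "1/3 * (r - 1) \<le> real n * a - real N * b" using gap by linarith
  have "?c * (r - 1) = (1/3 * (r - 1)) / (real N * (real N * real n))" by (simp add: power2_eq_square)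
  also have "\<dots> \<le> (real n * a - real N * b) / (real N * (real N * real n))" using g3 pos by (intro divide_right_mono) auto
  also have "\<dots> \<le> (real n * a - real N * b) / (real N * (a * b))"
    using g3 r pos ap ab by (intro divide_left_mono mult_left_mono mult_pos_pos) auto
  also have "\<dots> = real n / (real N * b) - 1 / a" using pos ap by (simp add: field_simps)
  finally show "1 / (\<Sum>j<N. (1/r) ^ j) + ?c * (r - 1) \<le> real n / (real N * (\<Sum>l<n. ((1/r) ^ m) ^ l))"
    by (simp add: a_def b_def x_def)
qed

lemma clique_harmonic:
  fixes \<alpha> \<beta> \<omega> :: "nat \<Rightarrow> real"
  assumes fin: "finite U" and bal: "\<And>k. Suc k < card U \<Longrightarrow> (card U - Suc k) * \<alpha> (Suc k) * \<omega> (Suc k) = Suc k * \<beta> (Suc k) * \<omega> k"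
    and A: "\<And>v. v \<in> U - S \<Longrightarrow> A S v = \<alpha> (card S)" and B: "\<And>v. v \<in> S \<Longrightarrow> B S v = \<beta> (card S)"
    and S: "S \<subset> U" "S \<noteq> {}"
  shows "gen U A B (\<lambda>S. (\<Sum>i<card S. \<omega> i) / c) S = 0"
proof -
  have fS: "finite S" and SU: "S \<subseteq> U" using S fin finite_subset by auto
  obtain k where k: "card S = Suc k" using fS S by (metis card_eq_0_iff not0_implies_Suc)
  have lt: "Suc k < card U" using psubset_card_mono[OF fin S(1)] k by simp
  have "(\<Sum>v\<in>U - S. A S v * ((\<Sum>i<card (insert v S). \<omega> i) / c - (\<Sum>i<card S. \<omega> i) / c)) = (\<Sum>v\<in>U - S. \<alpha> (Suc k) * (\<omega> (Suc k) / c))"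
    using fS A k by (intro sum.cong) (auto simp: add_divide_distrib)
  also have "\<dots> = (card U - Suc k) * \<alpha> (Suc k) * \<omega> (Suc k) / c"
    using fS SU k by (simp add: card_Diff_subset)
  finally have 1: "(\<Sum>v\<in>U - S. A S v * ((\<Sum>i<card (insert v S). \<omega> i) / c - (\<Sum>i<card S. \<omega> i) / c)) = (card U - Suc k) * \<alpha> (Suc k) * \<omega> (Suc k) / c" .
  have "(\<Sum>v\<in>S. B S v * ((\<Sum>i<card (S - {v}). \<omega> i) / c - (\<Sum>i<card S. \<omega> i) / c)) = (\<Sum>v\<in>S. \<beta> (Suc k) * (- \<omega> k / c))"
    using fS B k by (intro sum.cong) (auto simp: diff_divide_distrib[symmetric])
  also have "\<dots> = - (Suc k * \<beta> (Suc k) * \<omega> k / c)" using k by simp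
  finally show ?thesis using 1 bal[OF lt] by (simp add: gen_def)
qed

text \<open>Increments of the harmonic function of a clique under death-Birth updating; under Birth-death
  updating they are (1/r)^i.\<close>
definition om_dB :: "nat \<Rightarrow> real \<Rightarrow> nat \<Rightarrow> real" where
  "om_dB H r i = (1/r) ^ i * (real H - 1 + (r - 1) * real i)"

lemma balance_Bd:
  fixes r :: real assumes "0 < r" "Suc k < H"
  shows "real (H - Suc k) * (r * real (Suc k) / (real H - 1)) * (1/r) ^ Suc k
      = real (Suc k) * ((real H - real (Suc k)) / (real H - 1)) * (1/r) ^ k"
  using assms by (simp add: of_nat_diff field_simps)

lemma balance_dB:
  fixes r :: real assumes r: "1 \<le> r" and k: "Suc k < H"
  shows "real (H - Suc k) * (r * real (Suc k) / (r * real (Suc k) + (real H - 1 - real (Suc k)))) * om_dB H r (Suc k)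
      = real (Suc k) * ((real H - real (Suc k)) / (r * (real (Suc k) - 1) + (real H - real (Suc k)))) * om_dB H r k"
proof -
  define p where "p = real H - 1 + (r - 1) * real (Suc k)"
  define q where "q = real H - 1 + (r - 1) * real k"
  have pq: "0 < p" "0 < q" using r k by (auto simp: p_def q_def intro!: add_pos_nonneg)
  have e: "r * real (Suc k) + (real H - 1 - real (Suc k)) = p" "r * (real (Suc k) - 1) + (real H - real (Suc k)) = q"
    by (simp_all add: p_def q_def algebra_simps)
  show ?thesis unfolding e om_dB_def p_def[symmetric] q_def[symmetric] using pq r k by (simp add: of_nat_diff)
qed

subsection \<open>The amplifier graph\<close>

definition mate :: "nat \<Rightarrow> nat \<Rightarrow> nat" where
  "mate H v = (if even (v - H) then v + 1 else v - 1)"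

text \<open>Nodes below H form the hub, the next 2n nodes the light pairs, the last 2n nodes the heavy pairs. The
  exponents separate the time scales of both processes: units become homogeneous at rate 1,
  active pairs invade the hub at rate t^2, and the hub invades active pairs at rate t^3.\<close>
definition amp_weight :: "nat \<Rightarrow> nat \<Rightarrow> real \<Rightarrow> nat \<Rightarrow> nat \<Rightarrow> real" where
  "amp_weight H n t u v =
     (if u < H \<and> v < H then (if u = v then 0 else t)
      else if u < H then (if v < H + 2 * n then t ^ 4 else t ^ 3)
      else if v < H then (if u < H + 2 * n then t ^ 4 else t ^ 3)
      else if u = mate H v then (if v < H + 2 * n then t ^ 2 else 1) else 0)"

definition pair :: "nat \<Rightarrow> nat \<Rightarrow> nat set" where
  "pair H j = {H + 2 * j, H + 2 * j + 1}"

lemma mate_mate: "H \<le> v \<Longrightarrow> mate H (mate H v) = v"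
proof -
  assume "H \<le> v"
  then obtain k where k: "v = H + k" using le_Suc_ex by blast
  show ?thesis by (cases "even k") (auto simp: mate_def k elim!: oddE)
qed

lemma mate_facts:
  assumes "H \<le> v"
  shows "H \<le> mate H v" "mate H v \<noteq> v" "mate H v < H + 2 * m \<longleftrightarrow> v < H + 2 * m"
proof -
  obtain k where k: "v = H + k" using assms le_Suc_ex by blast
  show "H \<le> mate H v" "mate H v \<noteq> v" "mate H v < H + 2 * m \<longleftrightarrow> v < H + 2 * m"
    by (cases "even k"; auto simp: mate_def k elim!: oddE evenE)+
qed

lemma pair_mate: "v \<in> pair H j \<Longrightarrow> pair H j = {v, mate H v}"
  by (auto simp: pair_def mate_def)

lemma pair_eq_mate: "pair H j = {x, v} \<Longrightarrow> x \<noteq> v \<Longrightarrow> v = mate H x \<and> x = mate H v"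
  by (auto simp: pair_def mate_def doubleton_eq_iff)

lemma pair_ge: "v \<in> pair H j \<Longrightarrow> H \<le> v" by (auto simp: pair_def)

lemma card_pair: "card (pair H j) = 2" by (simp add: pair_def)

lemma pair_disjoint: "i \<noteq> j \<Longrightarrow> pair H i \<inter> pair H j = {}"
  by (auto simp: pair_def)

lemma pair_hub: "pair H j \<inter> {..<H} = {}" by (auto simp: pair_def)

lemma card_pairs: "finite K \<Longrightarrow> card (\<Union>j\<in>K. pair H j) = 2 * card K"
  by (subst card_UN_disjoint) (auto simp: pair_disjoint card_pair, simp add: pair_def)

lemma pair_range:
  assumes "K \<subseteq> {a..<b}" shows "(\<Union>j\<in>K. pair H j) \<subseteq> {H + 2 * a..<H + 2 * b}"
proof
  fix v assume "v \<in> (\<Union>j\<in>K. pair H j)"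
  then obtain j where j: "j \<in> K" "v \<in> pair H j" by auto
  hence "a \<le> j" "j < b" using assms by auto
  thus "v \<in> {H + 2 * a..<H + 2 * b}" using j by (auto simp: pair_def)
qed

lemma pair_in_pairs_iff: "v \<in> pair H j \<Longrightarrow> v \<in> (\<Union>j\<in>K. pair H j) \<longleftrightarrow> j \<in> K"
  using pair_disjoint[of _ j H] by (metis UN_iff disjoint_iff)

locale amp =
  fixes H n N :: nat and t :: real
  assumes H: "2 \<le> H" and n: "1 \<le> n" and N: "N = H + 4 * n" and t: "0 < t" "t \<le> 1"
begin

abbreviation "w \<equiv> amp_weight H n t"
abbreviation "P1 \<equiv> {H..<H + 2 * n}"
abbreviation "P2 \<equiv> {H + 2 * n..<N}"

lemma weighted: "weighted_graph N w"
  unfolding weighted_graph_def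
proof (intro conjI allI impI)
  fix u v assume "u < N" "v < N"
  show "0 \<le> w u v" using t by (simp add: amp_weight_def)
  have "u = mate H v \<longleftrightarrow> v = mate H u" if "H \<le> u" "H \<le> v" using mate_mate that by metis
  moreover have "v < H + 2 * n \<longleftrightarrow> u < H + 2 * n" if "u = mate H v" "H \<le> v" using mate_facts(3)[of H v n] that by simp
  ultimately show "w u v = w v u" by (auto simp: amp_weight_def)
next
  fix u assume "u < N" show "w u u = 0" using mate_facts(2)[of H u] by (auto simp: amp_weight_def)
qed

lemma connected: "graph_connected N w"
proof -
  let ?E = "{(a, b). a < N \<and> b < N \<and> w a b > 0}"
  have N0: "0 < N" "0 < H" using H N by auto
  have e: "(u, 0) \<in> ?E \<and> (0, u) \<in> ?E" if "u < N" "u \<noteq> 0" for u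
    using that N0 t by (auto simp: amp_weight_def)
  have "(u, 0) \<in> ?E\<^sup>*" if "u < N" for u using e[OF that] by (cases "u = 0") auto
  moreover have "(0, u) \<in> ?E\<^sup>*" if "u < N" for u using e[OF that] by (cases "u = 0") auto
  ultimately show ?thesis unfolding graph_connected_def by (meson rtrancl_trans)
qed

lemma wgraph: "1 \<le> r \<Longrightarrow> wgraph N w r"
  using weighted connected H N by unfold_locales auto

definition cc :: "real \<Rightarrow> real \<Rightarrow> real \<Rightarrow> nat \<Rightarrow> real" where
  "cc c0 c1 c2 u = (if u < H then c0 else if u < H + 2 * n then c1 else c2)"

lemma cc_simps: "u < H \<Longrightarrow> cc c0 c1 c2 u = c0" "H \<le> u \<Longrightarrow> u < H + 2 * n \<Longrightarrow> cc c0 c1 c2 u = c1"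
    "H + 2 * n \<le> u \<Longrightarrow> cc c0 c1 c2 u = c2"
  by (simp_all add: cc_def)

lemma sum_to_hub:
  assumes S: "S \<subseteq> {..<N}" and v: "v < H"
  shows "(\<Sum>u\<in>S. w u v * cc c0 c1 c2 u)
     = real (card (S \<inter> {..<H} - {v})) * (t * c0) + real (card (S \<inter> P1)) * (t ^ 4 * c1) + real (card (S \<inter> P2)) * (t ^ 3 * c2)"
proof -
  have fS: "finite S" using S finite_subset by blast
  have eS2: "S - {..<H} = S \<inter> P1 \<union> S \<inter> P2" using S N by auto
  have "(\<Sum>u\<in>S. w u v * cc c0 c1 c2 u) = (\<Sum>u\<in>S \<inter> {..<H}. w u v * cc c0 c1 c2 u) +
     ((\<Sum>u\<in>S \<inter> P1. w u v * cc c0 c1 c2 u) + (\<Sum>u\<in>S \<inter> P2. w u v * cc c0 c1 c2 u))"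
    unfolding sum.Int_Diff[OF fS, of _ "{..<H}"] eS2 by (subst sum.union_disjoint[of "S \<inter> P1"]) (use fS in auto)
  moreover have "(\<Sum>u\<in>S \<inter> {..<H}. w u v * cc c0 c1 c2 u) = (\<Sum>u\<in>S \<inter> {..<H} - {v}. t * c0)"
    using fS v by (intro sum.mono_neutral_cong_right) (auto simp: amp_weight_def cc_def)
  moreover have "(\<Sum>u\<in>S \<inter> P1. w u v * cc c0 c1 c2 u) = (\<Sum>u\<in>S \<inter> P1. t ^ 4 * c1)"
    using v by (intro sum.cong) (auto simp: amp_weight_def cc_def)
  moreover have "(\<Sum>u\<in>S \<inter> P2. w u v * cc c0 c1 c2 u) = (\<Sum>u\<in>S \<inter> P2. t ^ 3 * c2)"
    using v by (intro sum.cong) (auto simp: amp_weight_def cc_def)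
  ultimately show ?thesis by simp
qed

lemma sum_to_pair:
  assumes S: "S \<subseteq> {..<N}" and v: "H \<le> v"
  shows "(\<Sum>u\<in>S. w u v * cc c0 c1 c2 u)
     = real (card (S \<inter> {..<H})) * ((if v < H + 2 * n then t ^ 4 else t ^ 3) * c0)
       + (if mate H v \<in> S then (if v < H + 2 * n then t ^ 2 else 1) * cc c0 c1 c2 v else 0)"
proof -
  have fS: "finite S" using S finite_subset by blast
  have "(\<Sum>u\<in>S. w u v * cc c0 c1 c2 u) = (\<Sum>u\<in>S \<inter> {..<H}. w u v * cc c0 c1 c2 u) + (\<Sum>u\<in>S - {..<H}. w u v * cc c0 c1 c2 u)"
    by (rule sum.Int_Diff[OF fS])
  moreover have "(\<Sum>u\<in>S \<inter> {..<H}. w u v * cc c0 c1 c2 u) = (\<Sum>u\<in>S \<inter> {..<H}. (if v < H + 2 * n then t ^ 4 else t ^ 3) * c0)"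
    using v by (intro sum.cong) (auto simp: amp_weight_def cc_def)
  moreover have "(\<Sum>u\<in>S - {..<H}. w u v * cc c0 c1 c2 u)
    = (\<Sum>u\<in>S - {..<H}. if u = mate H v then (if v < H + 2 * n then t ^ 2 else 1) * cc c0 c1 c2 v else 0)"
    using v mate_facts(1,2)[OF v] mate_facts(3)[OF v, of n] by (intro sum.cong) (auto simp: amp_weight_def cc_def)
  moreover have "\<dots> = (if mate H v \<in> S then (if v < H + 2 * n then t ^ 2 else 1) * cc c0 c1 c2 v else 0)"
    using fS mate_facts(1)[OF v] by (subst sum.delta) auto
  ultimately show ?thesis by simp
qed

definition "dh = real (H - 1) * t + real (2 * n) * t ^ 4 + real (2 * n) * t ^ 3"
definition "d1 = real H * t ^ 4 + t ^ 2"
definition "d2 = real H * t ^ 3 + 1"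

lemma wdeg_amp: "u < N \<Longrightarrow> wdeg N w u = cc dh d1 d2 u"
proof -
  assume u: "u < N"
  have 1: "cc 1 1 1 v = 1" for v by (simp add: cc_def)
  have "wdeg N w u = (\<Sum>v\<in>{..<N}. w v u * cc 1 1 1 v)"
    using weighted u by (auto simp: wdeg_def weighted_graph_def 1 intro!: sum.cong)
  also have "\<dots> = cc dh d1 d2 u"
  proof (cases "u < H")
    case True
    have "{..<N} \<inter> {..<H} - {u} = {..<H} - {u}" "{..<N} \<inter> P1 = P1" "{..<N} \<inter> P2 = P2" using N by auto
    hence "card ({..<N} \<inter> {..<H} - {u}) = H - 1" "card ({..<N} \<inter> P1) = 2 * n" "card ({..<N} \<inter> P2) = 2 * n"
      using True N by simp_all
    thus ?thesis unfolding sum_to_hub[OF order_refl True] by (simp only: cc_simps(1)[OF True] dh_def)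
  next
    case False
    hence u': "H \<le> u" by simp
    have "{..<N} \<inter> {..<H} = {..<H}" using N by auto
    moreover have "mate H u < N" using mate_facts(3)[OF u', of "2 * n"] u N by simp
    ultimately show ?thesis using u' unfolding sum_to_pair[OF order_refl u']
      by (cases "u < H + 2 * n") (simp_all add: cc_simps d1_def d2_def)
  qed
  finally show ?thesis .
qed

lemma up_Bd_sum: "S \<subseteq> {..<N} \<Longrightarrow> up_Bd N w r S v = r * (\<Sum>u\<in>S. w u v * cc (1/dh) (1/d1) (1/d2) u)"
  unfolding up_Bd_def sum_distrib_left by (intro sum.cong refl) (auto simp: wdeg_amp cc_def)

lemma dn_Bd_sum: "dn_Bd N w r S v = (\<Sum>u\<in>{..<N} - S. w u v * cc (1/dh) (1/d1) (1/d2) u)"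
  unfolding dn_Bd_def by (intro sum.cong refl) (auto simp: wdeg_amp cc_def)

lemma card_compl: "S \<subseteq> {..<N} \<Longrightarrow> card (({..<N} - S) \<inter> P1) = 2 * n - card (S \<inter> P1)"
   "S \<subseteq> {..<N} \<Longrightarrow> card (({..<N} - S) \<inter> P2) = 2 * n - card (S \<inter> P2)"
   "S \<subseteq> {..<N} \<Longrightarrow> card (({..<N} - S) \<inter> {..<H}) = H - card (S \<inter> {..<H})"
proof -
  have "({..<N} - S) \<inter> P1 = P1 - S \<inter> P1" "({..<N} - S) \<inter> P2 = P2 - S \<inter> P2" "({..<N} - S) \<inter> {..<H} = {..<H} - S \<inter> {..<H}"
    using N by auto
  thus "card (({..<N} - S) \<inter> P1) = 2 * n - card (S \<inter> P1)"
   "card (({..<N} - S) \<inter> P2) = 2 * n - card (S \<inter> P2)"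
   "card (({..<N} - S) \<inter> {..<H}) = H - card (S \<inter> {..<H})"
    using N by (simp_all add: card_Diff_subset)
qed

text \<open>Only states with resident heavy pairs matter for Bd, and with resident light pairs for dB.\<close>
lemma rate_Bd_hub:
  assumes S: "S \<subseteq> {..<H} \<union> P1" and v: "v < H"
    and z: "z = card (S \<inter> {..<H})" and a: "a = card (S \<inter> P1)"
  shows "rate (up_Bd N w r) (dn_Bd N w r) S v = (if v \<in> S then
     (real H - z) * (t / dh) + (2 * real n - a) * (t ^ 4 / d1) + 2 * real n * (t ^ 3 / d2)
     else r * (z * (t / dh) + a * (t ^ 4 / d1)))"
proof -
  have SN: "S \<subseteq> {..<N}" using S N by auto
  have P2: "S \<inter> P2 = {}" using S N by auto
  have le: "z \<le> H" "a \<le> 2 * n" using card_mono[of "{..<H}" "S \<inter> {..<H}"] card_mono[of P1 "S \<inter> P1"] by (auto simp: z a)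
  show ?thesis
  proof (cases "v \<in> S")
    case True
    have "({..<N} - S) \<inter> {..<H} - {v} = ({..<N} - S) \<inter> {..<H}" using True by auto
    moreover have "({..<N} - S) \<subseteq> {..<N}" by auto
    ultimately show ?thesis using True le P2 card_compl[OF SN] v
      by (simp add: rate_def dn_Bd_sum sum_to_hub of_nat_diff flip: z a)
  next
    case False
    hence "S \<inter> {..<H} - {v} = S \<inter> {..<H}" by auto
    thus ?thesis using False P2 v SN by (simp add: rate_def up_Bd_sum sum_to_hub flip: z a)
  qed
qed

lemma rate_Bd_pair:
  assumes S: "S \<subseteq> {..<H} \<union> P1" and v: "v \<in> P1"
    and z: "z = card (S \<inter> {..<H})"
  shows "rate (up_Bd N w r) (dn_Bd N w r) S v = (if v \<in> S then
     (real H - z) * (t ^ 4 / dh) + (if mate H v \<in> S then 0 else t ^ 2 / d1)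
     else r * (z * (t ^ 4 / dh) + (if mate H v \<in> S then t ^ 2 / d1 else 0)))"
proof -
  have SN: "S \<subseteq> {..<N}" using S N by auto
  have le: "z \<le> H" using card_mono[of "{..<H}" "S \<inter> {..<H}"] by (auto simp: z)
  have v': "H \<le> v" "v < H + 2 * n" using v by auto
  have m: "mate H v < N" using mate_facts(3)[OF v'(1), of n] v' N by simp
  show ?thesis
  proof (cases "v \<in> S")
    case True
    have "({..<N} - S) \<subseteq> {..<N}" by auto
    thus ?thesis using True le card_compl[OF SN] v' m
      by (simp add: rate_def dn_Bd_sum sum_to_pair of_nat_diff cc_simps flip: z)
  next
    case False
    thus ?thesis using v' SN by (simp add: rate_def up_Bd_sum sum_to_pair cc_simps flip: z)
  qed
qed

lemma dB_sum: "(\<Sum>u\<in>S. w u v) = (\<Sum>u\<in>S. w u v * cc 1 1 1 u)"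
  by (intro sum.cong) (simp_all add: cc_def)

lemma rate_dB_hub:
  assumes S: "S \<subseteq> {..<H} \<union> P2" and v: "v < H"
    and z: "z = card (S \<inter> {..<H})" and a: "a = card (S \<inter> P2)"
  shows "v \<notin> S \<Longrightarrow> rate (up_dB N w r) (dn_dB N w r) S v =
       r * (real z * t + real a * t ^ 3) / (r * (real z * t + real a * t ^ 3) + ((real H - 1 - real z) * t + (2 * real n - real a) * t ^ 3 + 2 * real n * t ^ 4))"
    and "v \<in> S \<Longrightarrow> rate (up_dB N w r) (dn_dB N w r) S v =
       ((real H - real z) * t + (2 * real n - real a) * t ^ 3 + 2 * real n * t ^ 4)
       / (r * ((real z - 1) * t + real a * t ^ 3) + ((real H - real z) * t + (2 * real n - real a) * t ^ 3 + 2 * real n * t ^ 4))"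
proof -
  have SN: "S \<subseteq> {..<N}" using S N by auto
  have P1: "S \<inter> P1 = {}" using S N by auto
  have cN: "({..<N} - S) \<subseteq> {..<N}" by auto
  have le: "z \<le> H" "a \<le> 2 * n" using card_mono[of "{..<H}" "S \<inter> {..<H}"] card_mono[of P2 "S \<inter> P2"] N by (auto simp: z a)
  show "rate (up_dB N w r) (dn_dB N w r) S v =
       r * (real z * t + real a * t ^ 3) / (r * (real z * t + real a * t ^ 3) + ((real H - 1 - real z) * t + (2 * real n - real a) * t ^ 3 + 2 * real n * t ^ 4))" if vS: "v \<notin> S"
  proof -
    have c1: "S \<inter> {..<H} - {v} = S \<inter> {..<H}" using vS by auto
    have "({..<N} - S) \<inter> {..<H} - {v} = ({..<H} - insert v (S \<inter> {..<H}))" using N by auto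
    moreover have "card ({..<H} - insert v (S \<inter> {..<H})) = H - Suc z"
      using vS v by (subst card_Diff_subset) (auto simp: z)
    ultimately have c2: "card (({..<N} - S) \<inter> {..<H} - {v}) = H - Suc z" by simp
    have "insert v (S \<inter> {..<H}) \<subseteq> {..<H}" using v by auto
    hence "Suc z \<le> H" using card_mono[of "{..<H}" "insert v (S \<inter> {..<H})"] vS by (simp add: z)
    hence "real (H - Suc z) = real H - 1 - z" by (simp add: of_nat_diff)
    thus ?thesis
      using vS c1 c2 P1 le card_compl[OF SN] v
      by (simp add: rate_def up_dB_def sum_distrib_left[symmetric] dB_sum sum_to_hub[OF SN v] sum_to_hub[OF cN v] of_nat_diff add_ac flip: z a)
  qed
  show "rate (up_dB N w r) (dn_dB N w r) S v =
       ((real H - real z) * t + (2 * real n - real a) * t ^ 3 + 2 * real n * t ^ 4)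
       / (r * ((real z - 1) * t + real a * t ^ 3) + ((real H - real z) * t + (2 * real n - real a) * t ^ 3 + 2 * real n * t ^ 4))" if vS: "v \<in> S"
  proof -
    have "({..<N} - S) \<inter> {..<H} - {v} = ({..<N} - S) \<inter> {..<H}" using vS by auto
    moreover have "card (S \<inter> {..<H} - {v}) = z - 1" using vS v by (simp add: z)
    moreover have "real (z - 1) = real z - 1"
    proof -
      have "S \<inter> {..<H} \<noteq> {}" using vS v by auto
      hence "0 < z" by (simp add: z card_gt_0_iff)
      thus ?thesis by (simp add: of_nat_diff)
    qed
    ultimately show ?thesis
      using vS P1 le card_compl[OF SN] v
      by (simp add: rate_def dn_dB_def sum_distrib_left[symmetric] dB_sum sum_to_hub[OF SN v] sum_to_hub[OF cN v] of_nat_diff add_ac flip: z a)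
  qed
qed

lemma rate_dB_pair:
  assumes S: "S \<subseteq> {..<H} \<union> P2" and v: "v \<in> P2"
    and z: "z = card (S \<inter> {..<H})"
    and M: "M = z * t ^ 3 + (if mate H v \<in> S then 1 else 0)"
    and R: "R = (real H - z) * t ^ 3 + (if mate H v \<in> S then 0 else 1)"
  shows "rate (up_dB N w r) (dn_dB N w r) S v = (if v \<in> S then R else r * M) / (r * M + R)"
proof -
  have SN: "S \<subseteq> {..<N}" using S N by auto
  have cN: "({..<N} - S) \<subseteq> {..<N}" by auto
  have le: "z \<le> H" using card_mono[of "{..<H}" "S \<inter> {..<H}"] by (auto simp: z)
  have v': "H \<le> v" "\<not> v < H + 2 * n" "v < N" using v by auto
  have m: "mate H v < N" using mate_facts(3)[OF v'(1), of "2 * n"] v' N by simp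
  have "(\<Sum>u\<in>S. w u v) = M" using v' by (simp add: dB_sum sum_to_pair[OF SN v'(1)] M cc_simps flip: z)
  moreover have "(\<Sum>u\<in>{..<N} - S. w u v) = R"
    using v' m le card_compl(3)[OF SN] by (simp add: dB_sum sum_to_pair[OF cN v'(1)] R cc_simps of_nat_diff flip: z)
  ultimately show ?thesis by (simp add: rate_def up_dB_def dn_dB_def sum_distrib_left[symmetric])
qed

end

subsection \<open>Limits of the Birth-death rates\<close>

lemma tendsto_on_unit:
  assumes "\<And>t. 0 < t \<Longrightarrow> t \<le> 1 \<Longrightarrow> f t = g t" "(g \<longlongrightarrow> L) (at_right (0::real))"
  shows "(f \<longlongrightarrow> L) (at_right 0)"
proof -
  have "eventually (\<lambda>t. f t = g t) (at_right 0)"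
    using assms(1) by (auto simp: eventually_at_right[of 0 1] intro!: exI[of _ 1])
  thus ?thesis using assms(2) tendsto_cong by blast
qed

lemma flat_quotient:
  fixes p0 p1 p2 s0 s1 s2 :: real assumes "s0 \<noteq> 0"
  shows "((\<lambda>t. ((p0 + p1 * t ^ 2 + p2 * t ^ 3) / (s0 + s1 * t ^ 2 + s2 * t ^ 3) - p0 / s0) / t) \<longlongrightarrow> 0) (at_right 0)"
proof -
  have "((\<lambda>t. (p0 + p1 * t ^ 2 + p2 * t ^ 3) / (s0 + s1 * t ^ 2 + s2 * t ^ 3)) has_real_derivative 0) (at 0)"
    using assms by (auto intro!: derivative_eq_intros)
  hence "((\<lambda>t. ((p0 + p1 * t ^ 2 + p2 * t ^ 3) / (s0 + s1 * t ^ 2 + s2 * t ^ 3) - p0 / s0) / t) \<longlongrightarrow> 0) (at 0)"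
    by (simp add: has_field_derivative_iff)
  thus ?thesis by (rule filterlim_mono) (auto simp: at_le)
qed

definition qh :: "nat \<Rightarrow> nat \<Rightarrow> real \<Rightarrow> real" where
  "qh H n t = 1 / (real H - 1 + 2 * real n * t ^ 2 + 2 * real n * t ^ 3)"
definition q1 :: "nat \<Rightarrow> real \<Rightarrow> real" where "q1 H t = 1 / (1 + real H * t ^ 2)"
definition q2 :: "nat \<Rightarrow> real \<Rightarrow> real" where "q2 H t = 1 / (1 + real H * t ^ 3)"

lemma qh_lim: "2 \<le> H \<Longrightarrow> (qh H n \<longlongrightarrow> 1 / (real H - 1)) (at_right 0)"
  unfolding qh_def by (auto intro!: tendsto_eq_intros)

lemma qh_flat: "2 \<le> H \<Longrightarrow> ((\<lambda>t. (qh H n t - 1 / (real H - 1)) / t) \<longlongrightarrow> 0) (at_right 0)"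
  unfolding qh_def using flat_quotient[of "real H - 1" 1 0 0 "2 * real n" "2 * real n"] by simp

lemma q1_lim: "(q1 H \<longlongrightarrow> 1) (at_right 0)"
  unfolding q1_def by (auto intro!: tendsto_eq_intros)

lemma q2_lim: "(q2 H \<longlongrightarrow> 1) (at_right 0)"
  unfolding q2_def by (auto intro!: tendsto_eq_intros)

context amp
begin

lemma d_quotients: "t / dh = qh H n t" "t ^ 4 / dh = t ^ 3 * qh H n t" "t ^ 2 / d1 = q1 H t"
  "t ^ 4 / d1 = t ^ 2 * q1 H t" "t ^ 3 / d2 = t ^ 3 * q2 H t"
proof -
  have "dh = t * (real H - 1 + 2 * real n * t ^ 2 + 2 * real n * t ^ 3)"
    using H by (simp add: dh_def of_nat_diff algebra_simps eval_nat_numeral)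
  thus "t / dh = qh H n t" "t ^ 4 / dh = t ^ 3 * qh H n t"
    using t by (simp_all add: qh_def eval_nat_numeral)
  have "d1 = t ^ 2 * (1 + real H * t ^ 2)" by (simp add: d1_def algebra_simps eval_nat_numeral)
  thus "t ^ 2 / d1 = q1 H t" "t ^ 4 / d1 = t ^ 2 * q1 H t"
    using t by (simp_all add: q1_def eval_nat_numeral)
  show "t ^ 3 / d2 = t ^ 3 * q2 H t" by (simp add: d2_def q2_def add.commute)
qed

lemmas rate_Bd_hub' = rate_Bd_hub[unfolded d_quotients]
lemmas rate_Bd_pair' = rate_Bd_pair[unfolded d_quotients]

lemma rate_dB_hub':
  assumes S: "S \<subseteq> {..<H} \<union> P2" and v: "v < H"
    and z: "z = card (S \<inter> {..<H})" and a: "a = card (S \<inter> P2)"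
  shows "v \<notin> S \<Longrightarrow> rate (up_dB N w r) (dn_dB N w r) S v =
       (r * real z + (r * real a) * t ^ 2 + 0 * t ^ 3) / ((r * real z + (real H - 1 - real z)) + (r * real a + (2 * real n - real a)) * t ^ 2 + 2 * real n * t ^ 3)"
    and "v \<in> S \<Longrightarrow> rate (up_dB N w r) (dn_dB N w r) S v =
       ((real H - real z) + (2 * real n - real a) * t ^ 2 + 2 * real n * t ^ 3)
       / ((r * (real z - 1) + (real H - real z)) + (r * real a + (2 * real n - real a)) * t ^ 2 + 2 * real n * t ^ 3)"
proof -
  have *: "P / Q = X / Y" if "P = X * t" "Q = Y * t" for P Q X Y using t that by simp
  show "rate (up_dB N w r) (dn_dB N w r) S v =
       (r * real z + (r * real a) * t ^ 2 + 0 * t ^ 3) / ((r * real z + (real H - 1 - real z)) + (r * real a + (2 * real n - real a)) * t ^ 2 + 2 * real n * t ^ 3)"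
    if "v \<notin> S"
    unfolding rate_dB_hub(1)[OF S v z a that] by (rule *) (simp_all add: algebra_simps eval_nat_numeral)
  show "rate (up_dB N w r) (dn_dB N w r) S v =
       ((real H - real z) + (2 * real n - real a) * t ^ 2 + 2 * real n * t ^ 3)
       / ((r * (real z - 1) + (real H - real z)) + (r * real a + (2 * real n - real a)) * t ^ 2 + 2 * real n * t ^ 3)"
    if "v \<in> S"
    unfolding rate_dB_hub(2)[OF S v z a that] by (rule *) (simp_all add: algebra_simps eval_nat_numeral)
qed

end

definition unit_state :: "nat \<Rightarrow> nat set \<Rightarrow> nat set \<Rightarrow> nat set" where
  "unit_state H Z K = Z \<union> (\<Union>j\<in>K. pair H j)"

lemma unit_state_facts:
  assumes Z: "Z \<subseteq> {..<H}" and K: "K \<subseteq> {a..<b}" and S': "S = unit_state H Z K"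
  shows "S \<inter> {..<H} = Z" "S \<subseteq> {..<H} \<union> {H + 2 * a..<H + 2 * b}" "card (S \<inter> {H + 2 * a..<H + 2 * b}) = 2 * card K"
    "v \<in> pair H j \<Longrightarrow> v \<in> S \<longleftrightarrow> j \<in> K" "v \<in> pair H j \<Longrightarrow> mate H v \<in> S \<longleftrightarrow> j \<in> K"
    "u < H \<Longrightarrow> u \<in> S \<longleftrightarrow> u \<in> Z"
proof -
  note S = S'[unfolded unit_state_def]
  have r: "(\<Union>j\<in>K. pair H j) \<subseteq> {H + 2 * a..<H + 2 * b}" by (rule pair_range[OF K])
  show "S \<inter> {..<H} = Z" "S \<subseteq> {..<H} \<union> {H + 2 * a..<H + 2 * b}" using Z r S by auto
  show "u \<in> S \<longleftrightarrow> u \<in> Z" if "u < H" using \<open>S \<inter> {..<H} = Z\<close> that by auto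
  have "S \<inter> {H + 2 * a..<H + 2 * b} = (\<Union>j\<in>K. pair H j)" using Z r S by auto
  thus "card (S \<inter> {H + 2 * a..<H + 2 * b}) = 2 * card K" using card_pairs finite_subset[OF K] by simp
  have *: "v \<in> S \<longleftrightarrow> j \<in> K" if "v \<in> pair H j" for v
    using pair_in_pairs_iff[OF that, of K] pair_ge[OF that] Z S by auto
  show "v \<in> S \<longleftrightarrow> j \<in> K" if "v \<in> pair H j" by (rule *[OF that])
  show "mate H v \<in> S \<longleftrightarrow> j \<in> K" if "v \<in> pair H j" by (rule *) (use pair_mate[OF that] in blast)
qed

lemma half_state_facts:
  assumes Z: "Z \<subseteq> {..<H}" and K: "K \<subseteq> {a..<b} - {j}" and j: "j \<in> {a..<b}" and x: "x \<in> pair H j"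
    and S: "S = insert x (unit_state H Z K)"
  shows "S \<inter> {..<H} = Z" "S \<subseteq> {..<H} \<union> {H + 2 * a..<H + 2 * b}"
    "v \<in> pair H i \<Longrightarrow> i \<noteq> j \<Longrightarrow> v \<in> S \<longleftrightarrow> i \<in> K" "v \<in> pair H i \<Longrightarrow> i \<noteq> j \<Longrightarrow> mate H v \<in> S \<longleftrightarrow> i \<in> K"
    "x \<in> S" "mate H x \<notin> S" "u < H \<Longrightarrow> u \<in> S \<longleftrightarrow> u \<in> Z"
proof -
  have K': "K \<subseteq> {a..<b}" using K by auto
  note f = unit_state_facts[OF Z K' refl]
  have xr: "x \<in> {H + 2 * a..<H + 2 * b}" "H \<le> x" using pair_range[of "{j}" a b H] x j pair_ge[OF x] by auto
  show i: "S \<inter> {..<H} = Z" using f(1) S xr by auto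
  show "S \<subseteq> {..<H} \<union> {H + 2 * a..<H + 2 * b}" using f(2) S xr by auto
  show "u \<in> S \<longleftrightarrow> u \<in> Z" if "u < H" using i that by auto
  have *: "v \<in> S \<longleftrightarrow> i \<in> K" if "v \<in> pair H i" "i \<noteq> j" for v
  proof -
    have "v \<noteq> x" using pair_disjoint[OF that(2), of H] that x by auto
    thus ?thesis using f(4)[OF that(1)] S by auto
  qed
  show "v \<in> S \<longleftrightarrow> i \<in> K" if "v \<in> pair H i" "i \<noteq> j" by (rule *[OF that])
  show "mate H v \<in> S \<longleftrightarrow> i \<in> K" if "v \<in> pair H i" "i \<noteq> j" by (rule *) (use pair_mate[OF that(1)] that in blast)+
  show "x \<in> S" using S by simp
  have "mate H x \<noteq> x" by (rule mate_facts(2)[OF pair_ge[OF x]])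
  thus "mate H x \<notin> S" using f(5)[OF x] K S by auto
qed

locale amp_lim =
  fixes H n N :: nat and r :: real
  assumes H: "2 \<le> H" and n: "1 \<le> n" and N: "N = H + 4 * n" and r: "1 \<le> r"
begin

lemma amp: "0 < t \<Longrightarrow> t \<le> 1 \<Longrightarrow> amp H n N t"
  using H n N by unfold_locales

abbreviation "w t \<equiv> amp_weight H n t"
abbreviation "AB t \<equiv> up_Bd N (w t) r"
abbreviation "BB t \<equiv> dn_Bd N (w t) r"
abbreviation "Ad t \<equiv> up_dB N (w t) r"
abbreviation "Bd t \<equiv> dn_dB N (w t) r"
abbreviation "st \<equiv> unit_state H"

lemma wg: "0 < t \<Longrightarrow> t \<le> 1 \<Longrightarrow> wgraph N (w t) r"
  using amp.wgraph[OF amp] r by blast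

lemma c_pos: "0 < real H - 1" using H by simp

lemma pair_P1: "j \<in> {0..<n} \<Longrightarrow> v \<in> pair H j \<Longrightarrow> v \<in> {H..<H + 2 * n}"
  using pair_range[of "{j}" 0 n H] by auto

lemma pair_P2: "j \<in> {n..<2 * n} \<Longrightarrow> v \<in> pair H j \<Longrightarrow> v \<in> {H + 2 * n..<N}"
  using pair_range[of "{j}" n "2 * n" H] N by auto

lemma Bd_hub_rate:
  assumes "Z \<subset> {..<H}" "Z \<noteq> {}" "K \<subseteq> {0..<n}" "v \<in> {..<H}"
  shows "((\<lambda>t. (rate (AB t) (BB t) (st Z K) v - rate (\<lambda>Z _. r * card Z / (real H - 1)) (\<lambda>Z _. (real H - card Z) / (real H - 1)) Z v) / t) \<longlongrightarrow> 0) (at_right 0)"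
proof -
  have Z: "Z \<subseteq> {..<H}" using assms by auto
  have v: "v < H" using assms by auto
  note f = unit_state_facts[OF Z assms(3) refl, unfolded mult_0_right add_0_right]
  let ?z = "real (card Z)" and ?a = "real (2 * card K)" and ?c = "1 / (real H - 1)"
  show ?thesis
  proof (cases "v \<in> Z")
    case True
    let ?g = "\<lambda>t. (real H - ?z) * ((qh H n t - ?c) / t) + (2 * real n - ?a) * (t * q1 H t) + 2 * real n * (t ^ 2 * q2 H t)"
    have "(?g \<longlongrightarrow> (real H - ?z) * 0 + (2 * real n - ?a) * (0 * 1) + 2 * real n * (0 ^ 2 * 1)) (at_right 0)"
      by (intro tendsto_intros qh_flat H q1_lim q2_lim)
    hence l: "(?g \<longlongrightarrow> 0) (at_right 0)" by simp
    show ?thesis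
    proof (rule tendsto_on_unit[OF _ l])
      fix t :: real assume t: "0 < t" "t \<le> 1"
      have "rate (AB t) (BB t) (st Z K) v = (real H - ?z) * qh H n t + (2 * real n - ?a) * (t ^ 2 * q1 H t) + 2 * real n * (t ^ 3 * q2 H t)"
        using amp.rate_Bd_hub'[OF amp[OF t] f(2) v refl refl, of r] f True v by simp
      moreover have "rate (\<lambda>Z _. r * card Z / (real H - 1)) (\<lambda>Z _. (real H - card Z) / (real H - 1)) Z v = (real H - ?z) * ?c"
        using True by (simp add: rate_def)
      moreover have "(X * q + Y * (t ^ 2 * q') + W * (t ^ 3 * q'') - X * c') / t = X * ((q - c') / t) + Y * (t * q') + W * (t ^ 2 * q'')" for X Y W q q' q'' c'
        using t by (simp add: field_simps eval_nat_numeral)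
      ultimately show "(rate (AB t) (BB t) (st Z K) v - rate (\<lambda>Z _. r * card Z / (real H - 1)) (\<lambda>Z _. (real H - card Z) / (real H - 1)) Z v) / t = ?g t"
        by (simp only:)
    qed
  next
    case False
    let ?g = "\<lambda>t. r * (?z * ((qh H n t - ?c) / t) + ?a * (t * q1 H t))"
    have "(?g \<longlongrightarrow> r * (?z * 0 + ?a * (0 * 1))) (at_right 0)"
      by (intro tendsto_intros qh_flat H q1_lim q2_lim)
    hence l: "(?g \<longlongrightarrow> 0) (at_right 0)" by simp
    show ?thesis
    proof (rule tendsto_on_unit[OF _ l])
      fix t :: real assume t: "0 < t" "t \<le> 1"
      have "rate (AB t) (BB t) (st Z K) v = r * (?z * qh H n t + ?a * (t ^ 2 * q1 H t))"
        using amp.rate_Bd_hub'[OF amp[OF t] f(2) v refl refl, of r] f False v by simp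
      moreover have "rate (\<lambda>Z _. r * card Z / (real H - 1)) (\<lambda>Z _. (real H - card Z) / (real H - 1)) Z v = r * ?z * ?c"
        using False by (simp add: rate_def)
      moreover have "(r * (X * q + Y * (t ^ 2 * q')) - r * X * c') / t = r * (X * ((q - c') / t) + Y * (t * q'))" for X Y q q' c'
        using t by (simp add: field_simps eval_nat_numeral)
      ultimately show "(rate (AB t) (BB t) (st Z K) v - rate (\<lambda>Z _. r * card Z / (real H - 1)) (\<lambda>Z _. (real H - card Z) / (real H - 1)) Z v) / t = ?g t"
        by (simp only:)
    qed
  qed
qed

lemma Bd_pair_rate:
  assumes Z: "Z \<subseteq> {..<H}" and K: "K \<subseteq> {0..<n}" and j: "j \<in> {0..<n}" and v: "v \<in> pair H j" and t: "0 < t" "t \<le> 1"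
  shows "rate (AB t) (BB t) (st Z K) v = t ^ 3 * ((if j \<in> K then real H - card Z else r * card Z) * qh H n t)"
proof -
  note f = unit_state_facts[OF Z K refl, unfolded mult_0_right add_0_right]
  have v': "v \<in> {H..<H + 2 * n}" by (rule pair_P1[OF j v])
  show ?thesis using amp.rate_Bd_pair'[OF amp[OF t] f(2) v' refl, of r] f(1) f(4,5)[OF v] by simp
qed

lemma Bd_half_hub:
  assumes Z: "Z = {} \<or> Z = {..<H}" and K: "K \<subseteq> {0..<n} - {j}" and j: "j \<in> {0..<n}" and x: "x \<in> pair H j" and v: "v < H"
  shows "((\<lambda>t. rate (AB t) (BB t) (insert x (st Z K)) v) \<longlongrightarrow> 0) (at_right 0)"
proof -
  have ZH: "Z \<subseteq> {..<H}" using Z by auto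
  note f = half_state_facts[OF ZH K j x refl, unfolded mult_0_right add_0_right]
  define a where "a = real (card (insert x (st Z K) \<inter> {H..<H + 2 * n}))"
  define c d where "c = (if v \<in> Z then 2 * real n - a else r * a)" and "d = (if v \<in> Z then 2 * real n else 0)"
  let ?g = "\<lambda>t. c * (t ^ 2 * q1 H t) + d * (t ^ 3 * q2 H t)"
  have "(?g \<longlongrightarrow> c * (0 ^ 2 * 1) + d * (0 ^ 3 * 1)) (at_right 0)"
    by (intro tendsto_intros q1_lim q2_lim)
  hence l: "(?g \<longlongrightarrow> 0) (at_right 0)" by simp
  show ?thesis
  proof (rule tendsto_on_unit[OF _ l])
    fix t :: real assume t: "0 < t" "t \<le> 1"
    show "rate (AB t) (BB t) (insert x (st Z K)) v = ?g t"
      using Z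
    proof
      assume "Z = {}"
      thus ?thesis using amp.rate_Bd_hub'[OF amp[OF t] f(2) v refl refl, of r] f(1) f(7)[OF v]
        by (simp add: a_def c_def d_def)
    next
      assume "Z = {..<H}"
      thus ?thesis using amp.rate_Bd_hub'[OF amp[OF t] f(2) v refl refl, of r] f(1) f(7)[OF v] v
        by (simp add: a_def c_def d_def)
    qed
  qed
qed

lemma Bd_half_pair:
  assumes Z: "Z = {} \<or> Z = {..<H}" and K: "K \<subseteq> {0..<n} - {j}" and j: "j \<in> {0..<n}" and x: "x \<in> pair H j"
  shows "v = mate H x \<Longrightarrow> ((\<lambda>t. rate (AB t) (BB t) (insert x (st Z K)) v) \<longlongrightarrow> r) (at_right 0)"
    and "((\<lambda>t. rate (AB t) (BB t) (insert x (st Z K)) x) \<longlongrightarrow> 1) (at_right 0)"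
    and "i \<in> {0..<n} \<Longrightarrow> i \<noteq> j \<Longrightarrow> v \<in> pair H i \<Longrightarrow> ((\<lambda>t. rate (AB t) (BB t) (insert x (st Z K)) v) \<longlongrightarrow> 0) (at_right 0)"
proof -
  have ZH: "Z \<subseteq> {..<H}" using Z by auto
  note f = half_state_facts[OF ZH K j x refl, unfolded mult_0_right add_0_right]
  have l0: "((\<lambda>t. c * (t ^ 3 * qh H n t) + d * q1 H t) \<longlongrightarrow> d) (at_right 0)" for c d
    using tendsto_add[OF tendsto_mult[OF tendsto_const[of c] tendsto_mult[OF tendsto_power[OF tendsto_ident_at, of 3] qh_lim[OF H, of n]]]
        tendsto_mult[OF tendsto_const[of d] q1_lim[of H]]] by simp
  have rt: "rate (AB t) (BB t) (insert x (st Z K)) v = (if v \<in> insert x (st Z K) then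
     (real H - card Z) * (t ^ 3 * qh H n t) + (if mate H v \<in> insert x (st Z K) then 0 else q1 H t)
     else r * (card Z * (t ^ 3 * qh H n t) + (if mate H v \<in> insert x (st Z K) then q1 H t else 0)))"
    if t: "0 < t" "t \<le> 1" and v: "v \<in> {H..<H + 2 * n}" for t v
    using amp.rate_Bd_pair'[OF amp[OF t] f(2) v refl, of r] f(1) by simp
  have xP: "x \<in> {H..<H + 2 * n}" and mP: "mate H x \<in> {H..<H + 2 * n}"
    using pair_P1[OF j x] pair_P1[OF j, of "mate H x"] pair_mate[OF x] by auto
  have mm: "mate H (mate H x) = x" using mate_mate pair_ge[OF x] by blast
  show "((\<lambda>t. rate (AB t) (BB t) (insert x (st Z K)) x) \<longlongrightarrow> 1) (at_right 0)"
    by (rule tendsto_on_unit[OF _ l0[of "real H - card Z" 1]]) (use rt[OF _ _ xP] f(6) in simp)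
  show "((\<lambda>t. rate (AB t) (BB t) (insert x (st Z K)) v) \<longlongrightarrow> r) (at_right 0)" if "v = mate H x"
    by (rule tendsto_on_unit[OF _ l0[of "r * card Z" r]]) (use rt[OF _ _ mP] f(6) that mm in \<open>simp add: distrib_left\<close>)
  show "((\<lambda>t. rate (AB t) (BB t) (insert x (st Z K)) v) \<longlongrightarrow> 0) (at_right 0)" if "i \<in> {0..<n}" "i \<noteq> j" "v \<in> pair H i"
    by (rule tendsto_on_unit[OF _ l0[of "if i \<in> K then real H - card Z else r * card Z" 0]])
       (use rt[OF _ _ pair_P1[OF that(1,3)]] f(3)[OF that(3,2)] f(4)[OF that(3,2)] in simp)
qed

lemma Bd_hub_limits:
  assumes K: "K \<subseteq> {0..<n}" and v: "v < H"
  shows "((\<lambda>t. rate (AB t) (BB t) (st {} K) v / t ^ 2) \<longlongrightarrow> 2 * r * card K) (at_right 0)"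
    and "((\<lambda>t. rate (AB t) (BB t) (st {..<H} K) v / t ^ 2) \<longlongrightarrow> 2 * (real n - card K)) (at_right 0)"
proof -
  note f = unit_state_facts[of "{}" H K 0 n, OF empty_subsetI K refl, unfolded mult_0_right add_0_right]
  note g = unit_state_facts[of "{..<H}" H K 0 n, OF order_refl K refl, unfolded mult_0_right add_0_right]
  have "((\<lambda>t. 2 * r * card K * q1 H t) \<longlongrightarrow> 2 * r * card K * 1) (at_right 0)"
    by (intro tendsto_intros q1_lim)
  hence l: "((\<lambda>t. 2 * r * card K * q1 H t) \<longlongrightarrow> 2 * r * card K) (at_right 0)" by simp
  have "rate (AB t) (BB t) (st {} K) v / t ^ 2 = 2 * r * card K * q1 H t" if t: "0 < t" "t \<le> 1" for t
    using amp.rate_Bd_hub'[OF amp[OF t] f(2) v refl refl, of r] f(1,3) f(6)[OF v] t by simp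
  thus "((\<lambda>t. rate (AB t) (BB t) (st {} K) v / t ^ 2) \<longlongrightarrow> 2 * r * card K) (at_right 0)"
    by (rule tendsto_on_unit[OF _ l])
  have "((\<lambda>t. (2 * real n - 2 * card K) * q1 H t + 2 * real n * (t * q2 H t)) \<longlongrightarrow> (2 * real n - 2 * card K) * 1 + 2 * real n * (0 * 1)) (at_right 0)"
    by (intro tendsto_intros q1_lim q2_lim)
  hence l: "((\<lambda>t. (2 * real n - 2 * card K) * q1 H t + 2 * real n * (t * q2 H t)) \<longlongrightarrow> 2 * (real n - card K)) (at_right 0)"
    by simp
  have "rate (AB t) (BB t) (st {..<H} K) v / t ^ 2 = (2 * real n - 2 * card K) * q1 H t + 2 * real n * (t * q2 H t)"
    if t: "0 < t" "t \<le> 1" for t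
  proof -
    have "rate (AB t) (BB t) (st {..<H} K) v = (2 * real n - 2 * card K) * (t ^ 2 * q1 H t) + 2 * real n * (t ^ 3 * q2 H t)"
      using amp.rate_Bd_hub'[OF amp[OF t] g(2) v refl refl, of r] g(1,3) g(6)[OF v] v by simp
    moreover have "(X * (t ^ 2 * q) + Y * (t ^ 3 * q')) / t ^ 2 = X * q + Y * (t * q')" for X Y q q'
      using t by (simp add: field_simps eval_nat_numeral)
    ultimately show ?thesis by (simp only:)
  qed
  thus "((\<lambda>t. rate (AB t) (BB t) (st {..<H} K) v / t ^ 2) \<longlongrightarrow> 2 * (real n - card K)) (at_right 0)"
    by (rule tendsto_on_unit[OF _ l])
qed

end

subsection \<open>Birth-death fixation in the limit\<close>

lemma pair_index: "x \<in> {H + 2 * a..<H + 2 * b} \<Longrightarrow> \<exists>j\<in>{a..<b}. x \<in> pair H j"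
  by (intro bexI[of _ "(x - H) div 2"]) (auto simp: pair_def)

lemma pairs_eq: "(\<Union>j\<in>{a..<b}. pair H j) = {H + 2 * a..<H + 2 * b}"
  using pair_range[of "{a..<b}" a b H] pair_index[of _ H a b] by auto

context amp
begin

lemma sum_cc: "(\<Sum>u<N. cc c0 c1 c2 u) = real H * c0 + 2 * real n * c1 + 2 * real n * c2"
proof -
  have "{..<N} = {..<H} \<union> (P1 \<union> P2)" using N by auto
  hence "(\<Sum>u<N. cc c0 c1 c2 u) = (\<Sum>u\<in>{..<H} \<union> (P1 \<union> P2). cc c0 c1 c2 u)" by (rule arg_cong)
  also have "\<dots> = (\<Sum>u<H. cc c0 c1 c2 u) + (\<Sum>u\<in>P1 \<union> P2. cc c0 c1 c2 u)"
    by (rule sum.union_disjoint) auto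
  also have "(\<Sum>u\<in>P1 \<union> P2. cc c0 c1 c2 u) = (\<Sum>u\<in>P1. cc c0 c1 c2 u) + (\<Sum>u\<in>P2. cc c0 c1 c2 u)"
    by (rule sum.union_disjoint) auto
  also have "(\<Sum>u<H. cc c0 c1 c2 u) = real H * c0" by (simp add: cc_simps)
  also have "(\<Sum>u\<in>P1. cc c0 c1 c2 u) = 2 * real n * c1" by (simp add: cc_simps)
  also have "(\<Sum>u\<in>P2. cc c0 c1 c2 u) = 2 * real n * c2" using N by (simp add: cc_simps)
  finally show ?thesis by simp
qed

lemma wdeg_P1: "u \<in> P1 \<Longrightarrow> wdeg N w u = d1"
proof -
  assume u: "u \<in> P1"
  hence "u < N" using N by auto
  thus ?thesis using u by (subst wdeg_amp) (auto simp: cc_simps)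
qed

lemma wdeg_P2: "u \<in> P2 \<Longrightarrow> wdeg N w u = d2"
  by (subst wdeg_amp) (auto simp: cc_simps)

lemma V_Bd_P1: "(1::real) \<le> r \<Longrightarrow> wgraph.V_Bd N w P1 = 2 * real n * q1 H t / (real H * (t * qh H n t) + 2 * real n * q1 H t + 2 * real n * (t ^ 2 * q2 H t))"
proof -
  assume "1 \<le> r"
  then interpret g: wgraph N w r by (rule wgraph)
  have s: "(\<Sum>u<N. 1 / wdeg N w u) = (\<Sum>u<N. cc (1/dh) (1/d1) (1/d2) u)"
    by (intro sum.cong) (auto simp: wdeg_amp cc_def)
  have "(\<Sum>u\<in>P1. 1 / wdeg N w u) = (\<Sum>u\<in>P1. 1/d1)"
    by (intro sum.cong) (use wdeg_P1 in auto)
  hence "g.V_Bd P1 = (2 * real n * (1/d1)) / (real H * (1/dh) + 2 * real n * (1/d1) + 2 * real n * (1/d2))"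
    unfolding g.V_Bd_def s sum_cc by simp
  also have "\<dots> = (t ^ 2 * (2 * real n * (1/d1))) / (t ^ 2 * (real H * (1/dh) + 2 * real n * (1/d1) + 2 * real n * (1/d2)))"
    using t by simp
  also have "t ^ 2 * (2 * real n * (1/d1)) = 2 * real n * (t ^ 2 / d1)" by simp
  also have "t ^ 2 * (real H * (1/dh) + 2 * real n * (1/d1) + 2 * real n * (1/d2))
     = real H * (t * (t / dh)) + 2 * real n * (t ^ 2 / d1) + 2 * real n * (t ^ 2 * (1 / d2))"
    by (simp add: algebra_simps power2_eq_square)
  also have "1 / d2 = q2 H t" by (simp add: d2_def q2_def add.commute)
  finally show ?thesis unfolding d_quotients .
qed

lemma V_dB_P2: "(1::real) \<le> r \<Longrightarrow> wgraph.V_dB N w P2 = 2 * real n * d2 / (real H * dh + 2 * real n * d1 + 2 * real n * d2)"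
proof -
  assume "1 \<le> r"
  then interpret g: wgraph N w r by (rule wgraph)
  have s: "(\<Sum>u<N. wdeg N w u) = (\<Sum>u<N. cc dh d1 d2 u)"
    by (intro sum.cong) (auto simp: wdeg_amp)
  have "(\<Sum>u\<in>P2. wdeg N w u) = (\<Sum>u\<in>P2. d2)"
    by (intro sum.cong) (use wdeg_P2 in auto)
  thus ?thesis unfolding g.V_dB_def s sum_cc using N by simp
qed

end

context amp_lim
begin

abbreviation "x \<equiv> 1 / r"

lemma Bd_full:
  assumes "((\<lambda>t. fixation N (trans_Bd N (w t) r) (st {} {0..<n})) \<longlongrightarrow> L) (at_right 0)"
  shows "1 \<le> L"
proof -
  have st: "st {} {0..<n} = {H..<H + 2 * n}" using pairs_eq[of H 0 n] by (simp add: unit_state_def)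
  have sub: "{H..<H + 2 * n} \<subseteq> {..<N}" using N by auto
  let ?V = "\<lambda>t. 2 * real n * q1 H t / (real H * (t * qh H n t) + 2 * real n * q1 H t + 2 * real n * (t ^ 2 * q2 H t))"
  have "(?V \<longlongrightarrow> 2 * real n * 1 / (real H * (0 * (1 / (real H - 1))) + 2 * real n * 1 + 2 * real n * (0 ^ 2 * 1))) (at_right 0)"
    using n by (intro tendsto_intros q1_lim q2_lim qh_lim[OF H]) auto
  hence l: "(?V \<longlongrightarrow> 1) (at_right 0)" using n by simp
  have "?V t \<le> fixation N (trans_Bd N (w t) r) (st {} {0..<n})" if t: "0 < t" "t \<le> 1" for t
    using wgraph.fixation_ge_V_Bd[OF wg[OF t] sub] unfolding amp.V_Bd_P1[OF amp[OF t] r] st .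
  hence "eventually (\<lambda>t. ?V t \<le> fixation N (trans_Bd N (w t) r) (st {} {0..<n})) (at_right 0)"
    by (auto simp: eventually_at_right[of 0 1] intro!: exI[of _ 1])
  from tendsto_le[OF _ assms l this] show ?thesis by simp
qed

lemma dB_full:
  assumes "((\<lambda>t. fixation N (trans_dB N (w t) r) (st {} {n..<2 * n})) \<longlongrightarrow> L) (at_right 0)"
  shows "1 \<le> L"
proof -
  have st: "st {} {n..<2 * n} = {H + 2 * n..<N}" using pairs_eq[of H n "2 * n"] N by (simp add: unit_state_def)
  have sub: "{H + 2 * n..<N} \<subseteq> {..<N}" by auto
  have d: "amp.dh H n t = real (H - 1) * t + real (2 * n) * t ^ 4 + real (2 * n) * t ^ 3"
     "amp.d1 H t = real H * t ^ 4 + t ^ 2" "amp.d2 H t = real H * t ^ 3 + 1" if t: "0 < t" "t \<le> 1" for t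
    using amp.dh_def[OF amp[OF t]] amp.d1_def[OF amp[OF t]] amp.d2_def[OF amp[OF t]] by auto
  let ?W = "\<lambda>t. 2 * real n * (real H * t ^ 3 + 1) / (real H * (real (H - 1) * t + real (2 * n) * t ^ 4 + real (2 * n) * t ^ 3) + 2 * real n * (real H * t ^ 4 + t ^ 2) + 2 * real n * (real H * t ^ 3 + 1))"
  have l: "(?W \<longlongrightarrow> 1) (at_right 0)" using n by (auto intro!: tendsto_eq_intros)
  have "?W t \<le> fixation N (trans_dB N (w t) r) (st {} {n..<2 * n})" if t: "0 < t" "t \<le> 1" for t
    using wgraph.fixation_ge_V_dB[OF wg[OF t] sub] unfolding amp.V_dB_P2[OF amp[OF t] r] st d[OF t] .
  hence "eventually (\<lambda>t. ?W t \<le> fixation N (trans_dB N (w t) r) (st {} {n..<2 * n})) (at_right 0)"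
    by (auto simp: eventually_at_right[of 0 1] intro!: exI[of _ 1])
  from tendsto_le[OF _ assms l this] show ?thesis by simp
qed

lemma Bd_pair_limits:
  assumes Z: "Z \<subseteq> {..<H}" and K: "K \<subseteq> {0..<n}" and j: "j \<in> {0..<n}" and v: "v \<in> pair H j"
    and X: "X = (if j \<in> K then real H - card Z else r * card Z)"
  shows "((\<lambda>t. rate (AB t) (BB t) (st Z K) v / t) \<longlongrightarrow> 0) (at_right 0)"
    and "((\<lambda>t. rate (AB t) (BB t) (st Z K) v / t ^ 3) \<longlongrightarrow> X / (real H - 1)) (at_right 0)"
proof -
  have l: "((\<lambda>t. X * qh H n t) \<longlongrightarrow> X / (real H - 1)) (at_right 0)"
    using tendsto_mult[OF tendsto_const[of X] qh_lim[OF H, of n]] by simp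
  have l2: "((\<lambda>t. t ^ 2 * (X * qh H n t)) \<longlongrightarrow> 0) (at_right 0)"
    using tendsto_mult[OF tendsto_power[OF tendsto_ident_at, of 2] l] by simp
  have e: "rate (AB t) (BB t) (st Z K) v = t ^ 3 * (X * qh H n t)" if t: "0 < t" "t \<le> 1" for t
    using Bd_pair_rate[OF Z K j v t] unfolding X by simp
  have "rate (AB t) (BB t) (st Z K) v / t ^ 3 = X * qh H n t" if t: "0 < t" "t \<le> 1" for t
    unfolding e[OF t] using t by simp
  thus "((\<lambda>t. rate (AB t) (BB t) (st Z K) v / t ^ 3) \<longlongrightarrow> X / (real H - 1)) (at_right 0)"
    by (rule tendsto_on_unit[OF _ l])
  have "rate (AB t) (BB t) (st Z K) v / t = t ^ 2 * (X * qh H n t)" if t: "0 < t" "t \<le> 1" for t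
    unfolding e[OF t] using t by (simp add: power3_eq_cube power2_eq_square)
  thus "((\<lambda>t. rate (AB t) (BB t) (st Z K) v / t) \<longlongrightarrow> 0) (at_right 0)"
    by (rule tendsto_on_unit[OF _ l2])
qed

lemma Bd_limit_bound:
  assumes lim: "\<And>S. S \<subseteq> {..<N} \<Longrightarrow> ((\<lambda>t. fixation N (trans_Bd N (w t) r) S) \<longlongrightarrow> h0 S) (at_right 0)"
    and v: "v \<in> {H..<H + 2 * n}"
  shows "1 / 2 / (\<Sum>i<n. (x ^ (H + 2)) ^ i) \<le> h0 {v}"
proof -
  let ?A0 = "\<lambda>Z (_::nat). r * card Z / (real H - 1)" and ?B0 = "\<lambda>Z (_::nat). (real H - card Z) / (real H - 1)"
  define W where "W = (\<Sum>i<H. x ^ i)"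
  have x0: "0 < x" using r by simp
  have W: "0 < W" unfolding W_def using x0 H by (intro sum_pos) (auto simp: lessThan_empty_iff)
  have c: "0 < real H - 1" by (rule c_pos)
  interpret hub_pairs N n AB BB "\<lambda>t. fixation N (trans_Bd N (w t) r)" h0 "{..<H}" "{0..<n}" "pair H"
    ?A0 ?B0 "\<lambda>Z. (\<Sum>i<card Z. x ^ i) / W" r 1 "2 * r" 2 "r * H / (real H - 1)" "H / (real H - 1)"
    "1 / W" "x ^ (H - 1) / W" "x ^ (H + 2)" "unit_state H"
  proof (rule hub_pairs.intro)
    show "unit_state H = (\<lambda>Z K. Z \<union> \<Union> (pair H ` K))" by (simp add: fun_eq_iff unit_state_def)
    show "attractive_spins {..<N} (AB t) (BB t)" if "0 < t" "t \<le> 1" for t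
      by (rule wgraph.spins_Bd[OF wg[OF that]])
    show "attractive_spins.harmonic {..<N} (AB t) (BB t) (fixation N (trans_Bd N (w t) r))" if "0 < t" "t \<le> 1" for t
      by (rule wgraph.harmonic_Bd[OF wg[OF that]])
    show "((\<lambda>t. fixation N (trans_Bd N (w t) r) S) \<longlongrightarrow> h0 S) (at_right 0)" if "S \<subseteq> {..<N}" for S by (rule lim[OF that])
    show "{..<H} \<subseteq> {..<N}" "{..<H} \<noteq> {}" "finite {0..<n}" "card {0..<n} = n" "{0..<n} \<noteq> {}"
      using N H n by (auto simp: lessThan_empty_iff)
    show "pair H j \<subseteq> {..<N}" if "j \<in> {0..<n}" for j
      using pair_range[of "{j}" 0 n H] that N by (auto simp: subset_iff)
    show "card (pair H j) = 2" for j by (rule card_pair)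
    show "pair H j \<inter> {..<H} = {}" for j by (rule pair_hub)
    show "pair H i \<inter> pair H j = {}" if "i \<noteq> j" for i j by (rule pair_disjoint[OF that])
    show "((\<lambda>t. (rate (AB t) (BB t) (st Z K) v - rate ?A0 ?B0 Z v) / t) \<longlongrightarrow> 0) (at_right 0)"
      if "Z \<subset> {..<H}" "Z \<noteq> {}" "K \<subseteq> {0..<n}" "v \<in> {..<H}" for Z K v
      by (rule Bd_hub_rate[OF that])
    show "((\<lambda>t. rate (AB t) (BB t) (st Z K) v / t) \<longlongrightarrow> 0) (at_right 0)"
      if "Z \<subset> {..<H}" "K \<subseteq> {0..<n}" "j \<in> {0..<n}" "v \<in> pair H j" for Z K j v
      by (rule Bd_pair_limits(1)[OF psubset_imp_subset[OF that(1)] that(2-4) refl])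
    show "((\<lambda>t. rate (AB t) (BB t) (insert y (st Z K)) v) \<longlongrightarrow> r) (at_right 0)"
      if "Z = {} \<or> Z = {..<H}" "K \<subseteq> {0..<n} - {j}" "j \<in> {0..<n}" "pair H j = {y, v}" "y \<noteq> v" for Z K j y v
      by (rule Bd_half_pair(1)[OF that(1-3) _ conjunct1[OF pair_eq_mate[OF that(4,5)]]]) (simp add: that(4))
    show "((\<lambda>t. rate (AB t) (BB t) (insert y (st Z K)) y) \<longlongrightarrow> 1) (at_right 0)"
      if "Z = {} \<or> Z = {..<H}" "K \<subseteq> {0..<n} - {j}" "j \<in> {0..<n}" "pair H j = {y, v}" for Z K j y v
      by (rule Bd_half_pair(2)[OF that(1-3)]) (simp add: that(4))
    show "((\<lambda>t. rate (AB t) (BB t) (insert y (st Z K)) v) \<longlongrightarrow> 0) (at_right 0)"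
      if "Z = {} \<or> Z = {..<H}" "K \<subseteq> {0..<n} - {j}" "j \<in> {0..<n}" "y \<in> pair H j" "v \<in> st {..<H} {0..<n} - pair H j" for Z K j y v
    proof (cases "v < H")
      case True thus ?thesis by (rule Bd_half_hub[OF that(1-4)])
    next
      case False
      hence "v \<in> (\<Union>i\<in>{0..<n}. pair H i)" using that(5) by (simp add: unit_state_def)
      then obtain i where i: "i \<in> {0..<n}" "v \<in> pair H i" by (rule UN_E)
      hence "i \<noteq> j" using that(5) by auto
      thus ?thesis using Bd_half_pair(3)[OF that(1-4) i(1) _ i(2)] by blast
    qed
    show "((\<lambda>t. rate (AB t) (BB t) (st {} K) v / t ^ 2) \<longlongrightarrow> 2 * r * real (card K)) (at_right 0)"
      if "K \<subseteq> {0..<n}" "v \<in> {..<H}" for K v by (rule Bd_hub_limits(1)[OF that(1)]) (use that(2) in simp)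
    show "((\<lambda>t. rate (AB t) (BB t) (st {..<H} K) v / t ^ 2) \<longlongrightarrow> 2 * (real n - real (card K))) (at_right 0)"
      if "K \<subseteq> {0..<n}" "v \<in> {..<H}" for K v by (rule Bd_hub_limits(2)[OF that(1)]) (use that(2) in simp)
    show "((\<lambda>t. rate (AB t) (BB t) (st {} K) v / t ^ 3) \<longlongrightarrow> real H / (real H - 1)) (at_right 0)"
      if "K \<subseteq> {0..<n}" "j \<in> K" "v \<in> pair H j" for K j v
      by (rule Bd_pair_limits(2)[OF empty_subsetI that(1) _ that(3)]) (use that in auto)
    show "rate (AB t) (BB t) (st {} K) v = 0"
      if "K \<subseteq> {0..<n}" "j \<in> {0..<n} - K" "v \<in> pair H j" "0 < t" "t \<le> 1" for K j v t
      using Bd_pair_rate[OF empty_subsetI that(1) _ that(3,4,5)] that by auto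
    show "((\<lambda>t. rate (AB t) (BB t) (st {..<H} K) v / t ^ 3) \<longlongrightarrow> r * real H / (real H - 1)) (at_right 0)"
      if "K \<subseteq> {0..<n}" "j \<in> {0..<n} - K" "v \<in> pair H j" for K j v
      by (rule Bd_pair_limits(2)[OF order_refl that(1) _ that(3)]) (use that in auto)
    show "rate (AB t) (BB t) (st {..<H} K) v = 0"
      if "K \<subseteq> {0..<n}" "j \<in> K" "v \<in> pair H j" "0 < t" "t \<le> 1" for K j v t
      using Bd_pair_rate[OF order_refl that(1) _ that(3,4,5)] that by auto
    show "1 \<le> h0 (st {} {0..<n})"
      by (rule Bd_full[OF lim]) (use pairs_eq[of H 0 n] N in \<open>auto simp: unit_state_def\<close>)
    show "0 < ?A0 Z v" if "Z \<subset> {..<H}" "Z \<noteq> {}" for Z and v :: nat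
      using that c r finite_subset[of Z "{..<H}"] by (auto simp: card_gt_0_iff intro!: divide_pos_pos mult_pos_pos)
    show "0 \<le> ?A0 Z v" for Z and v :: nat using c r by simp
    show "0 \<le> ?B0 Z v" if "Z \<subseteq> {..<H}" for Z and v :: nat
      using c card_mono[OF _ that] by (auto intro!: divide_nonneg_pos)
    show "gen {..<H} ?A0 ?B0 (\<lambda>Z. (\<Sum>i<card Z. x ^ i) / W) Z = 0" if "Z \<subset> {..<H}" "Z \<noteq> {}" for Z
      by (rule clique_harmonic[where \<alpha> = "\<lambda>k. r * k / (real H - 1)" and \<beta> = "\<lambda>k. (real H - k) / (real H - 1)"])
         (use that balance_Bd[of r _ H] r in auto)
    show "(\<Sum>i<card {}. x ^ i) / W = 0" "(\<Sum>i<card {..<H}. x ^ i) / W = 1" using W by (auto simp: W_def)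
    show "(\<Sum>i<card {v}. x ^ i) / W = 1 / W" for v :: nat by simp
    show "(\<Sum>i<card ({..<H} - {v}). x ^ i) / W = 1 - x ^ (H - 1) / W" if "v \<in> {..<H}" for v
    proof -
      obtain k where k: "H = Suc k" using H by (cases H) auto
      have "(\<Sum>i<card ({..<H} - {v}). x ^ i) = W - x ^ (H - 1)" using that by (simp add: W_def k)
      thus ?thesis using W by (simp add: diff_divide_distrib)
    qed
    show "0 < r" "0 < (1::real)" "0 < 2 * r" "0 < (2::real)" "0 < r * real H / (real H - 1)" "0 < real H / (real H - 1)"
      "0 < 1 / W" "0 < x ^ (H - 1) / W" "0 < x ^ (H + 2)" using r c W H by auto
    show "x ^ (H + 2) * (2 * r * (1 / W) * (r * real H / (real H - 1)) * r) = 2 * (x ^ (H - 1) / W) * (real H / (real H - 1)) * 1"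
    proof -
      obtain k where k: "H = Suc k" using H by (cases H) auto
      have "x ^ (H + 2) * (r * r * r) = x ^ (H - 1)" using r by (simp add: k power_add eval_nat_numeral power_divide)
      moreover have "X * (2 * r * (1 / W) * (r * h / c) * r) = X * (r * r * r) * (2 * h / c / W)" for X h c
        by (simp add: mult_ac)
      moreover have "2 * (X / W) * (h / c) * 1 = X * (2 * h / c / W)" for X h c by (simp add: mult_ac)
      ultimately show ?thesis by (simp only:)
    qed
  qed
  obtain j where "j \<in> {0..<n}" "v \<in> pair H j" using pair_index[of v H 0 n] v by auto
  from single_mutant_bound[OF this] have 1: "r / (r + 1) / (\<Sum>i<n. (x ^ (H + 2)) ^ i) \<le> h0 {v}" .
  have "1 / 2 \<le> r / (r + 1)" using r by (simp add: field_simps)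
  hence "1 / 2 / (\<Sum>i<n. (x ^ (H + 2)) ^ i) \<le> r / (r + 1) / (\<Sum>i<n. (x ^ (H + 2)) ^ i)"
    using x0 by (intro divide_right_mono sum_nonneg) auto
  thus ?thesis using 1 by linarith
qed

end

subsection \<open>Death-Birth fixation in the limit\<close>

context amp_lim
begin

definition A0d :: "nat set \<Rightarrow> nat \<Rightarrow> real" where
  "A0d Z v = r * card Z / (r * card Z + (real H - 1 - card Z))"
definition B0d :: "nat set \<Rightarrow> nat \<Rightarrow> real" where
  "B0d Z v = (real H - card Z) / (r * (real (card Z) - 1) + (real H - card Z))"

lemma dB_hub_rate:
  assumes "Z \<subset> {..<H}" "Z \<noteq> {}" "K \<subseteq> {n..<2 * n}" "v \<in> {..<H}"
  shows "((\<lambda>t. (rate (Ad t) (Bd t) (st Z K) v - rate A0d B0d Z v) / t) \<longlongrightarrow> 0) (at_right 0)"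
proof -
  have Z: "Z \<subseteq> {..<H}" using assms by auto
  have v: "v < H" using assms by auto
  have N': "H + 2 * (2 * n) = N" using N by simp
  note f = unit_state_facts[OF Z assms(3) refl, unfolded N']
  let ?z = "real (card Z)" and ?a = "real (2 * card K)"
  have fZ: "finite Z" using Z finite_subset by blast
  have z1: "1 \<le> ?z" using fZ assms(2) by (simp add: Suc_leI card_gt_0_iff)
  have zH: "?z \<le> real H - 1" using psubset_card_mono[OF _ assms(1)] by simp
  show ?thesis
  proof (cases "v \<in> Z")
    case True
    have s0: "r * (?z - 1) + (real H - ?z) \<noteq> 0" using r z1 zH mult_nonneg_nonneg[of r "?z - 1"] by linarith
    let ?g = "\<lambda>t. (((real H - ?z) + (2 * real n - ?a) * t ^ 2 + 2 * real n * t ^ 3)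
       / ((r * (?z - 1) + (real H - ?z)) + (r * ?a + (2 * real n - ?a)) * t ^ 2 + 2 * real n * t ^ 3) - (real H - ?z) / (r * (?z - 1) + (real H - ?z))) / t"
    have l: "(?g \<longlongrightarrow> 0) (at_right 0)" by (rule flat_quotient[OF s0])
    show ?thesis
    proof (rule tendsto_on_unit[OF _ l])
      fix t :: real assume t: "0 < t" "t \<le> 1"
      have vS: "v \<in> st Z K" using f(6)[OF v] True by simp
      show "(rate (Ad t) (Bd t) (st Z K) v - rate A0d B0d Z v) / t = ?g t"
        unfolding amp.rate_dB_hub'(2)[OF amp[OF t] f(2) v refl refl vS] f(1) f(3) using True by (simp only: rate_def B0d_def if_True)
    qed
  next
    case False
    have s0: "r * ?z + (real H - 1 - ?z) \<noteq> 0" using r z1 zH mult_pos_pos[of r ?z] by linarith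
    let ?g = "\<lambda>t. ((r * ?z + (r * ?a) * t ^ 2 + 0 * t ^ 3)
       / ((r * ?z + (real H - 1 - ?z)) + (r * ?a + (2 * real n - ?a)) * t ^ 2 + 2 * real n * t ^ 3) - r * ?z / (r * ?z + (real H - 1 - ?z))) / t"
    have l: "(?g \<longlongrightarrow> 0) (at_right 0)" by (rule flat_quotient[OF s0])
    show ?thesis
    proof (rule tendsto_on_unit[OF _ l])
      fix t :: real assume t: "0 < t" "t \<le> 1"
      have vS: "v \<notin> st Z K" using f(6)[OF v] False by simp
      show "(rate (Ad t) (Bd t) (st Z K) v - rate A0d B0d Z v) / t = ?g t"
        unfolding amp.rate_dB_hub'(1)[OF amp[OF t] f(2) v refl refl vS] f(1) f(3) using False by (simp only: rate_def A0d_def if_False)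
    qed
  qed
qed

lemma dB_pair_rate:
  assumes Z: "Z \<subseteq> {..<H}" and K: "K \<subseteq> {n..<2 * n}" and j: "j \<in> {n..<2 * n}" and v: "v \<in> pair H j" and t: "0 < t" "t \<le> 1"
  shows "rate (Ad t) (Bd t) (st Z K) v = t ^ 3 * ((if j \<in> K then real H - card Z else r * card Z) /
     ((if j \<in> K then r else 1) + (r * card Z + (real H - card Z)) * t ^ 3))"
proof -
  have N': "H + 2 * (2 * n) = N" using N by simp
  note f = unit_state_facts[OF Z K refl, unfolded N']
  have v': "v \<in> {H + 2 * n..<N}" by (rule pair_P2[OF j v])
  show ?thesis using amp.rate_dB_pair[OF amp[OF t] f(2) v' refl refl refl, of r] f(1) f(4,5)[OF v] by (simp add: algebra_simps)
qed

lemma dB_pair_limits: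
  assumes Z: "Z \<subseteq> {..<H}" and K: "K \<subseteq> {n..<2 * n}" and j: "j \<in> {n..<2 * n}" and v: "v \<in> pair H j"
    and X: "X = (if j \<in> K then real H - card Z else r * card Z)" and Y: "Y = (if j \<in> K then r else 1)"
  shows "((\<lambda>t. rate (Ad t) (Bd t) (st Z K) v / t) \<longlongrightarrow> 0) (at_right 0)"
    and "((\<lambda>t. rate (Ad t) (Bd t) (st Z K) v / t ^ 3) \<longlongrightarrow> X / Y) (at_right 0)"
proof -
  define C where "C = r * card Z + (real H - card Z)"
  have Y0: "Y \<noteq> 0" using r by (simp add: Y)
  have "((\<lambda>t. X / (Y + C * t ^ 3)) \<longlongrightarrow> X / (Y + C * 0 ^ 3)) (at_right 0)"
    using Y0 by (intro tendsto_intros) auto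
  hence l: "((\<lambda>t. X / (Y + C * t ^ 3)) \<longlongrightarrow> X / Y) (at_right 0)" by simp
  have l2: "((\<lambda>t. t ^ 2 * (X / (Y + C * t ^ 3))) \<longlongrightarrow> 0) (at_right 0)"
    using tendsto_mult[OF tendsto_power[OF tendsto_ident_at, of 2] l] by simp
  have e: "rate (Ad t) (Bd t) (st Z K) v = t ^ 3 * (X / (Y + C * t ^ 3))" if t: "0 < t" "t \<le> 1" for t
    using dB_pair_rate[OF Z K j v t] unfolding X Y C_def .
  have "rate (Ad t) (Bd t) (st Z K) v / t ^ 3 = X / (Y + C * t ^ 3)" if t: "0 < t" "t \<le> 1" for t
    unfolding e[OF t] using t by simp
  thus "((\<lambda>t. rate (Ad t) (Bd t) (st Z K) v / t ^ 3) \<longlongrightarrow> X / Y) (at_right 0)"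
    by (rule tendsto_on_unit[OF _ l])
  have "rate (Ad t) (Bd t) (st Z K) v / t = t ^ 2 * (X / (Y + C * t ^ 3))" if t: "0 < t" "t \<le> 1" for t
  proof -
    have "t ^ 3 * q / t = t ^ 2 * q" for q using t by (simp add: power3_eq_cube power2_eq_square)
    thus ?thesis unfolding e[OF t] .
  qed
  thus "((\<lambda>t. rate (Ad t) (Bd t) (st Z K) v / t) \<longlongrightarrow> 0) (at_right 0)"
    by (rule tendsto_on_unit[OF _ l2])
qed

lemma dB_half_hub:
  assumes Z: "Z = {} \<or> Z = {..<H}" and K: "K \<subseteq> {n..<2 * n} - {j}" and j: "j \<in> {n..<2 * n}" and y: "y \<in> pair H j" and v: "v < H"
  shows "((\<lambda>t. rate (Ad t) (Bd t) (insert y (st Z K)) v) \<longlongrightarrow> 0) (at_right 0)"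
proof -
  have ZH: "Z \<subseteq> {..<H}" using Z by auto
  have N': "H + 2 * (2 * n) = N" using N by simp
  note f = half_state_facts[OF ZH K j y refl, unfolded N']
  define a where "a = real (card (insert y (st Z K) \<inter> {H + 2 * n..<N}))"
  show ?thesis using Z
  proof
    assume Ze: "Z = {}"
    let ?g = "\<lambda>t. (r * real 0 + (r * a) * t ^ 2 + 0 * t ^ 3) / ((r * real 0 + (real H - 1 - real 0)) + (r * a + (2 * real n - a)) * t ^ 2 + 2 * real n * t ^ 3)"
    have l: "(?g \<longlongrightarrow> 0) (at_right 0)" using c_pos by (auto intro!: tendsto_eq_intros)
    have vS: "v \<notin> insert y (st Z K)" using f(7)[OF v] Ze by simp
    have cZ: "card Z = 0" using Ze by simp
    show ?thesis
      by (rule tendsto_on_unit[OF _ l])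
         (simp only: amp.rate_dB_hub'(1)[OF amp f(2) v refl refl vS] f(1) cZ a_def[symmetric])
  next
    assume Ze: "Z = {..<H}"
    let ?g = "\<lambda>t. ((real H - real H) + (2 * real n - a) * t ^ 2 + 2 * real n * t ^ 3) / ((r * (real H - 1) + (real H - real H)) + (r * a + (2 * real n - a)) * t ^ 2 + 2 * real n * t ^ 3)"
    have l: "(?g \<longlongrightarrow> 0) (at_right 0)" using c_pos r by (auto intro!: tendsto_eq_intros)
    have vS: "v \<in> insert y (st Z K)" using f(7)[OF v] Ze v by simp
    have cZ: "card Z = H" using Ze by simp
    show ?thesis
      by (rule tendsto_on_unit[OF _ l])
         (simp only: amp.rate_dB_hub'(2)[OF amp f(2) v refl refl vS] f(1) cZ a_def[symmetric])
  qed
qed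

lemma dB_half_pair:
  assumes Z: "Z = {} \<or> Z = {..<H}" and K: "K \<subseteq> {n..<2 * n} - {j}" and j: "j \<in> {n..<2 * n}" and y: "y \<in> pair H j"
  shows "v = mate H y \<Longrightarrow> ((\<lambda>t. rate (Ad t) (Bd t) (insert y (st Z K)) v) \<longlongrightarrow> 1) (at_right 0)"
    and "((\<lambda>t. rate (Ad t) (Bd t) (insert y (st Z K)) y) \<longlongrightarrow> 1) (at_right 0)"
    and "i \<in> {n..<2 * n} \<Longrightarrow> i \<noteq> j \<Longrightarrow> v \<in> pair H i \<Longrightarrow> ((\<lambda>t. rate (Ad t) (Bd t) (insert y (st Z K)) v) \<longlongrightarrow> 0) (at_right 0)"
proof -
  have ZH: "Z \<subseteq> {..<H}" using Z by auto
  have N': "H + 2 * (2 * n) = N" using N by simp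
  note f = half_state_facts[OF ZH K j y refl, unfolded N']
  let ?z = "real (card Z)" and ?S = "insert y (st Z K)"
  let ?M = "\<lambda>v t. ?z * t ^ 3 + (if mate H v \<in> ?S then 1 else 0)"
  let ?R = "\<lambda>v t. (real H - ?z) * t ^ 3 + (if mate H v \<in> ?S then 0 else 1)"
  have rt: "rate (Ad t) (Bd t) ?S v = (if v \<in> ?S then ?R v t else r * ?M v t) / (r * ?M v t + ?R v t)"
    if t: "0 < t" "t \<le> 1" and v: "v \<in> {H + 2 * n..<N}" for t v
    using amp.rate_dB_pair[OF amp[OF t] f(2) v refl refl refl, of r] unfolding f(1) .
  have lM: "(?M v \<longlongrightarrow> (if mate H v \<in> ?S then 1 else 0)) (at_right 0)" for v
    by (cases "mate H v \<in> ?S"; simp only: if_True if_False; rule tendsto_eq_intros refl | simp)+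
  have lR: "(?R v \<longlongrightarrow> (if mate H v \<in> ?S then 0 else 1)) (at_right 0)" for v
    by (cases "mate H v \<in> ?S"; simp only: if_True if_False; rule tendsto_eq_intros refl | simp)+
  define m where "m v = (if mate H v \<in> ?S then 1 else 0 :: real)" for v
  have mR: "(if mate H v \<in> ?S then 0 else 1) = 1 - m v" for v by (simp add: m_def)
  have pos: "r * m v + (1 - m v) \<noteq> 0" for v using r by (simp add: m_def)
  have L: "((\<lambda>t. rate (Ad t) (Bd t) ?S v) \<longlongrightarrow> (if v \<in> ?S then 1 - m v else r * m v) / (r * m v + (1 - m v))) (at_right 0)"
    if v: "v \<in> {H + 2 * n..<N}" for v
  proof -
    have lM': "(?M v \<longlongrightarrow> m v) (at_right 0)" using lM[of v] by (simp only: m_def)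
    have lR': "(?R v \<longlongrightarrow> 1 - m v) (at_right 0)" using lR[of v] by (simp only: mR[symmetric])
    have "((\<lambda>t. (if v \<in> ?S then ?R v t else r * ?M v t) / (r * ?M v t + ?R v t)) \<longlongrightarrow> (if v \<in> ?S then 1 - m v else r * m v) / (r * m v + (1 - m v))) (at_right 0)"
    proof (cases "v \<in> ?S")
      case True
      show ?thesis unfolding if_P[OF True]
        by (rule tendsto_divide[OF lR' tendsto_add[OF tendsto_mult[OF tendsto_const lM'] lR'] pos])
    next
      case False
      show ?thesis unfolding if_not_P[OF False]
        by (rule tendsto_divide[OF tendsto_mult[OF tendsto_const lM'] tendsto_add[OF tendsto_mult[OF tendsto_const lM'] lR'] pos])
    qed
    note * = this
    show ?thesis by (rule tendsto_on_unit[OF _ *]) (rule rt[OF _ _ v])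
  qed
  have mx: "mate H y \<in> pair H j" using pair_mate[OF y] by blast
  have mm: "mate H (mate H y) = y" using mate_mate pair_ge[OF y] by blast
  have "m y = 0" using f(6) by (simp add: m_def)
  thus "((\<lambda>t. rate (Ad t) (Bd t) ?S y) \<longlongrightarrow> 1) (at_right 0)" using L[OF pair_P2[OF j y]] by simp
  show "((\<lambda>t. rate (Ad t) (Bd t) ?S v) \<longlongrightarrow> 1) (at_right 0)" if v: "v = mate H y"
  proof -
    have "m v = 1" "v \<notin> ?S" using f(6) by (simp_all add: m_def v mm)
    thus ?thesis using L[OF pair_P2[OF j mx]] r v by simp
  qed
  show "((\<lambda>t. rate (Ad t) (Bd t) ?S v) \<longlongrightarrow> 0) (at_right 0)" if i: "i \<in> {n..<2 * n}" "i \<noteq> j" "v \<in> pair H i"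
  proof -
    have "v \<in> ?S \<longleftrightarrow> mate H v \<in> ?S" using f(3)[OF i(3,2)] f(4)[OF i(3,2)] by simp
    hence "(if v \<in> ?S then 1 - m v else r * m v) = 0" by (simp add: m_def)
    thus ?thesis using L[OF pair_P2[OF i(1,3)]] by simp
  qed
qed

lemma dB_hub_limits:
  assumes K: "K \<subseteq> {n..<2 * n}" and v: "v < H"
  shows "((\<lambda>t. rate (Ad t) (Bd t) (st {} K) v / t ^ 2) \<longlongrightarrow> 2 * r / (real H - 1) * card K) (at_right 0)"
    and "((\<lambda>t. rate (Ad t) (Bd t) (st {..<H} K) v / t ^ 2) \<longlongrightarrow> 2 / (r * (real H - 1)) * (real n - card K)) (at_right 0)"
proof -
  have N': "H + 2 * (2 * n) = N" using N by simp
  note f = unit_state_facts[of "{}" H, OF empty_subsetI K refl, unfolded N']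
  note g = unit_state_facts[of "{..<H}" H, OF order_refl K refl, unfolded N']
  let ?a = "real (2 * card K)"
  let ?g = "\<lambda>t. (r * ?a) / ((r * real 0 + (real H - 1 - real 0)) + (r * ?a + (2 * real n - ?a)) * t ^ 2 + 2 * real n * t ^ 3)"
  have l: "(?g \<longlongrightarrow> 2 * r / (real H - 1) * card K) (at_right 0)"
    using c_pos by (auto intro!: tendsto_eq_intros)
  have vS: "v \<notin> st {} K" using f(6)[OF v] by simp
  have "rate (Ad t) (Bd t) (st {} K) v / t ^ 2 = ?g t" if t: "0 < t" "t \<le> 1" for t
  proof -
    have "(r * real 0 + X * t ^ 2 + 0 * t ^ 3) / Y / t ^ 2 = X / Y" for X Y using t by simp
    thus ?thesis unfolding amp.rate_dB_hub'(1)[OF amp[OF t] f(2) v refl refl vS] f(1) f(3) card.empty .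
  qed
  thus "((\<lambda>t. rate (Ad t) (Bd t) (st {} K) v / t ^ 2) \<longlongrightarrow> 2 * r / (real H - 1) * card K) (at_right 0)"
    by (rule tendsto_on_unit[OF _ l])
  let ?k = "\<lambda>t. ((2 * real n - ?a) + 2 * real n * t) / ((r * (real H - 1) + (real H - real H)) + (r * ?a + (2 * real n - ?a)) * t ^ 2 + 2 * real n * t ^ 3)"
  have "(?k \<longlongrightarrow> ((2 * real n - ?a) + 2 * real n * 0) / ((r * (real H - 1) + (real H - real H)) + (r * ?a + (2 * real n - ?a)) * 0 ^ 2 + 2 * real n * 0 ^ 3)) (at_right 0)"
    using c_pos r by (intro tendsto_intros) auto
  moreover have "((2 * real n - ?a) + 2 * real n * 0) / ((r * (real H - 1) + (real H - real H)) + (r * ?a + (2 * real n - ?a)) * 0 ^ 2 + 2 * real n * 0 ^ 3)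
      = 2 / (r * (real H - 1)) * (real n - card K)" by simp
  ultimately have l: "(?k \<longlongrightarrow> 2 / (r * (real H - 1)) * (real n - card K)) (at_right 0)" by (simp only:)
  have vS: "v \<in> st {..<H} K" using g(6)[OF v] v by simp
  have "rate (Ad t) (Bd t) (st {..<H} K) v / t ^ 2 = ?k t" if t: "0 < t" "t \<le> 1" for t
  proof -
    have "((real H - real H) + X * t ^ 2 + Y * t ^ 3) / W / t ^ 2 = (X + Y * t) / W" for X Y W
    proof -
      have "(real H - real H) + X * t ^ 2 + Y * t ^ 3 = (X + Y * t) * t ^ 2" by (simp add: eval_nat_numeral algebra_simps)
      thus ?thesis using t by simp
    qed
    thus ?thesis unfolding amp.rate_dB_hub'(2)[OF amp[OF t] g(2) v refl refl vS] g(1) g(3) card_lessThan .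
  qed
  thus "((\<lambda>t. rate (Ad t) (Bd t) (st {..<H} K) v / t ^ 2) \<longlongrightarrow> 2 / (r * (real H - 1)) * (real n - card K)) (at_right 0)"
    by (rule tendsto_on_unit[OF _ l])
qed

lemma dB_limit_bound:
  assumes lim: "\<And>S. S \<subseteq> {..<N} \<Longrightarrow> ((\<lambda>t. fixation N (trans_dB N (w t) r) S) \<longlongrightarrow> h0 S) (at_right 0)"
    and v: "v \<in> {H + 2 * n..<N}"
  shows "1 / 2 / (\<Sum>i<n. (x ^ (H + 2)) ^ i) \<le> h0 {v}"
proof -
  let ?om = "om_dB H r"
  define W where "W = (\<Sum>i<H. ?om i)"
  have x0: "0 < x" using r by simp
  have c: "0 < real H - 1" by (rule c_pos)
  have om: "0 < ?om i" for i using x0 c r by (auto simp: om_dB_def intro!: mult_pos_pos add_pos_nonneg)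
  have W: "0 < W" unfolding W_def using om H by (intro sum_pos) (auto simp: lessThan_empty_iff)
  have om0: "?om 0 = real H - 1" by (simp add: om_dB_def)
  have om1: "?om (H - 1) = x ^ (H - 1) * (r * (real H - 1))"
    using H by (simp add: om_dB_def of_nat_diff algebra_simps)
  have zH: "real (card Z) \<le> real H - 1" if "Z \<subset> {..<H}" for Z
    using psubset_card_mono[OF _ that] by simp
  have z1: "1 \<le> real (card Z)" if "Z \<subseteq> {..<H}" "Z \<noteq> {}" for Z
    using that finite_subset[of Z "{..<H}"] by (simp add: Suc_leI card_gt_0_iff)
  interpret hub_pairs N n Ad Bd "\<lambda>t. fixation N (trans_dB N (w t) r)" h0 "{..<H}" "{n..<2 * n}" "pair H"
    A0d B0d "\<lambda>Z. (\<Sum>i<card Z. ?om i) / W" 1 1 "2 * r / (real H - 1)" "2 / (r * (real H - 1))" "r * H" "H / r"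
    "?om 0 / W" "?om (H - 1) / W" "x ^ (H + 2)" "unit_state H"
  proof (rule hub_pairs.intro)
    show "unit_state H = (\<lambda>Z K. Z \<union> \<Union> (pair H ` K))" by (simp add: fun_eq_iff unit_state_def)
    show "attractive_spins {..<N} (Ad t) (Bd t)" if "0 < t" "t \<le> 1" for t
      by (rule wgraph.spins_dB[OF wg[OF that]])
    show "attractive_spins.harmonic {..<N} (Ad t) (Bd t) (fixation N (trans_dB N (w t) r))" if "0 < t" "t \<le> 1" for t
      by (rule wgraph.harmonic_dB[OF wg[OF that]])
    show "((\<lambda>t. fixation N (trans_dB N (w t) r) S) \<longlongrightarrow> h0 S) (at_right 0)" if "S \<subseteq> {..<N}" for S by (rule lim[OF that])
    show "{..<H} \<subseteq> {..<N}" "{..<H} \<noteq> {}" "finite {n..<2 * n}" "card {n..<2 * n} = n" "{n..<2 * n} \<noteq> {}"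
      using N H n by (auto simp: lessThan_empty_iff)
    show "pair H j \<subseteq> {..<N}" if "j \<in> {n..<2 * n}" for j
      using pair_range[of "{j}" n "2 * n" H] that N by (auto simp: subset_iff)
    show "card (pair H j) = 2" for j by (rule card_pair)
    show "pair H j \<inter> {..<H} = {}" for j by (rule pair_hub)
    show "pair H i \<inter> pair H j = {}" if "i \<noteq> j" for i j by (rule pair_disjoint[OF that])
    show "((\<lambda>t. (rate (Ad t) (Bd t) (st Z K) v - rate A0d B0d Z v) / t) \<longlongrightarrow> 0) (at_right 0)"
      if "Z \<subset> {..<H}" "Z \<noteq> {}" "K \<subseteq> {n..<2 * n}" "v \<in> {..<H}" for Z K v
      by (rule dB_hub_rate[OF that])
    show "((\<lambda>t. rate (Ad t) (Bd t) (st Z K) v / t) \<longlongrightarrow> 0) (at_right 0)"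
      if "Z \<subset> {..<H}" "K \<subseteq> {n..<2 * n}" "j \<in> {n..<2 * n}" "v \<in> pair H j" for Z K j v
      by (rule dB_pair_limits(1)[OF psubset_imp_subset[OF that(1)] that(2-4) refl refl])
    show "((\<lambda>t. rate (Ad t) (Bd t) (insert y (st Z K)) v) \<longlongrightarrow> 1) (at_right 0)"
      if "Z = {} \<or> Z = {..<H}" "K \<subseteq> {n..<2 * n} - {j}" "j \<in> {n..<2 * n}" "pair H j = {y, v}" "y \<noteq> v" for Z K j y v
      by (rule dB_half_pair(1)[OF that(1-3) _ conjunct1[OF pair_eq_mate[OF that(4,5)]]]) (simp add: that(4))
    show "((\<lambda>t. rate (Ad t) (Bd t) (insert y (st Z K)) y) \<longlongrightarrow> 1) (at_right 0)"
      if "Z = {} \<or> Z = {..<H}" "K \<subseteq> {n..<2 * n} - {j}" "j \<in> {n..<2 * n}" "pair H j = {y, v}" for Z K j y v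
      by (rule dB_half_pair(2)[OF that(1-3)]) (simp add: that(4))
    show "((\<lambda>t. rate (Ad t) (Bd t) (insert y (st Z K)) v) \<longlongrightarrow> 0) (at_right 0)"
      if "Z = {} \<or> Z = {..<H}" "K \<subseteq> {n..<2 * n} - {j}" "j \<in> {n..<2 * n}" "y \<in> pair H j" "v \<in> st {..<H} {n..<2 * n} - pair H j" for Z K j y v
    proof (cases "v < H")
      case True thus ?thesis by (rule dB_half_hub[OF that(1-4)])
    next
      case False
      hence "v \<in> (\<Union>i\<in>{n..<2 * n}. pair H i)" using that(5) by (simp add: unit_state_def)
      then obtain i where i: "i \<in> {n..<2 * n}" "v \<in> pair H i" by (rule UN_E)
      hence "i \<noteq> j" using that(5) by auto
      thus ?thesis using dB_half_pair(3)[OF that(1-4) i(1) _ i(2)] by blast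
    qed
    show "((\<lambda>t. rate (Ad t) (Bd t) (st {} K) v / t ^ 2) \<longlongrightarrow> 2 * r / (real H - 1) * real (card K)) (at_right 0)"
      if "K \<subseteq> {n..<2 * n}" "v \<in> {..<H}" for K v by (rule dB_hub_limits(1)[OF that(1)]) (use that(2) in simp)
    show "((\<lambda>t. rate (Ad t) (Bd t) (st {..<H} K) v / t ^ 2) \<longlongrightarrow> 2 / (r * (real H - 1)) * (real n - real (card K))) (at_right 0)"
      if "K \<subseteq> {n..<2 * n}" "v \<in> {..<H}" for K v by (rule dB_hub_limits(2)[OF that(1)]) (use that(2) in simp)
    show "((\<lambda>t. rate (Ad t) (Bd t) (st {} K) v / t ^ 3) \<longlongrightarrow> real H / r) (at_right 0)"
      if "K \<subseteq> {n..<2 * n}" "j \<in> K" "v \<in> pair H j" for K j v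
      by (rule dB_pair_limits(2)[OF empty_subsetI that(1) _ that(3)]) (use that in auto)
    show "rate (Ad t) (Bd t) (st {} K) v = 0"
      if "K \<subseteq> {n..<2 * n}" "j \<in> {n..<2 * n} - K" "v \<in> pair H j" "0 < t" "t \<le> 1" for K j v t
      using dB_pair_rate[OF empty_subsetI that(1) _ that(3,4,5)] that by auto
    show "((\<lambda>t. rate (Ad t) (Bd t) (st {..<H} K) v / t ^ 3) \<longlongrightarrow> r * real H) (at_right 0)"
      if "K \<subseteq> {n..<2 * n}" "j \<in> {n..<2 * n} - K" "v \<in> pair H j" for K j v
    proof -
      have "((\<lambda>t. rate (Ad t) (Bd t) (st {..<H} K) v / t ^ 3) \<longlongrightarrow> (r * real H) / 1) (at_right 0)"
        by (rule dB_pair_limits(2)[OF order_refl that(1) _ that(3)]) (use that in auto)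
      thus ?thesis by simp
    qed
    show "rate (Ad t) (Bd t) (st {..<H} K) v = 0"
      if "K \<subseteq> {n..<2 * n}" "j \<in> K" "v \<in> pair H j" "0 < t" "t \<le> 1" for K j v t
      using dB_pair_rate[OF order_refl that(1) _ that(3,4,5)] that by auto
    show "1 \<le> h0 (st {} {n..<2 * n})"
      by (rule dB_full[OF lim]) (use pairs_eq[of H n "2 * n"] N in \<open>auto simp: unit_state_def\<close>)
    show "0 < A0d Z v" if "Z \<subset> {..<H}" "Z \<noteq> {}" for Z v
      using zH[OF that(1)] z1[of Z] that r unfolding A0d_def by (intro divide_pos_pos add_pos_nonneg mult_pos_pos) auto
    show "0 \<le> A0d Z v" if "Z \<subseteq> {..<H}" "v \<in> {..<H} - Z" for Z v
    proof -
      have "Z \<subset> {..<H}" using that by auto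
      from zH[OF this] show ?thesis using r unfolding A0d_def by (intro divide_nonneg_nonneg add_nonneg_nonneg mult_nonneg_nonneg) auto
    qed
    show "0 \<le> B0d Z v" if "Z \<subseteq> {..<H}" "v \<in> Z" for Z v
    proof -
      have "real (card Z) \<le> real H" using card_mono[OF _ that(1)] by simp
      moreover have "1 \<le> real (card Z)" using z1[OF that(1)] that(2) by auto
      ultimately show ?thesis using r unfolding B0d_def by (intro divide_nonneg_nonneg add_nonneg_nonneg mult_nonneg_nonneg) auto
    qed
    show "gen {..<H} A0d B0d (\<lambda>Z. (\<Sum>i<card Z. ?om i) / W) Z = 0" if "Z \<subset> {..<H}" "Z \<noteq> {}" for Z
      by (rule clique_harmonic[where \<alpha> = "\<lambda>k. r * k / (r * k + (real H - 1 - k))" and \<beta> = "\<lambda>k. (real H - k) / (r * (real k - 1) + (real H - k))"])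
         (use that balance_dB[OF r, of _ H] in \<open>auto simp: A0d_def B0d_def\<close>)
    show "(\<Sum>i<card {}. ?om i) / W = 0" "(\<Sum>i<card {..<H}. ?om i) / W = 1" using W by (auto simp: W_def)
    show "(\<Sum>i<card {v}. ?om i) / W = ?om 0 / W" for v :: nat by simp
    show "(\<Sum>i<card ({..<H} - {v}). ?om i) / W = 1 - ?om (H - 1) / W" if "v \<in> {..<H}" for v
    proof -
      have "card ({..<H} - {v}) = H - 1" using that by simp
      moreover have "W = (\<Sum>i<H - 1. ?om i) + ?om (H - 1)"
        using H sum.lessThan_Suc[of ?om "H - 1"] by (simp add: W_def)
      ultimately have "(\<Sum>i<card ({..<H} - {v}). ?om i) = W - ?om (H - 1)" by simp
      thus ?thesis using W by (simp add: diff_divide_distrib)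
    qed
    show "0 < (1::real)" "0 < (1::real)" "0 < 2 * r / (real H - 1)" "0 < 2 / (r * (real H - 1))" "0 < r * real H" "0 < real H / r"
      "0 < ?om 0 / W" "0 < ?om (H - 1) / W" "0 < x ^ (H + 2)" using r c W H om by auto
    show "x ^ (H + 2) * (2 * r / (real H - 1) * (?om 0 / W) * (r * real H) * 1) = 2 / (r * (real H - 1)) * (?om (H - 1) / W) * (real H / r) * 1"
    proof -
      obtain k where k: "H = Suc k" using H by (cases H) auto
      have e: "x ^ (H + 2) * (r * r * r) = x ^ (H - 1)" using r by (simp add: k power_add eval_nat_numeral power_divide)
      have *: "X * (2 * r / d * (d / W) * (r * h) * 1) = 2 / (r * d) * (X * (r * r * r) * (r * d) / W) * (h / r) * 1" if "d \<noteq> 0" for X d h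
        using that r W by (simp add: field_simps)
      show ?thesis unfolding om0 om1 e[symmetric] by (rule *) (use c in simp)
    qed
  qed
  obtain j where "j \<in> {n..<2 * n}" "v \<in> pair H j" using pair_index[of v H n "2 * n"] v N by auto
  from single_mutant_bound[OF this] show ?thesis by simp
qed

end

subsection \<open>Uniformity in the fitness\<close>

lemma spins_cls:
  fixes A B :: "real \<times> real \<Rightarrow> nat set \<Rightarrow> nat \<Rightarrow> real"
  assumes spins: "\<And>z. z \<in> pbox \<Longrightarrow> attractive_spins {..<N} (A z) (B z)"
    and harm: "\<And>z. z \<in> pbox \<Longrightarrow> attractive_spins.harmonic {..<N} (A z) (B z) (h z)"
    and A: "\<And>S v. S \<subseteq> {..<N} \<Longrightarrow> v < N \<Longrightarrow> scaled (\<lambda>z. A z S v)"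
    and B: "\<And>S v. S \<subseteq> {..<N} \<Longrightarrow> v < N \<Longrightarrow> scaled (\<lambda>z. B z S v)"
    and S: "S \<subseteq> {..<N}"
  shows "scaled (\<lambda>z. h z S)"
proof -
  define X where "X = {S. S \<subset> {..<N} \<and> S \<noteq> {}}"
  define Y where "Y = {{}, {..<N}}"
  have XY: "X \<union> Y = Pow {..<N}" by (auto simp: X_def Y_def)
  define q where "q S T z = (if S \<subseteq> {..<N} then \<Sum>v<N. if flip S v = T then rate (A z) (B z) S v else 0 else 0)" for S T z
  have hz: "h z {} = 0" "h z {..<N} = 1" "S \<subseteq> {..<N} \<Longrightarrow> gen {..<N} (A z) (B z) (h z) S = 0" if "z \<in> pbox" for z S
    using harm[OF that] by (auto simp: attractive_spins.harmonic_def[OF spins[OF that]])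
  have rcls: "scaled (\<lambda>z. rate (A z) (B z) S v)" if "S \<subseteq> {..<N}" "v < N" for S v
    using A[OF that] B[OF that] by (cases "v \<in> S") (simp_all add: rate_def)
  have qcls: "scaled (q S T)" for S T
  proof (cases "S \<subseteq> {..<N}")
    case True
    have "scaled (\<lambda>z. if flip S v = T then rate (A z) (B z) S v else 0)" if "v \<in> {..<N}" for v
      using rcls[OF True, of v] that scaled_const[of 0] by (cases "flip S v = T") simp_all
    hence "scaled (\<lambda>z. \<Sum>v<N. if flip S v = T then rate (A z) (B z) S v else 0)" by (rule scaled_sum)
    thus ?thesis using True by (simp add: q_def[abs_def])
  next
    case False thus ?thesis using scaled_const[of 0] by (simp add: q_def[abs_def])
  qed
  have eq: "(\<Sum>T\<in>X \<union> Y. q S T z * (h z T - h z S)) = 0" if z: "z \<in> pbox" and S: "S \<in> X" for z S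
  proof -
    have SN: "S \<subseteq> {..<N}" using S by (auto simp: X_def)
    have "(\<Sum>T\<in>X \<union> Y. q S T z * (h z T - h z S))
      = (\<Sum>T\<in>Pow {..<N}. \<Sum>v<N. if flip S v = T then rate (A z) (B z) S v * (h z T - h z S) else 0)"
      unfolding XY using SN by (auto simp: q_def sum_distrib_right intro!: sum.cong)
    also have "\<dots> = (\<Sum>v<N. \<Sum>T\<in>Pow {..<N}. if flip S v = T then rate (A z) (B z) S v * (h z T - h z S) else 0)"
      by (rule sum.swap)
    also have "\<dots> = (\<Sum>v<N. rate (A z) (B z) S v * (h z (flip S v) - h z S))"
    proof (intro sum.cong refl)
      fix v assume "v \<in> {..<N}"
      hence "flip S v \<in> Pow {..<N}" using SN by (auto simp: flip_def)
      thus "(\<Sum>T\<in>Pow {..<N}. if flip S v = T then rate (A z) (B z) S v * (h z T - h z S) else 0) = rate (A z) (B z) S v * (h z (flip S v) - h z S)"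
        by (simp add: sum.delta')
    qed
    also have "\<dots> = 0" using hz(3)[OF z SN] SN by (simp add: gen_flip)
    finally show ?thesis .
  qed
  have nc: "\<exists>S\<in>W. \<exists>T\<in>(X \<union> Y) - W. pos_scaled (q S T)" if W: "W \<subseteq> X" "W \<noteq> {}" for W
  proof -
    have "finite W" by (rule finite_subset[of _ "Pow {..<N}"]) (use W XY in auto)
    hence "Max (card ` W) \<in> card ` W" and fW: "finite (card ` W)" using W by auto
    then obtain S where S: "S \<in> W" "card S = Max (card ` W)" by auto
    have SX: "S \<subset> {..<N}" "S \<noteq> {}" using S W by (auto simp: X_def)
    have fS: "finite S" using SX finite_subset by blast
    interpret attractive_spins "{..<N}" "A (1,1)" "B (1,1)" by (rule spins[OF pbox_ex])
    obtain v where v: "v \<in> {..<N} - S" "0 < A (1,1) S v" using up[OF SX] by blast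
    have "insert v S \<notin> W"
    proof
      assume "insert v S \<in> W"
      hence "card (insert v S) \<le> card S" using S(2) fW by auto
      thus False using v fS by simp
    qed
    moreover have "insert v S \<in> X \<union> Y" unfolding XY using v SX by auto
    moreover have "pos_scaled (q S (insert v S))"
    proof -
      have SN: "S \<subseteq> {..<N}" using SX by auto
      have nn: "0 \<le> rate (A (1,1)) (B (1,1)) S u" if "u < N" for u
        using A_nonneg[OF SN] B_nonneg[OF SN] that by (auto simp: rate_def)
      have "0 < (\<Sum>u<N. if flip S u = insert v S then rate (A (1,1)) (B (1,1)) S u else 0)"
        by (rule sum_pos2[of _ v]) (use v nn in \<open>auto simp: flip_def rate_def\<close>)
      hence "0 < q S (insert v S) (1,1)" using SN by (simp add: q_def)
      thus ?thesis using scaled_pcls_iff[OF qcls pbox_ex] by blast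
    qed
    ultimately show ?thesis using S(1) by blast
  qed
  have Ycls: "scaled (\<lambda>z. h z T)" if "T \<in> Y" for T
    using that
  proof (cases "T = {}")
    case True
    show ?thesis by (rule scaled_cong[OF _ scaled_const[of 0]]) (use hz(1) True in auto)
  next
    case False
    hence "T = {..<N}" using that by (auto simp: Y_def)
    thus ?thesis by (intro scaled_cong[OF _ scaled_const[of 1]]) (use hz(2) in auto)
  qed
  have fX: "finite X" by (rule finite_subset[of _ "Pow {..<N}"]) (use XY in auto)
  have Xcls: "scaled (\<lambda>z. h z T)" if "T \<in> X" for T
    by (rule scaled_elimination[where q = q and Y = Y and X = X and h = "\<lambda>S z. h z S", OF fX _ _ qcls eq nc Ycls that])
       (auto simp: X_def Y_def)
  show ?thesis using Xcls[of S] Ycls[of S] S XY by blast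
qed

lemma scaled_snd: "scaled snd" by (rule pos_scaled_cls[OF pos_scaled_snd])

locale weight_family =
  fixes N :: nat and W :: "real \<Rightarrow> nat \<Rightarrow> nat \<Rightarrow> real"
  assumes W: "\<And>u v. scaled (\<lambda>z. W (fst z) u v)"
    and graph: "\<And>t. 0 < t \<Longrightarrow> t \<le> 1 \<Longrightarrow> weighted_graph N (W t)"
    and conn: "\<And>t. 0 < t \<Longrightarrow> t \<le> 1 \<Longrightarrow> graph_connected N (W t)"
    and N2: "2 \<le> N"
begin

lemma wg: "z \<in> pbox \<Longrightarrow> wgraph N (W (fst z)) (snd z)"
  using graph conn N2 by unfold_locales (auto simp: pbox_def)

lemma wdeg_cls: "scaled (\<lambda>z. wdeg N (W (fst z)) u)"
  unfolding wdeg_def by (intro scaled_sum W)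

lemma Bd_extends:
  assumes S: "S \<subseteq> {..<N}"
  shows "\<exists>F. r_regular F \<and> (\<forall>z\<in>pbox. F z = fixation N (trans_Bd N (W (fst z)) (snd z)) S)"
proof -
  have c: "scaled (\<lambda>z. fixation N (trans_Bd N (W (fst z)) (snd z)) S)"
  proof (rule spins_cls[OF _ _ _ _ S])
    show "attractive_spins {..<N} (up_Bd N (W (fst z)) (snd z)) (dn_Bd N (W (fst z)) (snd z))" if "z \<in> pbox" for z
      by (rule wgraph.spins_Bd[OF wg[OF that]])
    show "attractive_spins.harmonic {..<N} (up_Bd N (W (fst z)) (snd z)) (dn_Bd N (W (fst z)) (snd z)) (fixation N (trans_Bd N (W (fst z)) (snd z)))"
      if "z \<in> pbox" for z by (rule wgraph.harmonic_Bd[OF wg[OF that]])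
    show "scaled (\<lambda>z. up_Bd N (W (fst z)) (snd z) S v)" for S v
      unfolding up_Bd_def by (intro scaled_sum scaled_divide scaled_mult W wdeg_cls scaled_snd)
    show "scaled (\<lambda>z. dn_Bd N (W (fst z)) (snd z) S v)" for S v
      unfolding dn_Bd_def by (intro scaled_sum scaled_divide scaled_mult W wdeg_cls scaled_snd)
  qed
  show ?thesis
  proof (rule scaled_bounded_extends[OF c])
    show "fixation N (trans_Bd N (W (fst z)) (snd z)) S \<le> 1" if "z \<in> pbox" for z
      by (rule stochastic.fixation_bounds(2)[OF wgraph.stochastic_Bd[OF wg[OF that]] S])
  qed blast
qed

lemma dB_extends:
  assumes S: "S \<subseteq> {..<N}"
  shows "\<exists>F. r_regular F \<and> (\<forall>z\<in>pbox. F z = fixation N (trans_dB N (W (fst z)) (snd z)) S)"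
proof -
  have c: "scaled (\<lambda>z. fixation N (trans_dB N (W (fst z)) (snd z)) S)"
  proof (rule spins_cls[OF _ _ _ _ S])
    show "attractive_spins {..<N} (up_dB N (W (fst z)) (snd z)) (dn_dB N (W (fst z)) (snd z))" if "z \<in> pbox" for z
      by (rule wgraph.spins_dB[OF wg[OF that]])
    show "attractive_spins.harmonic {..<N} (up_dB N (W (fst z)) (snd z)) (dn_dB N (W (fst z)) (snd z)) (fixation N (trans_dB N (W (fst z)) (snd z)))"
      if "z \<in> pbox" for z by (rule wgraph.harmonic_dB[OF wg[OF that]])
    show "scaled (\<lambda>z. up_dB N (W (fst z)) (snd z) S v)" for S v
      unfolding up_dB_def by (intro scaled_sum scaled_divide scaled_mult scaled_add W wdeg_cls scaled_snd)
    show "scaled (\<lambda>z. dn_dB N (W (fst z)) (snd z) S v)" for S v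
      unfolding dn_dB_def by (intro scaled_sum scaled_divide scaled_mult scaled_add W wdeg_cls scaled_snd)
  qed
  show ?thesis
  proof (rule scaled_bounded_extends[OF c])
    show "fixation N (trans_dB N (W (fst z)) (snd z)) S \<le> 1" if "z \<in> pbox" for z
      by (rule stochastic.fixation_bounds(2)[OF wgraph.stochastic_dB[OF wg[OF that]] S])
  qed blast
qed

end

lemma r_regular_sum: "(\<And>i. i \<in> I \<Longrightarrow> r_regular (f i)) \<Longrightarrow> r_regular (\<lambda>z. \<Sum>i\<in>I. f i z)"
  by (induction I rule: infinite_finite_induct) (auto intro: r_regular_const r_regular_add)

lemma r_regular_tendsto:
  assumes "r_regular F" "1 \<le> r" "r \<le> 6/5"
  shows "((\<lambda>t. F (t, r)) \<longlongrightarrow> F (0, r)) (at_right 0)"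
proof -
  have c: "continuous_on rbox F" using assms(1) by (simp add: r_regular_def)
  have "continuous_on {0..1} (\<lambda>t. F (t, r))"
    by (rule continuous_on_compose2[OF c]) (use assms in \<open>auto intro!: continuous_intros simp: rbox_def\<close>)
  hence "((\<lambda>t. F (t, r)) \<longlongrightarrow> F (0, r)) (at 0 within {0..1})" by (simp add: continuous_on)
  thus ?thesis by (simp add: at_within_Icc_at_right)
qed

lemma r_regular_zero_eq:
  assumes "r_regular F" "r_regular G" "1 \<le> r" "r \<le> 6/5" "\<And>t. 0 < t \<Longrightarrow> t \<le> 1 \<Longrightarrow> F (t, r) = G (t, r)"
  shows "F (0, r) = G (0, r)"
proof -
  have ev: "eventually (\<lambda>t. F (t, r) = G (t, r)) (at_right 0)"
    using assms(5) by (auto simp: eventually_at_right[of 0 1] intro!: exI[of _ 1])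
  have "((\<lambda>t. F (t, r)) \<longlongrightarrow> G (0, r)) (at_right 0)"
    unfolding tendsto_cong[OF ev] by (rule r_regular_tendsto[OF assms(2-4)])
  thus ?thesis by (rule tendsto_unique[OF trivial_limit_at_right_real r_regular_tendsto[OF assms(1,3,4)]])
qed

lemma uniform_comparison:
  assumes F: "r_regular F" and G: "r_regular G" and base: "\<And>t. 0 < t \<Longrightarrow> t \<le> 1 \<Longrightarrow> F (t, 1) = G (t, 1)"
    and c: "0 < c" and gap: "\<And>r. 1 < r \<Longrightarrow> r \<le> 6/5 \<Longrightarrow> G (0, r) + c * (r - 1) \<le> F (0, r)"
  shows "eventually (\<lambda>t. \<forall>r. 1 < r \<longrightarrow> r \<le> 6/5 \<longrightarrow> G (t, r) < F (t, r)) (at_right 0)"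
proof -
  obtain F' where F': "continuous_on rbox F'" "\<And>z. z \<in> rbox \<Longrightarrow> F z = F (fst z, 1) + (snd z - 1) * F' z"
    using F unfolding r_regular_def by metis
  obtain G' where G': "continuous_on rbox G'" "\<And>z. z \<in> rbox \<Longrightarrow> G z = G (fst z, 1) + (snd z - 1) * G' z"
    using G unfolding r_regular_def by metis
  define D where "D z = F' z - G' z" for z
  have D: "continuous_on rbox D" unfolding D_def by (intro continuous_intros F' G')
  have base0: "F (0, 1) = G (0, 1)" by (rule r_regular_zero_eq[OF F G _ _ base]) auto
  have FG: "F (t, r) - G (t, r) = (r - 1) * D (t, r)" if "0 \<le> t" "t \<le> 1" "1 \<le> r" "r \<le> 6/5" for t r
  proof -
    have z: "(t, r) \<in> rbox" using that by (simp add: rbox_def)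
    have "F (t, 1) = G (t, 1)" using base[of t] base0 that by (cases "t = 0") auto
    thus ?thesis using F'(2)[OF z] G'(2)[OF z] by (simp add: D_def right_diff_distrib)
  qed
  have Dc: "c \<le> D (0, r)" if "1 < r" "r \<le> 6/5" for r
  proof -
    have "F (0, r) - G (0, r) = (r - 1) * D (0, r)" by (rule FG) (use that in auto)
    hence "c * (r - 1) \<le> D (0, r) * (r - 1)" unfolding mult.commute[of "D (0, r)"] using gap[OF that] by linarith
    thus ?thesis using that by (intro mult_right_le_imp_le[of c "r - 1"]) auto
  qed
  have "continuous_on {1..6/5} (\<lambda>r. D (0, r))"
    by (rule continuous_on_compose2[OF D]) (auto intro!: continuous_intros simp: rbox_def)
  hence "((\<lambda>r. D (0, r)) \<longlongrightarrow> D (0, 1)) (at 1 within {1..6/5})" by (simp add: continuous_on)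
  hence "((\<lambda>r. D (0, r)) \<longlongrightarrow> D (0, 1)) (at_right 1)" by (simp add: at_within_Icc_at_right)
  hence "c \<le> D (0, 1)"
    by (rule tendsto_lowerbound) (auto simp: eventually_at_right[of 1 "6/5"] intro!: exI[of _ "6/5"] Dc)
  hence Dc: "c \<le> D (0, r)" if "1 \<le> r" "r \<le> 6/5" for r using Dc[of r] that by (cases "r = 1") auto
  have "compact rbox" unfolding rbox_def by (intro compact_Times) auto
  hence "uniformly_continuous_on rbox D" using D compact_uniformly_continuous by blast
  then obtain d where d: "0 < d" "\<And>z z'. z \<in> rbox \<Longrightarrow> z' \<in> rbox \<Longrightarrow> dist z' z < d \<Longrightarrow> dist (D z') (D z) < c"
    unfolding uniformly_continuous_on_def using c by metis
  have "G (t, r) < F (t, r)" if t: "0 < t" "t < min d 1" and r: "1 < r" "r \<le> 6/5" for t r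
  proof -
    have "dist (t, r) (0, r) < d" using t by (simp add: dist_Pair_Pair dist_real_def)
    hence "dist (D (t, r)) (D (0, r)) < c" using t r by (intro d(2)) (auto simp: rbox_def)
    hence "0 < D (t, r)" using Dc[of r] r by (simp add: dist_real_def)
    hence "0 < (r - 1) * D (t, r)" using r by simp
    thus ?thesis using FG[of t r] t r by simp
  qed
  thus ?thesis using d(1) by (auto simp: eventually_at_right[of 0 1] intro!: exI[of _ "min d 1"])
qed

lemma complete_weighted: "weighted_graph N complete_graph"
  by (auto simp: weighted_graph_def complete_graph_def)

lemma complete_connected: "graph_connected N complete_graph"
  unfolding graph_connected_def
proof (intro allI impI)
  fix u v assume "u < N" "v < N"
  thus "(u, v) \<in> {(a, b). a < N \<and> b < N \<and> 0 < complete_graph a b}\<^sup>*"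
    by (cases "u = v") (auto simp: complete_graph_def)
qed

lemma complete_sums:
  assumes S: "S \<subseteq> {..<N}"
  shows "v \<in> {..<N} - S \<Longrightarrow> (\<Sum>u\<in>S. complete_graph u v) = card S"
    "v \<in> S \<Longrightarrow> (\<Sum>u\<in>S. complete_graph u v) = real (card S) - 1"
    "v \<in> {..<N} - S \<Longrightarrow> (\<Sum>u\<in>{..<N} - S. complete_graph u v) = real N - card S - 1"
    "v \<in> S \<Longrightarrow> (\<Sum>u\<in>{..<N} - S. complete_graph u v) = real N - card S"
proof -
  have fS: "finite S" using S finite_subset by blast
  have in_: "(\<Sum>u\<in>T. complete_graph u v) = real (card T) - 1" if "finite T" "v \<in> T" for T v
  proof -
    have "(\<Sum>u\<in>T. complete_graph u v) = (\<Sum>u\<in>T - {v}. 1)"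
      using that by (intro sum.mono_neutral_cong_right) (auto simp: complete_graph_def)
    moreover have "0 < card T" using that by (auto simp: card_gt_0_iff)
    ultimately show ?thesis using that by (simp add: of_nat_diff)
  qed
  have out: "(\<Sum>u\<in>T. complete_graph u v) = real (card T)" if "v \<notin> T" for T v
  proof -
    have "(\<Sum>u\<in>T. complete_graph u v) = (\<Sum>u\<in>T. 1)" using that by (intro sum.cong) (auto simp: complete_graph_def)
    thus ?thesis by simp
  qed
  have cc: "real (card ({..<N} - S)) = real N - card S"
    using card_mono[OF _ S] S fS by (simp add: card_Diff_subset of_nat_diff)
  show "v \<in> {..<N} - S \<Longrightarrow> (\<Sum>u\<in>S. complete_graph u v) = card S" using out by auto
  show "v \<in> S \<Longrightarrow> (\<Sum>u\<in>S. complete_graph u v) = real (card S) - 1" using in_[OF fS, of v] by auto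
  show "v \<in> {..<N} - S \<Longrightarrow> (\<Sum>u\<in>{..<N} - S. complete_graph u v) = real N - card S - 1" using in_[of "{..<N} - S" v] cc by auto
  show "v \<in> S \<Longrightarrow> (\<Sum>u\<in>{..<N} - S. complete_graph u v) = real N - card S" using out[of v "{..<N} - S"] cc by auto
qed

lemma complete_fixation_le:
  assumes "wgraph N complete_graph r"
  shows "rho_Bd r N complete_graph \<le> 1 / (\<Sum>i<N. (1/r) ^ i)" (is ?Bd)
    and "rho_dB r N complete_graph \<le> 1 / (\<Sum>i<N. (1/r) ^ i)" (is ?dB)
proof -
  interpret g: wgraph N complete_graph r by (rule assms)
  have r: "1 \<le> r" and N: "2 \<le> N" by (rule g.r, rule g.N2)
  have x0: "0 < 1 / r" using r by simp
  have deg: "wdeg N complete_graph u = real N - 1" if "u < N" for u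
    using complete_sums(2)[OF order_refl, of u N] that N g.in_wdeg[OF that] by (simp add: of_nat_diff)
  define W where "W = (\<Sum>i<N. (1/r) ^ i)"
  have W: "0 < W" unfolding W_def using x0 N by (intro sum_pos) (auto simp: lessThan_empty_iff)
  have fix1: "fixation N (trans_Bd N complete_graph r) {v} \<le> 1 / W" if v: "v < N" for v
  proof -
    have "fixation N (trans_Bd N complete_graph r) {v} \<le> (\<Sum>i<card {v}. (1/r) ^ i) / W"
    proof (rule attractive_spins.harmonic_le_superharmonic[OF g.spins_Bd g.harmonic_Bd, where g = "\<lambda>S. (\<Sum>i<card S. (1/r) ^ i) / W"])
      fix S assume S: "S \<subset> {..<N}" "S \<noteq> {}"
      hence SN: "S \<subseteq> {..<N}" by auto
      have "gen {..<N} (up_Bd N complete_graph r) (dn_Bd N complete_graph r) (\<lambda>S. (\<Sum>i<card S. (1/r) ^ i) / W) S = 0"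
      proof (rule clique_harmonic[where \<alpha> = "\<lambda>k. r * k / (real N - 1)" and \<beta> = "\<lambda>k. (real N - k) / (real N - 1)"])
        show "real (card {..<N} - Suc k) * (r * real (Suc k) / (real N - 1)) * (1/r) ^ Suc k
          = real (Suc k) * ((real N - real (Suc k)) / (real N - 1)) * (1/r) ^ k" if "Suc k < card {..<N}" for k
          using balance_Bd[of r k N] that r by simp
        show "up_Bd N complete_graph r S v = r * real (card S) / (real N - 1)" if "v \<in> {..<N} - S" for v
        proof -
          have "up_Bd N complete_graph r S v = (\<Sum>u\<in>S. r * complete_graph u v / (real N - 1))"
            unfolding up_Bd_def using SN deg by (intro sum.cong) auto
          also have "\<dots> = r * (\<Sum>u\<in>S. complete_graph u v) / (real N - 1)" by (simp add: sum_divide_distrib sum_distrib_left)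
          finally show ?thesis using complete_sums(1)[OF SN that] by simp
        qed
        show "dn_Bd N complete_graph r S v = (real N - real (card S)) / (real N - 1)" if "v \<in> S" for v
        proof -
          have "dn_Bd N complete_graph r S v = (\<Sum>u\<in>{..<N} - S. complete_graph u v / (real N - 1))"
            unfolding dn_Bd_def using deg by (intro sum.cong) auto
          also have "\<dots> = (\<Sum>u\<in>{..<N} - S. complete_graph u v) / (real N - 1)" by (simp add: sum_divide_distrib)
          finally show ?thesis using complete_sums(4)[OF SN that] by simp
        qed
      qed (use S in auto)
      thus "gen {..<N} (up_Bd N complete_graph r) (dn_Bd N complete_graph r) (\<lambda>S. (\<Sum>i<card S. (1/r) ^ i) / W) S \<le> 0" by simp
    qed (use W v in \<open>auto simp: W_def\<close>)
    thus ?thesis by simp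
  qed
  have "(\<Sum>v<N. fixation N (trans_Bd N complete_graph r) {v}) \<le> (\<Sum>v<N. 1 / W)" using fix1 by (intro sum_mono) auto
  hence "rho_Bd r N complete_graph \<le> 1 / N * (N * (1 / W))" unfolding rho_Bd_def by (intro mult_left_mono) auto
  thus ?Bd using N by (simp add: W_def)
  define W' where "W' = (\<Sum>i<N. om_dB N r i)"
  have om: "(real N - 1) * (1/r) ^ i \<le> om_dB N r i" for i
    unfolding om_dB_def using r x0 by (simp add: mult.commute[of "real N - 1"] mult_le_cancel_left_pos del: power_one_over)
  have WW: "(real N - 1) * W \<le> W'" unfolding W_def W'_def sum_distrib_left by (intro sum_mono om)
  have W': "0 < W'" 
  proof -
    have "0 < (real N - 1) * W" using W N by (intro mult_pos_pos) auto
    thus ?thesis using WW by linarith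
  qed
  have fix2: "fixation N (trans_dB N complete_graph r) {v} \<le> 1 / W" if v: "v < N" for v
  proof -
    have "fixation N (trans_dB N complete_graph r) {v} \<le> (\<Sum>i<card {v}. om_dB N r i) / W'"
    proof (rule attractive_spins.harmonic_le_superharmonic[OF g.spins_dB g.harmonic_dB, where g = "\<lambda>S. (\<Sum>i<card S. om_dB N r i) / W'"])
      fix S assume S: "S \<subset> {..<N}" "S \<noteq> {}"
      hence SN: "S \<subseteq> {..<N}" by auto
      have "gen {..<N} (up_dB N complete_graph r) (dn_dB N complete_graph r) (\<lambda>S. (\<Sum>i<card S. om_dB N r i) / W') S = 0"
      proof (rule clique_harmonic[where \<alpha> = "\<lambda>k. r * k / (r * k + (real N - 1 - k))" and \<beta> = "\<lambda>k. (real N - k) / (r * (real k - 1) + (real N - k))"])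
        show "real (card {..<N} - Suc k) * (r * real (Suc k) / (r * real (Suc k) + (real N - 1 - real (Suc k)))) * om_dB N r (Suc k)
          = real (Suc k) * ((real N - real (Suc k)) / (r * (real (Suc k) - 1) + (real N - real (Suc k)))) * om_dB N r k" if "Suc k < card {..<N}" for k
          using balance_dB[of r k N] that r by simp
        show "up_dB N complete_graph r S v = r * real (card S) / (r * real (card S) + (real N - 1 - real (card S)))" if "v \<in> {..<N} - S" for v
          unfolding up_dB_def sum_distrib_left[symmetric] complete_sums(1)[OF SN that] complete_sums(3)[OF SN that] by (simp add: algebra_simps)
        show "dn_dB N complete_graph r S v = (real N - real (card S)) / (r * (real (card S) - 1) + (real N - real (card S)))" if "v \<in> S" for v
          unfolding dn_dB_def sum_distrib_left[symmetric] complete_sums(2)[OF SN that] complete_sums(4)[OF SN that] by simp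
      qed (use S in auto)
      thus "gen {..<N} (up_dB N complete_graph r) (dn_dB N complete_graph r) (\<lambda>S. (\<Sum>i<card S. om_dB N r i) / W') S \<le> 0" by simp
    qed (use W' v in \<open>auto simp: W'_def\<close>)
    also have "\<dots> = (real N - 1) / W'" by (simp add: om_dB_def)
    also have "\<dots> \<le> 1 / W" using WW W W' by (simp add: field_simps)
    finally show ?thesis .
  qed
  have "(\<Sum>v<N. fixation N (trans_dB N complete_graph r) {v}) \<le> (\<Sum>v<N. 1 / W)" using fix2 by (intro sum_mono) auto
  hence "rho_dB r N complete_graph \<le> 1 / N * (N * (1 / W))" unfolding rho_dB_def by (intro mult_left_mono) auto
  thus ?dB using N by (simp add: W_def)
qed

subsection \<open>The amplifier theorem\<close>

lemma scaled_if: "scaled f \<Longrightarrow> scaled g \<Longrightarrow> scaled (\<lambda>z. if P then f z else g z)"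
  by (cases P) simp_all

lemma scaled_fst_power: "scaled (\<lambda>z. fst z ^ k)" by (rule pos_scaled_cls[OF pos_scaled_fst_power])

lemma scaled_fst: "scaled fst" using scaled_fst_power[of 1] by simp

lemma amp_family:
  assumes "2 \<le> H" "1 \<le> n" "N = H + 4 * n"
  shows "weight_family N (amp_weight H n)"
proof
  have amp: "amp H n N t" if "0 < t" "t \<le> 1" for t using assms that by unfold_locales
  show "scaled (\<lambda>z. amp_weight H n (fst z) u v)" for u v
    unfolding amp_weight_def by (intro scaled_if scaled_const scaled_fst_power scaled_fst) auto
  show "weighted_graph N (amp_weight H n t)" if "0 < t" "t \<le> 1" for t by (rule amp.weighted[OF amp[OF that]])
  show "graph_connected N (amp_weight H n t)" if "0 < t" "t \<le> 1" for t by (rule amp.connected[OF amp[OF that]])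
  show "2 \<le> N" using assms by simp
qed

lemma complete_family: "2 \<le> N \<Longrightarrow> weight_family N (\<lambda>_. complete_graph)"
proof
  show "scaled (\<lambda>z. complete_graph u v)" for u v by (rule scaled_const) (simp add: complete_graph_def)
qed (auto simp: complete_weighted complete_connected)

lemma amplifier_comparison:
  fixes fx :: "real \<Rightarrow> real \<Rightarrow> nat set \<Rightarrow> real" and fxK :: "real \<Rightarrow> nat set \<Rightarrow> real"
  assumes N: "N = 4 * n + m - 2" and m: "20 \<le> m" "m \<le> 23" and n: "100 \<le> n"
    and ext: "\<And>S. S \<subseteq> {..<N} \<Longrightarrow> \<exists>F. r_regular F \<and> (\<forall>z\<in>pbox. F z = fx (fst z) (snd z) S)"
    and extK: "\<And>S. S \<subseteq> {..<N} \<Longrightarrow> \<exists>F. r_regular F \<and> (\<forall>z\<in>pbox. F z = fxK (snd z) S)"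
    and nonneg: "\<And>t r S. 0 < t \<Longrightarrow> t \<le> 1 \<Longrightarrow> 1 \<le> r \<Longrightarrow> S \<subseteq> {..<N} \<Longrightarrow> 0 \<le> fx t r S"
    and neutral: "\<And>t. 0 < t \<Longrightarrow> t \<le> 1 \<Longrightarrow> 1 / real N * (\<Sum>v<N. fx t 1 {v}) = 1 / real N"
    and neutralK: "1 / real N * (\<Sum>v<N. fxK 1 {v}) = 1 / real N"
    and P: "P \<subseteq> {..<N}" "card P = 2 * n"
    and lower: "\<And>r h0 v. 1 \<le> r \<Longrightarrow> (\<And>S. S \<subseteq> {..<N} \<Longrightarrow> ((\<lambda>t. fx t r S) \<longlongrightarrow> h0 S) (at_right 0)) \<Longrightarrow> v \<in> P
       \<Longrightarrow> 1 / 2 / (\<Sum>i<n. ((1/r) ^ m) ^ i) \<le> h0 {v}"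
    and upper: "\<And>r. 1 \<le> r \<Longrightarrow> 1 / real N * (\<Sum>v<N. fxK r {v}) \<le> 1 / (\<Sum>i<N. (1/r) ^ i)"
  shows "eventually (\<lambda>t. \<forall>r. 1 < r \<longrightarrow> r \<le> 6/5 \<longrightarrow> 1 / real N * (\<Sum>v<N. fxK r {v}) < 1 / real N * (\<Sum>v<N. fx t r {v})) (at_right 0)"
proof -
  have ev1: "eventually (\<lambda>t. 0 < t \<and> t \<le> 1) (at_right (0::real))"
    by (auto simp: eventually_at_right[of 0 1] intro!: exI[of _ 1])
  have "\<forall>S\<in>Pow {..<N}. \<exists>F. r_regular F \<and> (\<forall>z\<in>pbox. F z = fx (fst z) (snd z) S)" using ext by blast
  from bchoice[OF this] obtain Fs where Fs: "\<And>S. S \<subseteq> {..<N} \<Longrightarrow> r_regular (Fs S)"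
    "\<And>S z. S \<subseteq> {..<N} \<Longrightarrow> z \<in> pbox \<Longrightarrow> Fs S z = fx (fst z) (snd z) S" by auto
  have "\<forall>S\<in>Pow {..<N}. \<exists>F. r_regular F \<and> (\<forall>z\<in>pbox. F z = fxK (snd z) S)" using extK by blast
  from bchoice[OF this] obtain Gs where Gs: "\<And>S. S \<subseteq> {..<N} \<Longrightarrow> r_regular (Gs S)"
    "\<And>S z. S \<subseteq> {..<N} \<Longrightarrow> z \<in> pbox \<Longrightarrow> Gs S z = fxK (snd z) S" by auto
  define F where "F z = 1 / real N * (\<Sum>v<N. Fs {v} z)" for z
  define G where "G z = 1 / real N * (\<Sum>v<N. Gs {v} z)" for z
  have niceF: "r_regular F" unfolding F_def by (intro r_regular_mult r_regular_const r_regular_sum Fs) auto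
  have niceG: "r_regular G" unfolding G_def by (intro r_regular_mult r_regular_const r_regular_sum Gs) auto
  have pb: "(t, r) \<in> pbox" if "0 < t" "t \<le> 1" "1 \<le> r" "r \<le> 6/5" for t r using that by (simp add: pbox_def)
  have Feq: "F (t, r) = 1 / real N * (\<Sum>v<N. fx t r {v})" if "0 < t" "t \<le> 1" "1 \<le> r" "r \<le> 6/5" for t r
    unfolding F_def using Fs(2)[OF _ pb[OF that]] by simp
  have Geq: "G (t, r) = 1 / real N * (\<Sum>v<N. fxK r {v})" if "0 < t" "t \<le> 1" "1 \<le> r" "r \<le> 6/5" for t r
    unfolding G_def using Gs(2)[OF _ pb[OF that]] by simp
  have Fslim: "((\<lambda>t. fx t r S) \<longlongrightarrow> Fs S (0, r)) (at_right 0)" if r: "1 \<le> r" "r \<le> 6/5" and S: "S \<subseteq> {..<N}" for r S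
    by (rule tendsto_on_unit[OF _ r_regular_tendsto[OF Fs(1)[OF S] r]]) (use Fs(2)[OF S pb[OF _ _ r]] in simp)
  obtain c where c: "0 < c" "\<And>r. 1 < r \<Longrightarrow> r \<le> 6/5 \<Longrightarrow>
     1 / (\<Sum>j<N. (1/r) ^ j) + c * (r - 1) \<le> real n / (real N * (\<Sum>l<n. ((1/r) ^ m) ^ l))"
    using geometric_comparison[OF N m n] by blast
  have "eventually (\<lambda>t. \<forall>r. 1 < r \<longrightarrow> r \<le> 6/5 \<longrightarrow> G (t, r) < F (t, r)) (at_right 0)"
  proof (rule uniform_comparison[OF niceF niceG _ c(1)])
    show "F (t, 1) = G (t, 1)" if "0 < t" "t \<le> 1" for t
    proof -
      have 1: "(1::real) \<le> 6/5" by simp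
      show ?thesis unfolding Feq[OF that order_refl 1] Geq[OF that order_refl 1] neutral[OF that] neutralK ..
    qed
    fix r :: real assume r: "1 < r" "r \<le> 6/5"
    hence r': "1 \<le> r" by simp
    define \<Sigma> where "\<Sigma> = (\<Sum>l<n. ((1/r) ^ m) ^ l)"
    have "G (0, r) = (\<lambda>_. 1 / real N * (\<Sum>v<N. fxK r {v})) (0, r)"
      by (rule r_regular_zero_eq[OF niceG r_regular_const r' r(2)]) (rule Geq[OF _ _ r' r(2)])
    hence G0: "G (0, r) \<le> 1 / (\<Sum>i<N. (1/r) ^ i)" using upper[OF r'] by simp
    have low: "1 / 2 / \<Sigma> \<le> Fs {v} (0, r)" if "v \<in> P" for v
      unfolding \<Sigma>_def by (rule lower[OF r' _ that]) (rule Fslim[OF r' r(2)])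
    have nn: "0 \<le> Fs {v} (0, r)" if "v < N" for v
    proof -
      have vN: "{v} \<subseteq> {..<N}" using that by simp
      have "eventually (\<lambda>t. 0 \<le> fx t r {v}) (at_right 0)"
        using ev1 by eventually_elim (use nonneg[OF _ _ r' vN] in simp)
      thus ?thesis by (rule tendsto_lowerbound[OF Fslim[OF r' r(2) vN]]) simp
    qed
    have "real (2 * n) * (1 / 2 / \<Sigma>) = (\<Sum>v\<in>P. 1 / 2 / \<Sigma>)" using P by simp
    also have "\<dots> \<le> (\<Sum>v\<in>P. Fs {v} (0, r))" by (intro sum_mono low)
    also have "\<dots> \<le> (\<Sum>v<N. Fs {v} (0, r))" using P nn by (intro sum_mono2) auto
    finally have "1 / real N * (real (2 * n) * (1 / 2 / \<Sigma>)) \<le> F (0, r)" unfolding F_def by (intro mult_left_mono) auto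
    hence "real n / (real N * \<Sigma>) \<le> F (0, r)" by simp
    thus "G (0, r) + c * (r - 1) \<le> F (0, r)" using G0 c(2)[OF r] unfolding \<Sigma>_def by linarith
  qed
  with ev1 show ?thesis
  proof eventually_elim
    fix t assume t: "0 < t \<and> t \<le> 1" and *: "\<forall>r. 1 < r \<longrightarrow> r \<le> 6/5 \<longrightarrow> G (t, r) < F (t, r)"
    show "\<forall>r. 1 < r \<longrightarrow> r \<le> 6/5 \<longrightarrow> 1 / real N * (\<Sum>v<N. fxK r {v}) < 1 / real N * (\<Sum>v<N. fx t r {v})"
      using * Feq[of t] Geq[of t] t by simp
  qed
qed

lemma amplifier_Bd:
  assumes H: "18 \<le> H" "H \<le> 21" and n: "100 \<le> n" and N: "N = H + 4 * n"
  shows "eventually (\<lambda>t. \<forall>r. 1 < r \<longrightarrow> r \<le> 6/5 \<longrightarrow> rho_Bd r N complete_graph < rho_Bd r N (amp_weight H n t)) (at_right 0)"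
  unfolding rho_Bd_def
proof (rule amplifier_comparison[where m = "H + 2" and P = "{H..<H + 2 * n}"])
  interpret A: weight_family N "amp_weight H n" by (rule amp_family) (use assms in auto)
  interpret K: weight_family N "\<lambda>_. complete_graph" by (rule complete_family) (use assms in auto)
  have wg: "wgraph N (amp_weight H n t) r" if "0 < t" "t \<le> 1" "1 \<le> r" for t r
    using A.graph A.conn A.N2 that by unfold_locales
  have wgK: "wgraph N complete_graph r" if "1 \<le> r" for r
    using K.graph[of 1] K.conn[of 1] K.N2 that by unfold_locales auto
  show "N = 4 * n + (H + 2) - 2" "20 \<le> H + 2" "H + 2 \<le> 23" "100 \<le> n" using assms by auto
  show "\<exists>F. r_regular F \<and> (\<forall>z\<in>pbox. F z = fixation N (trans_Bd N (amp_weight H n (fst z)) (snd z)) S)" if "S \<subseteq> {..<N}" for S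
    by (rule A.Bd_extends[OF that])
  show "\<exists>F. r_regular F \<and> (\<forall>z\<in>pbox. F z = fixation N (trans_Bd N complete_graph (snd z)) S)" if "S \<subseteq> {..<N}" for S
    by (rule K.Bd_extends[OF that])
  show "0 \<le> fixation N (trans_Bd N (amp_weight H n t) r) S" if "0 < t" "t \<le> 1" "1 \<le> r" "S \<subseteq> {..<N}" for t r S
    by (rule stochastic.fixation_bounds(1)[OF wgraph.stochastic_Bd[OF wg[OF that(1-3)]] that(4)])
  show "1 / real N * (\<Sum>v<N. fixation N (trans_Bd N (amp_weight H n t) 1) {v}) = 1 / real N" if "0 < t" "t \<le> 1" for t
    using wgraph.rho_neutral_Bd[OF wg[OF that order_refl] refl] by (simp only: rho_Bd_def)
  show "1 / real N * (\<Sum>v<N. fixation N (trans_Bd N complete_graph 1) {v}) = 1 / real N"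
    using wgraph.rho_neutral_Bd[OF wgK[OF order_refl] refl] by (simp only: rho_Bd_def)
  show "{H..<H + 2 * n} \<subseteq> {..<N}" "card {H..<H + 2 * n} = 2 * n" using N by auto
  show "1 / 2 / (\<Sum>i<n. ((1 / r) ^ (H + 2)) ^ i) \<le> h0 {v}"
    if "1 \<le> r" "\<And>S. S \<subseteq> {..<N} \<Longrightarrow> ((\<lambda>t. fixation N (trans_Bd N (amp_weight H n t) r) S) \<longlongrightarrow> h0 S) (at_right 0)"
      "v \<in> {H..<H + 2 * n}" for r h0 v
  proof -
    interpret amp_lim H n N r using assms that(1) by unfold_locales auto
    show ?thesis by (rule Bd_limit_bound[OF that(2,3)])
  qed
  show "1 / real N * (\<Sum>v<N. fixation N (trans_Bd N complete_graph r) {v}) \<le> 1 / (\<Sum>i<N. (1 / r) ^ i)" if "1 \<le> r" for r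
    using complete_fixation_le(1)[OF wgK[OF that]] by (simp only: rho_Bd_def)
qed

lemma amplifier_dB:
  assumes H: "18 \<le> H" "H \<le> 21" and n: "100 \<le> n" and N: "N = H + 4 * n"
  shows "eventually (\<lambda>t. \<forall>r. 1 < r \<longrightarrow> r \<le> 6/5 \<longrightarrow> rho_dB r N complete_graph < rho_dB r N (amp_weight H n t)) (at_right 0)"
  unfolding rho_dB_def
proof (rule amplifier_comparison[where m = "H + 2" and P = "{H + 2 * n..<N}"])
  interpret A: weight_family N "amp_weight H n" by (rule amp_family) (use assms in auto)
  interpret K: weight_family N "\<lambda>_. complete_graph" by (rule complete_family) (use assms in auto)
  have wg: "wgraph N (amp_weight H n t) r" if "0 < t" "t \<le> 1" "1 \<le> r" for t r
    using A.graph A.conn A.N2 that by unfold_locales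
  have wgK: "wgraph N complete_graph r" if "1 \<le> r" for r
    using K.graph[of 1] K.conn[of 1] K.N2 that by unfold_locales auto
  show "N = 4 * n + (H + 2) - 2" "20 \<le> H + 2" "H + 2 \<le> 23" "100 \<le> n" using assms by auto
  show "\<exists>F. r_regular F \<and> (\<forall>z\<in>pbox. F z = fixation N (trans_dB N (amp_weight H n (fst z)) (snd z)) S)" if "S \<subseteq> {..<N}" for S
    by (rule A.dB_extends[OF that])
  show "\<exists>F. r_regular F \<and> (\<forall>z\<in>pbox. F z = fixation N (trans_dB N complete_graph (snd z)) S)" if "S \<subseteq> {..<N}" for S
    by (rule K.dB_extends[OF that])
  show "0 \<le> fixation N (trans_dB N (amp_weight H n t) r) S" if "0 < t" "t \<le> 1" "1 \<le> r" "S \<subseteq> {..<N}" for t r S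
    by (rule stochastic.fixation_bounds(1)[OF wgraph.stochastic_dB[OF wg[OF that(1-3)]] that(4)])
  show "1 / real N * (\<Sum>v<N. fixation N (trans_dB N (amp_weight H n t) 1) {v}) = 1 / real N" if "0 < t" "t \<le> 1" for t
    using wgraph.rho_neutral_dB[OF wg[OF that order_refl] refl] by (simp only: rho_dB_def)
  show "1 / real N * (\<Sum>v<N. fixation N (trans_dB N complete_graph 1) {v}) = 1 / real N"
    using wgraph.rho_neutral_dB[OF wgK[OF order_refl] refl] by (simp only: rho_dB_def)
  show "{H + 2 * n..<N} \<subseteq> {..<N}" "card {H + 2 * n..<N} = 2 * n" using N by auto
  show "1 / 2 / (\<Sum>i<n. ((1 / r) ^ (H + 2)) ^ i) \<le> h0 {v}"
    if "1 \<le> r" "\<And>S. S \<subseteq> {..<N} \<Longrightarrow> ((\<lambda>t. fixation N (trans_dB N (amp_weight H n t) r) S) \<longlongrightarrow> h0 S) (at_right 0)"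
      "v \<in> {H + 2 * n..<N}" for r h0 v
  proof -
    interpret amp_lim H n N r using assms that(1) by unfold_locales auto
    show ?thesis by (rule dB_limit_bound[OF that(2,3)])
  qed
  show "1 / real N * (\<Sum>v<N. fixation N (trans_dB N complete_graph r) {v}) \<le> 1 / (\<Sum>i<N. (1 / r) ^ i)" if "1 \<le> r" for r
    using complete_fixation_le(2)[OF wgK[OF that]] by (simp only: rho_dB_def)
qed

theorem theorem3:
  shows "\<exists>N0::nat. \<forall>N\<ge>N0. \<exists>w :: nat \<Rightarrow> nat \<Rightarrow> real.
           weighted_graph N w \<and> graph_connected N w \<and>
           (\<forall>r::real. 1 < r \<and> r < 1.2 \<longrightarrow>
              rho_Bd r N w > rho_Bd r N complete_graph \<and>
              rho_dB r N w > rho_dB r N complete_graph)"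
proof (intro exI[of _ 421] allI impI)
  fix N :: nat assume N: "421 \<le> N"
  define H where "H = 18 + (N - 18) mod 4"
  define n where "n = (N - 18) div 4"
  have H: "18 \<le> H" "H \<le> 21" unfolding H_def by auto
  have n: "100 \<le> n" unfolding n_def using N by linarith
  have NH: "N = H + 4 * n" unfolding H_def n_def using N by (simp add: mod_mult_div_eq)
  have "eventually (\<lambda>t. 0 < t \<and> t \<le> 1) (at_right (0::real))"
    by (auto simp: eventually_at_right[of 0 1] intro!: exI[of _ 1])
  from eventually_conj[OF this eventually_conj[OF amplifier_Bd[OF H n NH] amplifier_dB[OF H n NH]]]
  obtain t where t: "0 < t" "t \<le> 1"
    and Bd: "\<forall>r. 1 < r \<longrightarrow> r \<le> 6/5 \<longrightarrow> rho_Bd r N complete_graph < rho_Bd r N (amp_weight H n t)"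
    and dB: "\<forall>r. 1 < r \<longrightarrow> r \<le> 6/5 \<longrightarrow> rho_dB r N complete_graph < rho_dB r N (amp_weight H n t)"
    using eventually_happens'[OF trivial_limit_at_right_real] by blast
  interpret amp H n N t using H n NH t by unfold_locales auto
  show "\<exists>w :: nat \<Rightarrow> nat \<Rightarrow> real.
           weighted_graph N w \<and> graph_connected N w \<and>
           (\<forall>r::real. 1 < r \<and> r < 1.2 \<longrightarrow>
              rho_Bd r N w > rho_Bd r N complete_graph \<and>
              rho_dB r N w > rho_dB r N complete_graph)"
    using weighted connected Bd dB by (intro exI[of _ "amp_weight H n t"] conjI allI impI) auto
qed

end
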